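(* Let $\alpha\in\mathbb{C}$ with $\mathrm{Re}(\alpha)>0$. Then, as operators in $L^2(\mathbb{R})$, $$\mathcal{C}^\alpha=H_\alpha .$$
   Context: The Cesàro operator $\mathcal{C}$ in $L^2(\mathbb{R})$ is $(\mathcal{C}f)(x)=\frac1x\int_0^x f(t)\,dt=\int_0^1 f(ux)\,du$; it is a bounded normal operator with spectrum $\{z\in\mathbb{C}:|z-1|=1\}$. For $\mathrm{Re}(\alpha)>0$, $z^\alpha$ denotes the branch on the right half-plane $\{\mathrm{Re}(z)>0\}$ with $1^\alpha=1$, and $0^\alpha:=0$; this is a continuous function on the spectrum of $\mathcal{C}$, and $\mathcal{C}^\alpha$ is defined by the functional calculus for normal operators. The Hölder operator $H_\alpha$ is the bounded operator in $L^2(\mathbb{R})$ given by $(H_\alpha f)(x)=\frac{1}{\Gamma(\alpha)}\int_0^1\left(\log\frac1u\right)^{\alpha-1}f(ux)\,du$. *)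

theory Defs
  imports "HOL-Analysis.Analysis"
begin

definition square_integrable :: "(real \<Rightarrow> complex) \<Rightarrow> bool" where
  "square_integrable f \<longleftrightarrow>
     f \<in> borel_measurable lborel \<and> integrable lborel (\<lambda>x. (norm (f x))\<^sup>2)"

definition l2_eq :: "(real \<Rightarrow> complex) \<Rightarrow> (real \<Rightarrow> complex) \<Rightarrow> bool" where
  "l2_eq f g \<longleftrightarrow>
     square_integrable f \<and> square_integrable g \<and> (AE x in lborel. f x = g x)"

lemma square_integrable_measurable [measurable_dest]:
  "square_integrable f \<Longrightarrow> f \<in> borel_measurable lborel"
  by (simp add: square_integrable_def)

lemma borel_measurable_cnj [measurable (raw)]:
  fixes f :: "'a \<Rightarrow> complex"
  assumes "f \<in> borel_measurable M"
  shows "(\<lambda>x. cnj (f x)) \<in> borel_measurable M"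
  by (rule measurable_compose[OF assms borel_measurable_continuous_onI])
    (intro continuous_intros)

lemma square_integrable_zero: "square_integrable (\<lambda>_. 0)"
  by (simp add: square_integrable_def)

lemma square_integrable_add:
  assumes f: "square_integrable f" and g: "square_integrable g"
  shows "square_integrable (\<lambda>x. f x + g x)"
  unfolding square_integrable_def
proof
  note [measurable] = square_integrable_measurable[OF f] square_integrable_measurable[OF g]
  show "(\<lambda>x. f x + g x) \<in> borel_measurable lborel" by measurable
  have int: "integrable lborel (\<lambda>x. 2 * (norm (f x))\<^sup>2 + 2 * (norm (g x))\<^sup>2)"
    using f g by (auto simp: square_integrable_def)
  show "integrable lborel (\<lambda>x. (norm (f x + g x))\<^sup>2)"
  proof (rule Bochner_Integration.integrable_bound[OF int])
    have "(norm (f x + g x))\<^sup>2 \<le> 2 * (norm (f x))\<^sup>2 + 2 * (norm (g x))\<^sup>2" for x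
    proof -
      have "(norm (f x + g x))\<^sup>2 \<le> (norm (f x) + norm (g x))\<^sup>2"
        by (intro power_mono norm_triangle_ineq) auto
      also have "\<dots> \<le> 2 * (norm (f x))\<^sup>2 + 2 * (norm (g x))\<^sup>2"
        using sum_squares_bound[of "norm (f x)" "norm (g x)"]
        by (simp add: power2_sum)
      finally show ?thesis .
    qed
    then show "AE x in lborel. norm ((norm (f x + g x))\<^sup>2)
        \<le> norm (2 * (norm (f x))\<^sup>2 + 2 * (norm (g x))\<^sup>2)"
      by auto
  qed measurable
qed

lemma square_integrable_mult:
  assumes f: "square_integrable f"
  shows "square_integrable (\<lambda>x. c * f x)"
  using f by (auto simp: square_integrable_def norm_mult power_mult_distrib)

lemma square_integrable_product:
  assumes f: "square_integrable f" and g: "square_integrable g"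
  shows "integrable lborel (\<lambda>x. f x * cnj (g x))"
proof -
  note [measurable] = square_integrable_measurable[OF f] square_integrable_measurable[OF g]
  have int: "integrable lborel (\<lambda>x. (norm (f x))\<^sup>2 + (norm (g x))\<^sup>2)"
    using f g by (auto simp: square_integrable_def)
  show ?thesis
  proof (rule Bochner_Integration.integrable_bound[OF int])
    have "norm (f x) * norm (g x) \<le> (norm (f x))\<^sup>2 + (norm (g x))\<^sup>2" for x
    proof -
      have "0 \<le> norm (f x) * norm (g x)" by simp
      then show ?thesis
        using sum_squares_bound[of "norm (f x)" "norm (g x)"] by linarith
    qed
    then show "AE x in lborel. norm (f x * cnj (g x))
        \<le> norm ((norm (f x))\<^sup>2 + (norm (g x))\<^sup>2)"
      by (auto simp: norm_mult)
  qed measurable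
qed

quotient_type l2 = "real \<Rightarrow> complex" / partial: l2_eq
proof (rule part_equivpI)
  show "\<exists>f. l2_eq f f"
    by (rule exI[of _ "\<lambda>_. 0"]) (simp add: l2_eq_def square_integrable_zero)
  show "symp l2_eq"
    by (rule sympI) (auto simp: l2_eq_def elim: eventually_mono)
  show "transp l2_eq"
  proof (rule transpI)
    fix f g h assume "l2_eq f g" "l2_eq g h"
    then show "l2_eq f h"
      unfolding l2_eq_def by auto
  qed
qed

lift_definition scaleC :: "complex \<Rightarrow> l2 \<Rightarrow> l2" (infixr "*\<^sub>C" 75)
  is "\<lambda>c f x. c * f x"
  by (auto simp: l2_eq_def square_integrable_mult elim: eventually_mono)

lift_definition cinner :: "l2 \<Rightarrow> l2 \<Rightarrow> complex"
  is "\<lambda>f g. \<integral>x. f x * cnj (g x) \<partial>lborel"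
proof -
  fix f f' g g' :: "real \<Rightarrow> complex"
  assume h: "l2_eq f f'" "l2_eq g g'"
  then have [measurable]: "f \<in> borel_measurable lborel" "f' \<in> borel_measurable lborel"
      "g \<in> borel_measurable lborel" "g' \<in> borel_measurable lborel"
    by (auto simp: l2_eq_def square_integrable_def)
  have "AE x in lborel. f x * cnj (g x) = f' x * cnj (g' x)"
    using h unfolding l2_eq_def by auto
  then show "(\<integral>x. f x * cnj (g x) \<partial>lborel) = (\<integral>x. f' x * cnj (g' x) \<partial>lborel)"
    by (intro integral_cong_AE) auto
qed

instantiation l2 :: real_vector
begin

lift_definition zero_l2 :: l2 is "\<lambda>_. 0"
  by (simp add: l2_eq_def square_integrable_zero)

lift_definition plus_l2 :: "l2 \<Rightarrow> l2 \<Rightarrow> l2" is "\<lambda>f g x. f x + g x"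
  by (auto simp: l2_eq_def intro: square_integrable_add)

definition uminus_l2 :: "l2 \<Rightarrow> l2" where "uminus_l2 f = (- 1) *\<^sub>C f"

definition minus_l2 :: "l2 \<Rightarrow> l2 \<Rightarrow> l2" where "minus_l2 f g = f + - g"

definition scaleR_l2 :: "real \<Rightarrow> l2 \<Rightarrow> l2" where "scaleR_l2 r f = complex_of_real r *\<^sub>C f"

instance
proof
  fix a b c :: l2 and r s :: real
  show "a + b + c = a + (b + c)"
    by transfer (auto simp: l2_eq_def add.assoc intro!: square_integrable_add)
  show "a + b = b + a"
    by transfer (auto simp: l2_eq_def add.commute intro!: square_integrable_add)
  show "0 + a = a"
    by transfer (auto simp: l2_eq_def)
  show "- a + a = 0"
    unfolding uminus_l2_def
    by transfer (auto simp: l2_eq_def square_integrable_zero)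
  show "a - b = a + - b"
    by (simp add: minus_l2_def)
  show "r *\<^sub>R (a + b) = r *\<^sub>R a + r *\<^sub>R b"
    unfolding scaleR_l2_def
    by transfer (auto simp: l2_eq_def distrib_left
        intro!: square_integrable_add square_integrable_mult)
  show "(r + s) *\<^sub>R a = r *\<^sub>R a + s *\<^sub>R a"
    unfolding scaleR_l2_def
    by transfer (auto simp: l2_eq_def distrib_right
        intro!: square_integrable_add square_integrable_mult)
  show "r *\<^sub>R s *\<^sub>R a = (r * s) *\<^sub>R a"
    unfolding scaleR_l2_def
    by transfer (auto simp: l2_eq_def mult.assoc intro!: square_integrable_mult)
  show "1 *\<^sub>R a = a"
    unfolding scaleR_l2_def by transfer (auto simp: l2_eq_def)
qed

end

lemma cinner_add_left: "cinner (f + g) h = cinner f h + cinner g h"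
  by transfer (simp add: l2_eq_def distrib_right square_integrable_product)

lemma cinner_scaleC_left: "cinner (c *\<^sub>C f) g = c * cinner f g"
  by transfer (simp add: mult.assoc)

lemma cinner_commute: "cinner f g = cnj (cinner g f)"
  by transfer (simp add: mult.commute flip: Bochner_Integration.integral_cnj)

lemma cinner_self_real:
  "cinner f f = complex_of_real (Re (cinner f f))" "0 \<le> Re (cinner f f)"
  "Re (cinner f f) = 0 \<longleftrightarrow> f = 0"
proof -
  have "cinner f f = complex_of_real (Re (cinner f f)) \<and> 0 \<le> Re (cinner f f) \<and>
    (Re (cinner f f) = 0 \<longleftrightarrow> f = 0)"
  proof transfer
    fix f :: "real \<Rightarrow> complex" assume "l2_eq f f"
    then have f: "square_integrable f" and int: "integrable lborel (\<lambda>x. (norm (f x))\<^sup>2)"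
      by (auto simp: l2_eq_def square_integrable_def)
    have eq: "(\<integral>x. f x * cnj (f x) \<partial>lborel)
        = complex_of_real (\<integral>x. (norm (f x))\<^sup>2 \<partial>lborel)"
      by (simp add: complex_norm_square[symmetric] flip: integral_complex_of_real of_real_power)
    have "(\<integral>x. (norm (f x))\<^sup>2 \<partial>lborel) = 0 \<longleftrightarrow> (AE x in lborel. f x = 0)"
      by (subst integral_nonneg_eq_0_iff_AE[OF int]) auto
    then show "(\<integral>x. f x * cnj (f x) \<partial>lborel)
          = complex_of_real (Re (\<integral>x. f x * cnj (f x) \<partial>lborel)) \<and>
        0 \<le> Re (\<integral>x. f x * cnj (f x) \<partial>lborel) \<and>
        (Re (\<integral>x. f x * cnj (f x) \<partial>lborel) = 0 \<longleftrightarrow> l2_eq f (\<lambda>_. 0))"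
      using f unfolding eq l2_eq_def by (simp add: square_integrable_zero)
  qed
  then show "cinner f f = complex_of_real (Re (cinner f f))" "0 \<le> Re (cinner f f)"
    "Re (cinner f f) = 0 \<longleftrightarrow> f = 0"
    by blast+
qed

instantiation l2 :: real_inner
begin

definition inner_l2 :: "l2 \<Rightarrow> l2 \<Rightarrow> real" where "inner_l2 f g = Re (cinner f g)"

definition norm_l2 :: "l2 \<Rightarrow> real" where "norm_l2 f = sqrt (Re (cinner f f))"

definition dist_l2 :: "l2 \<Rightarrow> l2 \<Rightarrow> real" where "dist_l2 f g = norm (f - g)"

definition sgn_l2 :: "l2 \<Rightarrow> l2" where "sgn_l2 f = inverse (norm f) *\<^sub>R f"

definition uniformity_l2 :: "(l2 \<times> l2) filter" where
  "uniformity_l2 = (INF e\<in>{0 <..}. principal {(x, y). dist x y < e})"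

definition open_l2 :: "l2 set \<Rightarrow> bool" where
  "open_l2 U \<longleftrightarrow> (\<forall>x\<in>U. \<forall>\<^sub>F (x', y) in uniformity. x' = x \<longrightarrow> y \<in> U)"

instance
proof
  fix x y z :: l2 and r :: real and U :: "l2 set"
  show "dist x y = norm (x - y)" by (rule dist_l2_def)
  show "sgn x = x /\<^sub>R norm x" by (rule sgn_l2_def)
  show "(uniformity :: (l2 \<times> l2) filter) = (INF e\<in>{0 <..}. principal {(x, y). dist x y < e})"
    by (rule uniformity_l2_def)
  show "open U \<longleftrightarrow> (\<forall>x\<in>U. \<forall>\<^sub>F (x', y) in uniformity. x' = x \<longrightarrow> y \<in> U)"
    by (rule open_l2_def)
  show "inner x y = inner y x"
    by (simp add: inner_l2_def cinner_commute[of x y])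
  show "inner (x + y) z = inner x z + inner y z"
    by (simp add: inner_l2_def cinner_add_left)
  show "inner (r *\<^sub>R x) y = r * inner x y"
    by (simp add: inner_l2_def scaleR_l2_def cinner_scaleC_left)
  show "0 \<le> inner x x"
    by (simp add: inner_l2_def cinner_self_real(2))
  show "inner x x = 0 \<longleftrightarrow> x = 0"
    by (simp add: inner_l2_def cinner_self_real(3))
  show "norm x = sqrt (inner x x)"
    by (simp add: norm_l2_def inner_l2_def)
qed

end

text \<open>
  The bounded complex-linear operators are the elements of the real-linear type
  \<^typ>\<open>l2 \<Rightarrow>\<^sub>L l2\<close> that commute with complex scalars.
\<close>

definition complex_linear :: "(l2 \<Rightarrow>\<^sub>L l2) \<Rightarrow> bool" where
  "complex_linear T \<longleftrightarrow> (\<forall>c f. T (c *\<^sub>C f) = c *\<^sub>C T f)"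

definition is_adjoint :: "(l2 \<Rightarrow>\<^sub>L l2) \<Rightarrow> (l2 \<Rightarrow>\<^sub>L l2) \<Rightarrow> bool" where
  "is_adjoint S T \<longleftrightarrow> (\<forall>f g. cinner (T f) g = cinner f (S g))"

definition spectrum :: "(l2 \<Rightarrow>\<^sub>L l2) \<Rightarrow> complex set" where
  "spectrum T = {z. \<not> (\<exists>S. complex_linear S \<and>
     (\<forall>f. S (z *\<^sub>C f - T f) = f \<and> z *\<^sub>C S f - T (S f) = f))}"

text \<open>
  \<open>functional_calculus T \<Phi>\<close>: \<open>\<Phi>\<close> is an isometric unital \<open>*\<close>-homomorphism from
  the algebra of continuous functions on the spectrum of \<open>T\<close> (functions that agree on the
  spectrum being identified) to the bounded operators, and it maps the identity function to \<open>T\<close>.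
  Such a map exists exactly when \<open>T\<close> is normal, and its values on continuous functions are
  unique.
\<close>

definition functional_calculus ::
    "(l2 \<Rightarrow>\<^sub>L l2) \<Rightarrow> ((complex \<Rightarrow> complex) \<Rightarrow> (l2 \<Rightarrow>\<^sub>L l2)) \<Rightarrow> bool" where
  "functional_calculus T \<Phi> \<longleftrightarrow>
     (\<forall>f g. continuous_on (spectrum T) f \<longrightarrow> continuous_on (spectrum T) g \<longrightarrow>
        ((\<forall>z\<in>spectrum T. f z = g z) \<longrightarrow> \<Phi> f = \<Phi> g) \<and>
        \<Phi> (\<lambda>z. f z + g z) = \<Phi> f + \<Phi> g \<and>
        \<Phi> (\<lambda>z. f z * g z) = \<Phi> f o\<^sub>L \<Phi> g) \<and>
     (\<forall>f. continuous_on (spectrum T) f \<longrightarrow>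
        complex_linear (\<Phi> f) \<and>
        (\<forall>c h. \<Phi> (\<lambda>z. c * f z) h = c *\<^sub>C \<Phi> f h) \<and>
        is_adjoint (\<Phi> (\<lambda>z. cnj (f z))) (\<Phi> f) \<and>
        norm (\<Phi> f) = (SUP z\<in>spectrum T. norm (f z))) \<and>
     \<Phi> (\<lambda>_. 1) = id_blinfun \<and>
     \<Phi> (\<lambda>z. z) = T"

text \<open>\<open>apply_fun f T\<close> is the operator \<open>f(T)\<close>, for normal \<open>T\<close> and
  \<open>f\<close> continuous on its spectrum.\<close>

definition apply_fun :: "(complex \<Rightarrow> complex) \<Rightarrow> (l2 \<Rightarrow>\<^sub>L l2) \<Rightarrow> (l2 \<Rightarrow>\<^sub>L l2)" where
  "apply_fun f T = (THE S. \<exists>\<Phi>. functional_calculus T \<Phi> \<and> S = \<Phi> f)"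

text \<open>
  The interval integral is oriented, so for negative \<open>x\<close> the first integral is minus the integral
  over the interval from \<open>x\<close> to \<open>0\<close>. Changing \<open>f\<close> on a null set does not affect the integrals
  for \<open>x \<noteq> 0\<close>, so the choice of representative \<^term>\<open>rep_l2 f\<close> is immaterial.
  \<^const>\<open>Blinfun\<close> is meaningful only on bounded linear maps; both maps below are bounded
  (the second for \<open>Re \<alpha> > 0\<close>), by Minkowski's integral inequality.
\<close>

definition cesaro :: "l2 \<Rightarrow>\<^sub>L l2" where
  "cesaro = Blinfun (\<lambda>f. abs_l2 (\<lambda>x.
     (1 / complex_of_real x) * (LBINT t=0..ereal x. rep_l2 f t)))"

definition hoelder :: "complex \<Rightarrow> l2 \<Rightarrow>\<^sub>L l2" where
  "hoelder \<alpha> = Blinfun (\<lambda>f. abs_l2 (\<lambda>x.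
     (1 / Gamma \<alpha>) * (LBINT u=0..1.
        complex_of_real (ln (1 / u)) powr (\<alpha> - 1) * rep_l2 f (u * x))))"

end

theory Submission
  imports Defs
begin

text \<open>
  Why \<open>C\<^sup>\<alpha> = H\<^sub>\<alpha>\<close>. Both operators average the dilates \<open>x \<mapsto> f (u x)\<close> of a function against a kernel
  on \<open>0 < u < 1\<close>: the Cesaro operator \<open>C\<close> against the constant kernel, the Hoelder operator against
  a power of \<open>log (1/u)\<close>. Such an average \<open>A\<^sub>k\<close> acts on \<open>x \<mapsto> x\<^sup>s\<close> as multiplication by
  \<open>\<integral> k u * u\<^sup>s du\<close>. For \<open>C\<close> this number is \<open>z = 1 / (s + 1)\<close>, and in terms of \<open>z\<close> the number for
  \<open>A\<^sub>k\<close> is the Mellin transform \<open>\<integral> k u * u\<^bsup>1/z - 1\<^esup> du\<close>. So \<open>A\<^sub>k\<close> should be that function of \<open>C\<close>, and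
  for the Hoelder kernel Euler's integral evaluates it to \<open>z\<^sup>\<alpha>\<close>. Three things turn this into a proof.

  The functional calculus of \<open>C\<close>. The relations \<open>C C\<^sup>* = C\<^sup>* C = C + C\<^sup>*\<close> say that \<open>U = 1 - C\<close> is
  unitary, so the calculus should live on the circle \<open>\<bar>z - 1\<bar> = 1\<close>. The norm of a polynomial \<open>P\<close> in
  \<open>C\<close> and \<open>C\<^sup>*\<close> is the maximum on the circle of the polynomial \<open>p\<close>. The upper bound is a transference
  argument (\<open>poly_of_norm_le\<close>): the discrete Fourier transforms of the orbit \<open>U\<^sup>n f\<close>, \<open>n < N\<close>, are up to
  a bounded error eigenvectors of \<open>C\<close>, Parseval recovers \<open>\<parallel>P f\<parallel>\<close> from them, and the error is
  negligible as \<open>N\<close> grows. The lower bound (\<open>poly_of_norm_ge\<close>) uses the approximate eigenvectors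
  \<open>x\<^sup>s\<close> on \<open>(0,1)\<close>, with \<open>Re s\<close> slightly above \<open>-1/2\<close> (\<open>cesaro_powr_eigenvector\<close>). Since \<open>L\<^sup>2\<close> is
  complete and polynomials are uniformly dense, the calculus extends to all continuous functions, the
  circle is the spectrum, and the calculus is unique (\<open>spectrum_T\<close>, \<open>functional_calculus_calculus\<close>,
  \<open>apply_fun_eqI\<close>).

  Kernels as functions of \<open>C\<close>. For the kernel \<open>u\<^sup>n\<close> the average \<open>A\<^sub>n\<close> satisfies the resolvent identity
  \<open>A\<^sub>n + n C A\<^sub>n = C\<close>, whence \<open>A\<^sub>n = (z / (1 + n z))(C)\<close>, and \<open>z / (1 + n z)\<close> is the Mellin transform of
  \<open>u\<^sup>n\<close> (\<open>transforms_power\<close>). The weighted norm \<open>\<integral> \<bar>k u\<bar> u\<^bsup>-1/2\<^esup> du\<close> bounds the norm of \<open>A\<^sub>k\<close> by Schur's test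
  and the Mellin transform on the circle because \<open>Re (1/z) = 1/2\<close> there; polynomials are dense
  for this norm, so the identity \<open>A\<^sub>k = (Mellin transform of k)(C)\<close> passes to the Hoelder kernel
  (\<open>transforms_continuous_open\<close>).

  The Mellin transform of the Hoelder kernel. The substitution \<open>u = e\<^bsup>-t\<^esup>\<close> reduces it to Euler's
  integral \<open>\<integral> t\<^bsup>\<alpha> - 1\<^esup> e\<^bsup>- w t\<^esup> dt = \<Gamma>(\<alpha>) w\<^bsup>- \<alpha>\<^esup>\<close> for complex \<open>w\<close> in the right half-plane
  (\<open>laplace_integral\<close>), taken at \<open>w = 1/z\<close>.
\<close>

section \<open>The Hilbert space of square-integrable functions\<close>

lemma l2_eq_refl: "square_integrable f \<Longrightarrow> l2_eq f f"
  by (simp add: l2_eq_def)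

lemma square_integrable_rep: "square_integrable (rep_l2 f)"
  using Quotient3_rep_reflp[OF Quotient3_l2] by (auto simp: l2_eq_def)

lemma abs_rep_l2: "abs_l2 (rep_l2 f) = f"
  by (rule Quotient3_abs_rep[OF Quotient3_l2])

lemma AE_rep_abs_l2:
  assumes "square_integrable h"
  shows "AE x in lborel. rep_l2 (abs_l2 h) x = h x"
proof -
  have "l2_eq (rep_l2 (abs_l2 h)) h"
    using assms by (intro rep_abs_rsp_left[OF Quotient3_l2] l2_eq_refl)
  then show ?thesis by (simp add: l2_eq_def)
qed

lemma abs_l2_eqI:
  assumes "square_integrable f" "square_integrable g" "AE x in lborel. f x = g x"
  shows "abs_l2 f = abs_l2 g"
  using assms by (intro Quotient3_rel_abs[OF Quotient3_l2]) (auto simp: l2_eq_def)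

lemma square_integrable_cong_AE:
  assumes "square_integrable f" "g \<in> borel_measurable lborel" "AE x in lborel. f x = g x"
  shows "square_integrable g"
proof -
  have "integrable lborel (\<lambda>x. (norm (f x))\<^sup>2) \<longleftrightarrow> integrable lborel (\<lambda>x. (norm (g x))\<^sup>2)"
    using assms by (intro integrable_cong_AE) (auto simp: square_integrable_def)
  then show ?thesis
    using assms by (auto simp: square_integrable_def)
qed

lemma square_integrable_diff:
  assumes "square_integrable f" "square_integrable g"
  shows "square_integrable (\<lambda>x. f x - g x)"
  using square_integrable_add[OF assms(1) square_integrable_mult[OF assms(2), of "-1"]] by simp

lemma abs_l2_add:
  "square_integrable f \<Longrightarrow> square_integrable g \<Longrightarrow> abs_l2 f + abs_l2 g = abs_l2 (\<lambda>x. f x + g x)"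
  by (simp add: plus_l2.abs_eq l2_eq_refl)

lemma abs_l2_scaleC:
  "square_integrable f \<Longrightarrow> c *\<^sub>C abs_l2 f = abs_l2 (\<lambda>x. c * f x)"
  by (simp add: scaleC.abs_eq l2_eq_refl)

lemma abs_l2_diff:
  "square_integrable f \<Longrightarrow> square_integrable g \<Longrightarrow> abs_l2 f - abs_l2 g = abs_l2 (\<lambda>x. f x - g x)"
  using abs_l2_scaleC[of g "-1"] abs_l2_add[of f "\<lambda>x. (-1) * g x"] square_integrable_mult[of g "-1"]
  by (simp add: minus_l2_def uminus_l2_def)

lemma cinner_abs_l2:
  "square_integrable f \<Longrightarrow> square_integrable g \<Longrightarrow>
    cinner (abs_l2 f) (abs_l2 g) = (\<integral>x. f x * cnj (g x) \<partial>lborel)"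
  by (simp add: cinner.abs_eq l2_eq_refl)

lemma norm_abs_l2:
  assumes "square_integrable f"
  shows "(norm (abs_l2 f))\<^sup>2 = (\<integral>x. (norm (f x))\<^sup>2 \<partial>lborel)"
proof -
  have "cinner (abs_l2 f) (abs_l2 f) = complex_of_real (\<integral>x. (norm (f x))\<^sup>2 \<partial>lborel)"
    unfolding cinner_abs_l2[OF assms assms]
    by (simp add: complex_norm_square[symmetric] flip: integral_complex_of_real of_real_power)
  then show ?thesis
    by (simp add: norm_l2_def)
qed

lemma nn_integral_norm_abs_l2:
  assumes "square_integrable f"
  shows "(\<integral>\<^sup>+x. ennreal ((norm (f x))\<^sup>2) \<partial>lborel) = ennreal ((norm (abs_l2 f))\<^sup>2)"
  using assms unfolding norm_abs_l2[OF assms]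
  by (intro nn_integral_eq_integral) (auto simp: square_integrable_def)

lemma square_integrableI_nn:
  assumes "f \<in> borel_measurable lborel" "(\<integral>\<^sup>+x. ennreal ((norm (f x))\<^sup>2) \<partial>lborel) < \<infinity>"
  shows "square_integrable f"
  unfolding square_integrable_def using assms
  by (auto intro!: integrableI_bounded)

lemma norm_abs_l2_le:
  assumes "f \<in> borel_measurable lborel" "0 \<le> B"
    and "(\<integral>\<^sup>+x. ennreal ((norm (f x))\<^sup>2) \<partial>lborel) \<le> ennreal (B\<^sup>2)"
  shows "square_integrable f" "norm (abs_l2 f) \<le> B"
proof -
  show f: "square_integrable f"
    using assms by (intro square_integrableI_nn) (auto intro: le_less_trans)
  have "ennreal ((norm (abs_l2 f))\<^sup>2) \<le> ennreal (B\<^sup>2)"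
    using assms nn_integral_norm_abs_l2[OF f] by simp
  then have "(norm (abs_l2 f))\<^sup>2 \<le> B\<^sup>2"
    by (simp add: ennreal_le_iff)
  then show "norm (abs_l2 f) \<le> B"
    using assms(2) power2_le_imp_le by blast
qed

subsection \<open>Complex-linear structure\<close>

lemma scaleC_add_right: "c *\<^sub>C (f + g) = c *\<^sub>C f + c *\<^sub>C g"
  by transfer (auto simp: l2_eq_def distrib_left intro!: square_integrable_add square_integrable_mult)

lemma scaleC_add_left: "(c + d) *\<^sub>C f = c *\<^sub>C f + d *\<^sub>C f"
  by transfer (auto simp: l2_eq_def distrib_right intro!: square_integrable_add square_integrable_mult)

lemma scaleC_scaleC: "c *\<^sub>C d *\<^sub>C f = (c * d) *\<^sub>C f"
  by transfer (auto simp: l2_eq_def mult.assoc intro!: square_integrable_mult)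

lemma scaleC_one: "1 *\<^sub>C f = f"
  by transfer (auto simp: l2_eq_def)

lemma scaleC_zero_left: "0 *\<^sub>C f = 0"
  by transfer (auto simp: l2_eq_def square_integrable_zero)

lemma scaleC_minus_left: "(- c) *\<^sub>C f = - (c *\<^sub>C f)"
  by (simp add: uminus_l2_def scaleC_scaleC)

lemma scaleC_diff_left: "(c - d) *\<^sub>C f = c *\<^sub>C f - d *\<^sub>C f"
  using scaleC_add_left[of c "-d" f] by (simp add: scaleC_minus_left)

lemma scaleC_minus_right: "c *\<^sub>C (- f) = - (c *\<^sub>C f)"
  by (simp add: uminus_l2_def scaleC_scaleC)

lemma scaleC_diff_right: "c *\<^sub>C (f - g) = c *\<^sub>C f - c *\<^sub>C g"
  using scaleC_add_right[of c f "-g"] by (simp add: scaleC_minus_right)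

lemma scaleC_zero_right: "c *\<^sub>C 0 = (0 :: l2)"
  using scaleC_diff_right[of c 0 0] by simp

lemma scaleC_sum_right: "c *\<^sub>C (\<Sum>i\<in>A. f i) = (\<Sum>i\<in>A. c *\<^sub>C f i)"
  by (induction A rule: infinite_finite_induct) (auto simp: scaleC_add_right scaleC_zero_right)

lemma cinner_add_right: "cinner f (g + h) = cinner f g + cinner f h"
  by (metis cinner_add_left cinner_commute complex_cnj_add)

lemma cinner_scaleC_right: "cinner f (c *\<^sub>C g) = cnj c * cinner f g"
  by (metis cinner_scaleC_left cinner_commute complex_cnj_mult)

lemma cinner_diff_left: "cinner (f - g) h = cinner f h - cinner g h"
  by (metis cinner_add_left add_diff_cancel_right' diff_add_cancel)

lemma cinner_diff_right: "cinner f (g - h) = cinner f g - cinner f h"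
  by (metis cinner_add_right add_diff_cancel_right' diff_add_cancel)

lemma cinner_zero_left: "cinner 0 g = 0"
  using cinner_diff_left[of 0 0 g] by simp

lemma cinner_zero_right: "cinner g 0 = 0"
  using cinner_diff_right[of g 0 0] by simp

lemma cinner_sum_left: "cinner (\<Sum>i\<in>A. f i) g = (\<Sum>i\<in>A. cinner (f i) g)"
  by (induction A rule: infinite_finite_induct) (auto simp: cinner_add_left cinner_zero_left)

lemma cinner_sum_right: "cinner g (\<Sum>i\<in>A. f i) = (\<Sum>i\<in>A. cinner g (f i))"
  by (induction A rule: infinite_finite_induct) (auto simp: cinner_add_right cinner_zero_right)

lemma cinner_self: "cinner f f = complex_of_real ((norm f)\<^sup>2)"
  using cinner_self_real[of f] by (simp add: norm_l2_def)

lemma norm_scaleC: "norm (c *\<^sub>C f) = cmod c * norm (f :: l2)"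
proof -
  have "cinner (c *\<^sub>C f) (c *\<^sub>C f) = (c * cnj c) * cinner f f"
    by (simp add: cinner_scaleC_left cinner_scaleC_right)
  also have "\<dots> = complex_of_real ((cmod c * norm f)\<^sup>2)"
    by (simp add: cinner_self power_mult_distrib complex_norm_square[symmetric])
  finally have "cinner (c *\<^sub>C f) (c *\<^sub>C f) = complex_of_real ((cmod c * norm f)\<^sup>2)" .
  then have "(norm (c *\<^sub>C f))\<^sup>2 = (cmod c * norm f)\<^sup>2"
    by (metis cinner_self of_real_eq_iff)
  then show ?thesis
    by (simp add: power2_eq_iff_nonneg)
qed

lemma cinner_extensionality:
  assumes "\<And>h. cinner h f = cinner h g"
  shows "f = g"
proof -
  have "cinner (f - g) (f - g) = 0"
    by (subst cinner_diff_right) (simp add: assms)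
  then show ?thesis
    by (simp add: cinner_self)
qed

lemma cmod_cinner_le: "cmod (cinner f g) \<le> norm f * norm g"
proof (cases "cinner f g = 0")
  case False
  define c where "c = cnj (cinner f g) / cmod (cinner f g)"
  have "cinner (c *\<^sub>C f) g = complex_of_real (cmod (cinner f g))"
    using False by (simp add: cinner_scaleC_left c_def field_simps complex_norm_square[symmetric]
        power2_eq_square)
  then have "cmod (cinner f g) = inner (c *\<^sub>C f) g"
    by (simp add: inner_l2_def)
  also have "\<dots> \<le> norm (c *\<^sub>C f) * norm g"
    by (rule norm_cauchy_schwarz)
  also have "\<dots> = norm f * norm g"
    using False by (simp add: norm_scaleC c_def norm_divide)
  finally show ?thesis .
qed simp

subsection \<open>Completeness\<close>

text \<open>
  Along a subsequence whose increments \<open>d\<^sub>n\<close> have norm at most \<open>2\<^sup>-\<^sup>n\<close> the function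
  \<open>\<Sum>n. 2\<^sup>n \<bar>d\<^sub>n\<bar>\<^sup>2\<close> is integrable, hence finite almost everywhere; this forces pointwise
  convergence at a geometric rate, and Fatou's lemma upgrades it to convergence in norm.
\<close>

lemma summable_if_weighted_squares_finite:
  fixes d :: "nat \<Rightarrow> 'a :: banach"
  assumes "(\<Sum>n. ennreal (2 ^ n * (norm (d n))\<^sup>2)) < \<infinity>"
  shows "summable d"
proof -
  define a where "a n = ennreal (2 ^ n * (norm (d n))\<^sup>2)" for n
  define C where "C = enn2real (suminf a)"
  have "suminf a < \<infinity>"
    using assms by (simp add: a_def[abs_def])
  then have C: "suminf a = ennreal C" "C \<ge> 0"
    by (auto simp: C_def)
  have bound: "norm (d n) \<le> sqrt C * (sqrt (1 / 2)) ^ n" for n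
  proof -
    have "sum a {n} \<le> suminf a"
      by (intro sum_le_suminf) auto
    then have "a n \<le> ennreal C"
      by (simp add: C(1))
    then have "ennreal (2 ^ n * (norm (d n))\<^sup>2) \<le> ennreal C"
      by (simp only: a_def)
    then have "(norm (d n))\<^sup>2 \<le> C * (1 / 2) ^ n"
      using C(2) by (simp add: field_simps)
    then have "norm (d n) \<le> sqrt (C * (1 / 2) ^ n)"
      by (rule real_le_rsqrt)
    then show ?thesis
      by (simp add: real_sqrt_mult real_sqrt_power)
  qed
  have "sqrt (1 / 2) < 1"
    by simp
  then have "summable (\<lambda>n. sqrt C * (sqrt (1 / 2)) ^ n)"
    by (intro summable_mult summable_geometric) auto
  then show ?thesis
    using bound by (intro summable_comparison_test[OF _ \<open>summable (\<lambda>n. sqrt C * (sqrt (1 / 2)) ^ n)\<close>]) blast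
qed

lemma l2_convergent_if_fast_Cauchy:
  fixes Y :: "nat \<Rightarrow> l2"
  assumes fast: "\<And>n. norm (Y (Suc n) - Y n) \<le> (1 / 2) ^ n" and "Cauchy Y"
  shows "convergent Y"
proof -
  define g where "g n = rep_l2 (Y n)" for n
  have sq: "square_integrable (g n)" for n
    by (simp add: g_def square_integrable_rep)
  have [measurable]: "g n \<in> borel_measurable lborel" for n
    using sq[of n] by (simp add: square_integrable_def)
  have Y: "Y n = abs_l2 (g n)" for n
    by (simp add: g_def abs_rep_l2)
  have dist: "(\<integral>\<^sup>+x. ennreal ((norm (g m x - g n x))\<^sup>2) \<partial>lborel) = ennreal ((norm (Y m - Y n))\<^sup>2)"
    for m n
    using nn_integral_norm_abs_l2[OF square_integrable_diff[OF sq[of m] sq[of n]]]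
    by (simp add: Y abs_l2_diff sq)
  have "(\<integral>\<^sup>+x. (\<Sum>n. ennreal (2 ^ n * (norm (g (Suc n) x - g n x))\<^sup>2)) \<partial>lborel)
      = (\<Sum>n. ennreal (2 ^ n) * ennreal ((norm (Y (Suc n) - Y n))\<^sup>2))"
    by (subst nn_integral_suminf) (auto simp: ennreal_mult nn_integral_cmult dist)
  also have "\<dots> \<le> (\<Sum>n. ennreal ((1 / 2) ^ n))"
  proof (intro suminf_le)
    fix n
    have "(norm (Y (Suc n) - Y n))\<^sup>2 \<le> ((1 / 2) ^ n)\<^sup>2"
      using fast[of n] by (intro power_mono) auto
    then have "2 ^ n * (norm (Y (Suc n) - Y n))\<^sup>2 \<le> 2 ^ n * ((1 / 2) ^ n)\<^sup>2"
      by simp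
    also have "\<dots> = (1 / 2) ^ n"
      by (simp add: power2_eq_square power_divide)
    finally show "ennreal (2 ^ n) * ennreal ((norm (Y (Suc n) - Y n))\<^sup>2) \<le> ennreal ((1 / 2) ^ n)"
      by (simp add: ennreal_mult[symmetric] ennreal_le_iff)
  qed auto
  also have "\<dots> = ennreal (\<Sum>n. (1 / 2) ^ n)"
    by (intro suminf_ennreal2) (auto intro: summable_geometric)
  finally have "(\<integral>\<^sup>+x. (\<Sum>n. ennreal (2 ^ n * (norm (g (Suc n) x - g n x))\<^sup>2)) \<partial>lborel) < \<infinity>"
    by (rule le_less_trans) simp
  then have "AE x in lborel. (\<Sum>n. ennreal (2 ^ n * (norm (g (Suc n) x - g n x))\<^sup>2)) \<noteq> \<infinity>"
    by (intro nn_integral_noteq_infinite) auto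
  then have conv: "AE x in lborel. (\<lambda>n. g n x) \<longlonglongrightarrow> lim (\<lambda>n. g n x)"
  proof eventually_elim
    case (elim x)
    then have "summable (\<lambda>n. g (Suc n) x - g n x)"
      by (intro summable_if_weighted_squares_finite) (simp add: less_top)
    then have "convergent (\<lambda>n. \<Sum>i<n. g (Suc i) x - g i x)"
      by (simp add: summable_iff_convergent)
    then have "convergent (\<lambda>n. g n x - g 0 x)"
      by (simp only: sum_lessThan_telescope[of "\<lambda>n. g n x"])
    from convergent_add[OF this convergent_const[of "g 0 x"]] have "convergent (\<lambda>n. g n x)"
      by simp
    then show ?case
      by (simp add: convergent_LIMSEQ_iff)
  qed
  define G where "G x = lim (\<lambda>n. g n x)" for x
  have [measurable]: "G \<in> borel_measurable lborel"
    unfolding G_def by measurable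
  have close: "(\<integral>\<^sup>+x. ennreal ((norm (G x - g n x))\<^sup>2) \<partial>lborel) \<le> ennreal (e\<^sup>2)"
    if e: "\<And>m. m \<ge> n \<Longrightarrow> norm (Y m - Y n) \<le> e" for n e
  proof -
    have "(\<integral>\<^sup>+x. ennreal ((norm (G x - g n x))\<^sup>2) \<partial>lborel)
        = (\<integral>\<^sup>+x. liminf (\<lambda>m. ennreal ((norm (g m x - g n x))\<^sup>2)) \<partial>lborel)"
      using conv
    proof (intro nn_integral_cong_AE, eventually_elim)
      case (elim x)
      then have "(\<lambda>m. ennreal ((norm (g m x - g n x))\<^sup>2)) \<longlonglongrightarrow> ennreal ((norm (G x - g n x))\<^sup>2)"
        by (intro tendsto_intros tendsto_ennrealI) (simp add: G_def)
      then show ?case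
        by (intro lim_imp_Liminf[symmetric]) auto
    qed
    also have "\<dots> \<le> liminf (\<lambda>m. \<integral>\<^sup>+x. ennreal ((norm (g m x - g n x))\<^sup>2) \<partial>lborel)"
      by (intro nn_integral_liminf) measurable
    also have "\<dots> \<le> liminf (\<lambda>m. ennreal (e\<^sup>2))"
    proof (intro Liminf_mono eventually_sequentiallyI[of n])
      fix m assume "n \<le> m"
      then show "(\<integral>\<^sup>+x. ennreal ((norm (g m x - g n x))\<^sup>2) \<partial>lborel) \<le> ennreal (e\<^sup>2)"
        using e[of m] by (auto simp: dist intro!: ennreal_leI power_mono)
    qed
    also have "\<dots> = ennreal (e\<^sup>2)"
      by (simp add: Liminf_const)
    finally show ?thesis .
  qed
  have tail: "\<exists>N. \<forall>n\<ge>N. \<forall>m\<ge>n. norm (Y m - Y n) \<le> e" if "e > 0" for e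
    using \<open>Cauchy Y\<close> that unfolding Cauchy_def dist_norm by (meson less_imp_le order_trans)
  obtain N where N: "\<And>m. m \<ge> N \<Longrightarrow> norm (Y m - Y N) \<le> 1"
    using tail[of 1] by auto
  have "square_integrable (\<lambda>x. (G x - g N x))"
    using close[OF N] by (intro norm_abs_l2_le(1)[where B = 1]) auto
  from square_integrable_add[OF this sq[of N]] have G: "square_integrable G"
    by simp
  have "Y \<longlonglongrightarrow> abs_l2 G"
  proof (rule LIMSEQ_I)
    fix r :: real assume "r > 0"
    then obtain M where M: "\<And>n m. n \<ge> M \<Longrightarrow> m \<ge> n \<Longrightarrow> norm (Y m - Y n) \<le> r / 2"
      using tail[of "r / 2"] by auto
    have "norm (Y n - abs_l2 G) < r" if "n \<ge> M" for n
    proof -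
      have "norm (abs_l2 (\<lambda>x. G x - g n x)) \<le> r / 2"
        using close[OF M[OF that]] \<open>r > 0\<close> by (intro norm_abs_l2_le(2)) auto
      then have "norm (abs_l2 G - Y n) \<le> r / 2"
        by (simp add: Y abs_l2_diff sq G)
      then show ?thesis
        using \<open>r > 0\<close> norm_minus_commute[of "Y n" "abs_l2 G"] by linarith
    qed
    then show "\<exists>M. \<forall>n\<ge>M. norm (Y n - abs_l2 G) < r" by blast
  qed
  then show ?thesis
    by (auto simp: convergent_def)
qed

instance l2 :: banach
proof
  fix X :: "nat \<Rightarrow> l2" assume X: "Cauchy X"
  have "\<exists>N. \<forall>m\<ge>N. \<forall>k\<ge>N. dist (X m) (X k) < (1 / 2) ^ n" for n
    using X unfolding Cauchy_def by simp
  then obtain N where N: "\<And>n m k. m \<ge> N n \<Longrightarrow> k \<ge> N n \<Longrightarrow> dist (X m) (X k) < (1 / 2) ^ n"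
    by metis
  (* summing the thresholds makes r strictly increasing and still at least N n *)
  define r where "r n = n + (\<Sum>i\<le>n. N i)" for n
  have r: "strict_mono r"
    by (intro strict_monoI_Suc) (simp add: r_def)
  have rN: "N n \<le> r n" for n
    unfolding r_def by (intro trans_le_add2 member_le_sum) auto
  have "convergent (X \<circ> r)"
  proof (rule l2_convergent_if_fast_Cauchy)
    fix n
    have "N n \<le> r (Suc n)"
      using rN[of n] strict_mono_less[OF r, of n "Suc n"] by simp
    then show "norm ((X \<circ> r) (Suc n) - (X \<circ> r) n) \<le> (1 / 2) ^ n"
      using N[OF _ rN, of n "r (Suc n)"] by (simp add: dist_norm less_imp_le)
  qed (use X r in \<open>rule Cauchy_subseq_Cauchy\<close>)
  then obtain l where "(X \<circ> r) \<longlonglongrightarrow> l"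
    by (auto simp: convergent_def)
  then have "X \<longlonglongrightarrow> l"
    using Cauchy_converges_subseq[OF X r] by blast
  then show "convergent X"
    by (auto simp: convergent_def)
qed

section \<open>Operators whose difference from the identity is unitary\<close>

definition scalar_op :: "complex \<Rightarrow> l2 \<Rightarrow>\<^sub>L l2" where
  "scalar_op c = Blinfun (\<lambda>f. c *\<^sub>C f)"

lemma scalar_op_apply: "scalar_op c f = c *\<^sub>C f"
proof -
  have "bounded_linear (\<lambda>f :: l2. c *\<^sub>C f)"
  proof (rule bounded_linear_intro)
    show "norm (c *\<^sub>C f) \<le> norm f * cmod c" for f :: l2
      by (simp add: norm_scaleC)
  qed (auto simp: scaleC_add_right scaleR_l2_def scaleC_scaleC mult.commute)
  then show ?thesis
    unfolding scalar_op_def by (simp add: bounded_linear_Blinfun_apply)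
qed

lemma scalar_op_1: "scalar_op 1 = id_blinfun"
  by (intro blinfun_eqI) (simp add: scalar_op_apply scaleC_one)

lemma complex_linearD: "complex_linear A \<Longrightarrow> A (c *\<^sub>C f) = c *\<^sub>C A f"
  by (simp add: complex_linear_def)

lemma is_adjointD: "is_adjoint S A \<Longrightarrow> cinner (A f) g = cinner f (S g)"
  by (simp add: is_adjoint_def)

lemma is_adjoint_unique:
  assumes "is_adjoint S A" "is_adjoint S' A"
  shows "S = S'"
proof (rule blinfun_eqI)
  fix g show "S g = S' g"
    using assms by (intro cinner_extensionality) (simp add: is_adjoint_def)
qed

lemma is_adjoint_sym:
  assumes "is_adjoint S A"
  shows "is_adjoint A S"
  unfolding is_adjoint_def
  by (metis assms cinner_commute is_adjointD)

lemma complex_linear_if_adjoint: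
  assumes "is_adjoint S A"
  shows "complex_linear S"
  unfolding complex_linear_def
proof (intro allI cinner_extensionality)
  fix c g h
  have "cinner h (S (c *\<^sub>C g)) = cinner (A h) (c *\<^sub>C g)"
    by (simp add: is_adjointD[OF assms])
  also have "\<dots> = cinner h (c *\<^sub>C S g)"
    by (simp add: cinner_scaleC_right is_adjointD[OF assms])
  finally show "cinner h (S (c *\<^sub>C g)) = cinner h (c *\<^sub>C S g)" .
qed

lemma sum_roots_of_unity:
  assumes "n < N" "m < N"
  shows "(\<Sum>k<N. cnj (cis (2 * pi * real k / real N)) ^ n * cis (2 * pi * real k / real N) ^ m)
    = (if n = m then of_nat N else 0)"
proof -
  define t where "t = 2 * pi * (real m - real n) / real N"
  have N: "N > 0" using assms by simp
  have "cnj (cis (2 * pi * real k / real N)) ^ n * cis (2 * pi * real k / real N) ^ m = cis t ^ k" for k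
    by (simp add: cis_cnj Complex.DeMoivre cis_mult t_def algebra_simps diff_divide_distrib)
  then have eq: "(\<Sum>k<N. cnj (cis (2 * pi * real k / real N)) ^ n * cis (2 * pi * real k / real N) ^ m)
      = (\<Sum>k<N. cis t ^ k)"
    by simp
  show ?thesis
  proof (cases "n = m")
    case True
    then show ?thesis unfolding eq by (simp add: t_def)
  next
    case False
    have "cis t \<noteq> 1"
    proof
      assume "cis t = 1"
      then have "cos t = 1" by (simp add: complex_eq_iff)
      then obtain j :: int where j: "t = of_int j * 2 * pi"
        using cos_one_2pi_int by blast
      have "real m - real n = of_int j * real N"
      proof -
        from j have "t * real N = (of_int j * real N) * (2 * pi)" by simp
        moreover have "t * real N = (real m - real n) * (2 * pi)"
          using N by (simp add: t_def)
        ultimately show ?thesis by simp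
      qed
      then have "int m - int n = j * int N"
        by (metis of_int_diff of_int_eq_iff of_int_mult of_int_of_nat_eq)
      moreover have "\<bar>int m - int n\<bar> < int N" using assms by auto
      ultimately have "j = 0"
        by (metis abs_mult abs_of_nat mult_le_cancel_right1 not_less of_nat_0_le_iff zero_less_abs_iff int_one_le_iff_zero_less)
      then show False
        using False \<open>int m - int n = j * int N\<close> by simp
    qed
    moreover have "cis t ^ N = 1"
    proof -
      have "real N * t = 2 * pi * of_int (int m - int n)"
        using N by (simp add: t_def)
      then show ?thesis
        by (simp only: Complex.DeMoivre) (metis cis_multiple_2pi Ints_of_int)
    qed
    ultimately show ?thesis
      unfolding eq using False by (simp add: geometric_sum)
  qed
qed

text \<open>
  The discrete Fourier transform is, up to the factor \<open>N\<close>, unitary also for Hilbert-space valued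
  sequences, since only orthogonality of the characters enters.
\<close>

lemma roots_of_unity_Parseval:
  fixes v :: "nat \<Rightarrow> l2"
  shows "(\<Sum>k<N. (norm (\<Sum>n<N. cnj (cis (2 * pi * real k / real N)) ^ n *\<^sub>C v n))\<^sup>2)
    = real N * (\<Sum>n<N. (norm (v n))\<^sup>2)" (is "?L = ?R")
proof -
  let ?w = "\<lambda>k. cis (2 * pi * real k / real N)"
  have "complex_of_real ?L
      = (\<Sum>k<N. \<Sum>n<N. \<Sum>m<N. cnj (?w k) ^ n * ?w k ^ m * cinner (v n) (v m))"
    by (simp only: of_real_sum cinner_self[symmetric] cinner_sum_left)
      (simp add: cinner_sum_right cinner_scaleC_left cinner_scaleC_right sum_distrib_left mult.assoc mult.left_commute)
  also have "\<dots> = (\<Sum>n<N. \<Sum>k<N. \<Sum>m<N. cnj (?w k) ^ n * ?w k ^ m * cinner (v n) (v m))"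
    by (rule sum.swap)
  also have "\<dots> = (\<Sum>n<N. \<Sum>m<N. \<Sum>k<N. cnj (?w k) ^ n * ?w k ^ m * cinner (v n) (v m))"
    by (intro sum.cong[OF refl] sum.swap)
  also have "\<dots> = (\<Sum>n<N. \<Sum>m<N. (\<Sum>k<N. cnj (?w k) ^ n * ?w k ^ m) * cinner (v n) (v m))"
    by (simp add: sum_distrib_right)
  also have "\<dots> = (\<Sum>n<N. \<Sum>m<N. (if n = m then of_nat N else 0) * cinner (v n) (v m))"
    by (intro sum.cong refl arg_cong2[where f = "(*)"] sum_roots_of_unity) auto
  also have "\<dots> = (\<Sum>n<N. of_nat N * cinner (v n) (v n))"
    by (intro sum.cong[OF refl]) (simp add: if_distrib[of "\<lambda>x. x * _"] sum.delta' cong: if_cong)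
  also have "\<dots> = complex_of_real ?R"
    by (simp add: cinner_self sum_distrib_left)
  finally show ?thesis
    by (simp only: of_real_eq_iff)
qed

definition unit_circle_at_1 :: "complex set" where
  "unit_circle_at_1 = sphere 1 1"

lemma unit_circle_at_1_iff: "z \<in> unit_circle_at_1 \<longleftrightarrow> cmod (z - 1) = 1"
  by (simp add: unit_circle_at_1_def dist_norm norm_minus_commute)

lemma compact_unit_circle_at_1: "compact unit_circle_at_1"
  by (simp add: unit_circle_at_1_def)

lemma zero_in_unit_circle_at_1: "0 \<in> unit_circle_at_1"
  by (simp add: unit_circle_at_1_iff)

text \<open>
  The two product relations express that \<open>1 - T\<close> is unitary with adjoint \<open>1 - T'\<close>. Unitarity alone
  confines the spectrum to the circle of radius one around one; the approximate eigenvectors make it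
  the whole circle.
\<close>

locale circle_pair =
  fixes T T' :: "l2 \<Rightarrow>\<^sub>L l2"
  assumes T_linear: "complex_linear T"
    and T_adjoint: "is_adjoint T' T"
    and T_mult_adj: "T (T' f) = T f + T' f"
    and adj_mult_T: "T' (T f) = T f + T' f"
    and approx_eigenvector:
      "z \<in> unit_circle_at_1 \<Longrightarrow> 0 < d \<Longrightarrow> \<exists>f. norm f = 1 \<and> norm (T f - z *\<^sub>C f) \<le> d"
begin

definition U :: "l2 \<Rightarrow>\<^sub>L l2" where "U = id_blinfun - T"

lemma U_apply: "U f = f - T f"
  by (simp add: U_def blinfun.diff_left)

lemma norm_U: "norm (U f) = norm f"
proof -
  have "cinner (T f) (T f) = cinner f (T f) + cinner (T f) f"
    by (simp add: is_adjointD[OF T_adjoint] adj_mult_T cinner_add_right)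
  then have "cinner (U f) (U f) = cinner f f"
    by (simp add: U_apply cinner_diff_left cinner_diff_right)
  then show ?thesis
    by (simp add: cinner_self flip: of_real_power)
qed

lemma norm_U_pow: "norm ((blinfun_apply U ^^ n) f) = norm f"
  by (induction n) (simp_all add: norm_U)

text \<open>
  A polynomial function on the circle paired with the operator obtained by inserting \<open>T\<close> for \<open>z\<close> and
  \<open>T'\<close> for the conjugate of \<open>z\<close>. It is a relation because the operator is determined by the function
  only after the norm identity is known.
\<close>

inductive poly_of :: "(complex \<Rightarrow> complex) \<Rightarrow> (l2 \<Rightarrow>\<^sub>L l2) \<Rightarrow> bool" where
  const: "poly_of (\<lambda>z. c) (scalar_op c)"
| id: "poly_of (\<lambda>z. z) T"
| cnj: "poly_of cnj T'"
| add: "poly_of p P \<Longrightarrow> poly_of q Q \<Longrightarrow> poly_of (\<lambda>z. p z + q z) (P + Q)"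
| mult: "poly_of p P \<Longrightarrow> poly_of q Q \<Longrightarrow> poly_of (\<lambda>z. p z * q z) (P o\<^sub>L Q)"

lemma poly_of_linear: "poly_of p P \<Longrightarrow> complex_linear P"
proof (induction rule: poly_of.induct)
  case (cnj)
  then show ?case using complex_linear_if_adjoint[OF T_adjoint] .
qed (auto simp: complex_linear_def scalar_op_apply scaleC_scaleC mult.commute
    blinfun.add_left scaleC_add_right intro: complex_linearD[OF T_linear])

lemma poly_of_commutes: "poly_of p P \<Longrightarrow> P (T f) = T (P f)"
  by (induction arbitrary: f rule: poly_of.induct)
    (auto simp: scalar_op_apply complex_linearD[OF T_linear] T_mult_adj adj_mult_T
      blinfun.add_left blinfun.add_right)

lemma poly_of_commutes_U: "poly_of p P \<Longrightarrow> P ((blinfun_apply U ^^ n) f) = (blinfun_apply U ^^ n) (P f)"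
  by (induction n arbitrary: f) (auto simp: U_apply blinfun.diff_right poly_of_commutes)

lemma poly_of_cont: "poly_of p P \<Longrightarrow> continuous_on S p"
  by (induction rule: poly_of.induct) (auto intro!: continuous_intros)

lemma poly_of_bounded:
  assumes "poly_of p P"
  shows "\<exists>B\<ge>0. \<forall>z\<in>unit_circle_at_1. cmod (p z) \<le> B"
proof -
  have "bounded (p ` unit_circle_at_1)"
    using poly_of_cont[OF assms] compact_unit_circle_at_1
    by (intro compact_imp_bounded compact_continuous_image)
  then show ?thesis
    unfolding bounded_pos by (meson image_eqI less_imp_le)
qed

lemma poly_of_adjoint: "poly_of p P \<Longrightarrow> \<exists>P'. poly_of (\<lambda>z. cnj (p z)) P' \<and> is_adjoint P' P"
proof (induction rule: poly_of.induct)
  case (const c)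
  have "is_adjoint (scalar_op (cnj c)) (scalar_op c)"
    by (simp add: is_adjoint_def scalar_op_apply cinner_scaleC_left cinner_scaleC_right)
  then show ?case using poly_of.const by blast
next
  case id
  then show ?case using poly_of.cnj T_adjoint by auto
next
  case cnj
  then show ?case using poly_of.id is_adjoint_sym[OF T_adjoint] by auto
next
  case (add p P q Q)
  then obtain P' Q' where *: "poly_of (\<lambda>z. cnj (p z)) P'" "poly_of (\<lambda>z. cnj (q z)) Q'"
    and "is_adjoint P' P" "is_adjoint Q' Q" by blast
  then have "is_adjoint (P' + Q') (P + Q)"
    by (simp add: is_adjoint_def blinfun.add_left cinner_add_left cinner_add_right)
  with poly_of.add[OF *] show ?case by auto
next
  case (mult p P q Q)
  then obtain P' Q' where *: "poly_of (\<lambda>z. cnj (p z)) P'" "poly_of (\<lambda>z. cnj (q z)) Q'"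
    and "is_adjoint P' P" "is_adjoint Q' Q" by blast
  then have "is_adjoint (Q' o\<^sub>L P') (P o\<^sub>L Q)"
    by (simp add: is_adjoint_def)
  with poly_of.mult[OF *(2) *(1)] show ?case by (auto simp: mult.commute)
qed

text \<open>
  The relation between \<open>T\<close> and \<open>T'\<close> turns an almost eigenvector of \<open>T\<close> into one of the adjoint with
  the conjugate eigenvalue: with \<open>w = T v - z v\<close>, the vector \<open>T' w - w\<close> is a unimodular multiple of
  \<open>T' v - cnj z v\<close>.
\<close>

lemma adj_approx:
  assumes "z \<in> unit_circle_at_1" "norm (T v - z *\<^sub>C v) \<le> d"
  shows "norm (T' v - cnj z *\<^sub>C v) \<le> (norm T' + 1) * d"
proof -
  define w where "w = T v - z *\<^sub>C v"
  have T'lin: "complex_linear T'" using complex_linear_if_adjoint[OF T_adjoint] .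
  have z: "(z - 1) * cnj (z - 1) = 1"
    using assms(1) complex_norm_square[of "z - 1"] by (simp add: unit_circle_at_1_iff)
  have "T' w - w = T v + T' v - z *\<^sub>C T' v - T v + z *\<^sub>C v"
    by (simp add: w_def blinfun.diff_right adj_mult_T complex_linearD[OF T'lin])
  also have "\<dots> = (1 - z) *\<^sub>C T' v + z *\<^sub>C v"
    by (simp add: scaleC_diff_left scaleC_one)
  finally have "cnj (z - 1) *\<^sub>C (T' w - w)
      = (- ((z - 1) * cnj (z - 1))) *\<^sub>C T' v + (cnj (z - 1) * z) *\<^sub>C v"
    by (simp add: scaleC_add_right scaleC_scaleC algebra_simps)
  moreover have "cnj (z - 1) * z = cnj z"
    using z by (simp add: algebra_simps)
  ultimately have "cnj (z - 1) *\<^sub>C (T' w - w) = - (T' v - cnj z *\<^sub>C v)"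
    by (simp only: z) (simp add: scaleC_minus_left scaleC_one)
  then have "norm (T' v - cnj z *\<^sub>C v) = norm (cnj (z - 1) *\<^sub>C (T' w - w))"
    by (metis norm_minus_cancel)
  also have "\<dots> = norm (T' w - w)"
    using assms(1) by (simp only: norm_scaleC complex_mod_cnj unit_circle_at_1_iff mult_1)
  also have "\<dots> \<le> norm (T' w) + norm w"
    by (rule norm_triangle_ineq4)
  also have "\<dots> \<le> norm T' * norm w + norm w"
    using norm_blinfun[of T' w] by simp
  also have "\<dots> \<le> (norm T' + 1) * d"
    using assms(2) mult_left_mono[of "norm w" d "norm T'"] by (simp add: w_def algebra_simps)
  finally show ?thesis .
qed

text \<open>
  The constant depends on the polynomial only, neither on the point nor on the vector. This
  uniformity is used with a fixed error and growing vectors for the upper norm bound, and with unit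
  vectors and a vanishing error for the lower one.
\<close>

lemma poly_of_approx:
  "poly_of p P \<Longrightarrow> \<exists>K\<ge>0. \<forall>z\<in>unit_circle_at_1. \<forall>v d.
      norm (T v - z *\<^sub>C v) \<le> d \<longrightarrow> norm (P v - p z *\<^sub>C v) \<le> K * d"
proof (induction rule: poly_of.induct)
  case (const c)
  then show ?case by (intro exI[of _ 0]) (simp add: scalar_op_apply)
next
  case id
  then show ?case by (intro exI[of _ 1]) simp
next
  case cnj
  then show ?case using adj_approx by (intro exI[of _ "norm T' + 1"]) auto
next
  case (add p P q Q)
  from add.IH obtain K L where K: "K \<ge> 0" "\<And>z v d. z \<in> unit_circle_at_1 \<Longrightarrow>
      norm (T v - z *\<^sub>C v) \<le> d \<Longrightarrow> norm (P v - p z *\<^sub>C v) \<le> K * d"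
    and L: "L \<ge> 0" "\<And>z v d. z \<in> unit_circle_at_1 \<Longrightarrow>
      norm (T v - z *\<^sub>C v) \<le> d \<Longrightarrow> norm (Q v - q z *\<^sub>C v) \<le> L * d"
    by metis
  show ?case
  proof (intro exI[of _ "K + L"] conjI ballI allI impI)
    fix z v d assume a: "z \<in> unit_circle_at_1" "norm (T v - z *\<^sub>C v) \<le> d"
    have "(P + Q) v - (p z + q z) *\<^sub>C v = (P v - p z *\<^sub>C v) + (Q v - q z *\<^sub>C v)"
      by (simp add: blinfun.add_left scaleC_add_left)
    then have "norm ((P + Q) v - (p z + q z) *\<^sub>C v) \<le> norm (P v - p z *\<^sub>C v) + norm (Q v - q z *\<^sub>C v)"
      by (metis norm_triangle_ineq)
    also have "\<dots> \<le> (K + L) * d"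
      using K(2)[OF a] L(2)[OF a] by (simp add: distrib_right)
    finally show "norm ((P + Q) v - (p z + q z) *\<^sub>C v) \<le> (K + L) * d" .
  qed (use K L in simp)
next
  case (mult p P q Q)
  from mult.IH obtain K L where K: "K \<ge> 0" "\<And>z v d. z \<in> unit_circle_at_1 \<Longrightarrow>
      norm (T v - z *\<^sub>C v) \<le> d \<Longrightarrow> norm (P v - p z *\<^sub>C v) \<le> K * d"
    and L: "L \<ge> 0" "\<And>z v d. z \<in> unit_circle_at_1 \<Longrightarrow>
      norm (T v - z *\<^sub>C v) \<le> d \<Longrightarrow> norm (Q v - q z *\<^sub>C v) \<le> L * d"
    by metis
  obtain B where B: "B \<ge> 0" "\<And>z. z \<in> unit_circle_at_1 \<Longrightarrow> cmod (q z) \<le> B"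
    using poly_of_bounded[OF mult.hyps(2)] by blast
  show ?case
  proof (intro exI[of _ "norm P * L + B * K"] conjI ballI allI impI)
    fix z v d assume a: "z \<in> unit_circle_at_1" "norm (T v - z *\<^sub>C v) \<le> d"
    have "(P o\<^sub>L Q) v - (p z * q z) *\<^sub>C v = P (Q v - q z *\<^sub>C v) + q z *\<^sub>C (P v - p z *\<^sub>C v)"
      by (simp add: blinfun.diff_right complex_linearD[OF poly_of_linear[OF mult.hyps(1)]]
          scaleC_diff_right scaleC_scaleC mult.commute)
    then have "norm ((P o\<^sub>L Q) v - (p z * q z) *\<^sub>C v)
        \<le> norm (P (Q v - q z *\<^sub>C v)) + cmod (q z) * norm (P v - p z *\<^sub>C v)"
      by (metis norm_triangle_ineq norm_scaleC)
    also have "\<dots> \<le> norm P * (L * d) + B * (K * d)"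
      using K L B a by (intro add_mono mult_mono order_trans[OF norm_blinfun]) auto
    finally show "norm ((P o\<^sub>L Q) v - (p z * q z) *\<^sub>C v) \<le> (norm P * L + B * K) * d"
      by (simp add: algebra_simps)
  qed (use K L B in simp)
qed

text \<open>
  The Fourier sum of an orbit is shifted by \<open>U\<close>, so the geometric sum telescopes and leaves only two
  boundary terms, however many summands there are.
\<close>

lemma U_geometric:
  fixes f :: l2 and w :: complex
  assumes "w ^ N = 1" "cmod w = 1"
  defines "v \<equiv> (\<Sum>n<N. cnj w ^ n *\<^sub>C (blinfun_apply U ^^ n) f)"
  shows "norm (T v - (1 - w) *\<^sub>C v) \<le> 2 * norm f"
proof -
  have w: "w * cnj w = 1"
    using assms(2) by (simp add: complex_norm_square[symmetric])
  have Ulin: "U (c *\<^sub>C g) = c *\<^sub>C U g" for c g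
    by (simp add: U_apply complex_linearD[OF T_linear] scaleC_diff_right)
  have "U v - w *\<^sub>C v = (\<Sum>n<N. w *\<^sub>C (cnj w ^ Suc n *\<^sub>C (blinfun_apply U ^^ Suc n) f - cnj w ^ n *\<^sub>C (blinfun_apply U ^^ n) f))"
    using w by (simp add: v_def blinfun.sum_right Ulin scaleC_sum_right sum_subtractf
        scaleC_diff_right scaleC_scaleC mult.assoc[symmetric])
  also have "\<dots> = w *\<^sub>C (cnj w ^ N *\<^sub>C (blinfun_apply U ^^ N) f - f)"
    using sum_lessThan_telescope[of "\<lambda>n. cnj w ^ n *\<^sub>C (blinfun_apply U ^^ n) f" N]
    by (simp only: scaleC_sum_right[symmetric]) (simp add: scaleC_one)
  finally have "norm (U v - w *\<^sub>C v) = norm (cnj w ^ N *\<^sub>C (blinfun_apply U ^^ N) f - f)"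
    using assms(2) by (simp add: norm_scaleC)
  also have "\<dots> \<le> norm (cnj w ^ N *\<^sub>C (blinfun_apply U ^^ N) f) + norm f"
    by (rule norm_triangle_ineq4)
  also have "\<dots> = 2 * norm f"
    using assms(2) by (simp add: norm_scaleC norm_U_pow norm_power)
  also have "U v - w *\<^sub>C v = - (T v - (1 - w) *\<^sub>C v)"
    by (simp add: U_apply scaleC_diff_left scaleC_one)
  finally show ?thesis
    by (simp only: norm_minus_cancel)
qed

text \<open>
  Transference. For each \<open>N\<close>-th root of unity \<open>w\<close> the orbit sum \<open>v\<close> satisfies
  \<open>\<parallel>P v\<parallel> \<le> s \<parallel>v\<parallel> + 2 K \<parallel>f\<parallel>\<close>. Averaging the squares over all roots, Parseval turns the left side into
  \<open>N \<parallel>P f\<parallel>\<^sup>2\<close>, as \<open>P\<close> commutes with the isometry \<open>U\<close>, and the main term on the right into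
  \<open>s\<^sup>2 N \<parallel>f\<parallel>\<^sup>2\<close>, while the error terms grow more slowly than \<open>N\<close>.
\<close>

lemma poly_of_norm_le:
  assumes "poly_of p P" and s: "\<And>z. z \<in> unit_circle_at_1 \<Longrightarrow> cmod (p z) \<le> s"
  shows "norm P \<le> s"
proof (rule norm_blinfun_bound)
  show s0: "0 \<le> s"
    using s[OF zero_in_unit_circle_at_1] norm_ge_zero order_trans by blast
  fix f :: l2
  obtain K where K: "K \<ge> 0" "\<And>z v d. z \<in> unit_circle_at_1 \<Longrightarrow>
      norm (T v - z *\<^sub>C v) \<le> d \<Longrightarrow> norm (P v - p z *\<^sub>C v) \<le> K * d"
    using poly_of_approx[OF assms(1)] by metis
  define F where "F = (norm f)\<^sup>2"
  define C where "C = s\<^sup>2 * F + 8 * K\<^sup>2 * F"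
  have main: "(norm (P f))\<^sup>2 \<le> s\<^sup>2 * F + C / real m" if m: "m \<ge> 1" for m
  proof -
    (* N = m^2 against the weight 1/m in the square of the sum makes both error terms O(1/m). *)
    define N where "N = m\<^sup>2"
    define w where "w k = cis (2 * pi * real k / real N)" for k
    define v where "v k = (\<Sum>n<N. cnj (w k) ^ n *\<^sub>C (blinfun_apply U ^^ n) f)" for k
    have N: "real N = (real m)\<^sup>2" "N > 0" using m by (auto simp: N_def)
    have wN: "w k ^ N = 1" for k
    proof -
      have "real N * (2 * pi * real k / real N) = 2 * pi * of_int (int k)"
        using N by simp
      then show ?thesis
        unfolding w_def by (simp only: Complex.DeMoivre) (metis cis_multiple_2pi Ints_of_int)
    qed
    have Pv: "P (v k) = (\<Sum>n<N. cnj (w k) ^ n *\<^sub>C (blinfun_apply U ^^ n) (P f))" for k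
      by (simp add: v_def blinfun.sum_right complex_linearD[OF poly_of_linear[OF assms(1)]]
          poly_of_commutes_U[OF assms(1)])
    have bound: "(norm (P (v k)))\<^sup>2 \<le> (1 + 1 / real m) * s\<^sup>2 * (norm (v k))\<^sup>2 + (1 + real m) * (4 * K\<^sup>2 * F)" for k
    proof -
      have mem: "1 - w k \<in> unit_circle_at_1"
        by (simp add: unit_circle_at_1_iff w_def)
      have "norm (T (v k) - (1 - w k) *\<^sub>C v k) \<le> 2 * norm f"
        unfolding v_def by (rule U_geometric) (use wN in \<open>auto simp: w_def\<close>)
      from K(2)[OF mem this]
      have "norm (P (v k)) \<le> norm (p (1 - w k) *\<^sub>C v k) + K * (2 * norm f)"
        by (meson add_left_mono norm_diff_ineq norm_triangle_sub order_trans)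
      also have "\<dots> \<le> s * norm (v k) + K * (2 * norm f)"
        using s[OF mem] by (simp add: norm_scaleC mult_right_mono)
      finally have "norm (P (v k)) \<le> s * norm (v k) + 2 * K * norm f" by simp
      then have "(norm (P (v k)))\<^sup>2 \<le> (s * norm (v k) + 2 * K * norm f)\<^sup>2"
        by (intro power_mono) auto
      also have "\<dots> \<le> (1 + 1 / real m) * (s * norm (v k))\<^sup>2 + (1 + real m) * (2 * K * norm f)\<^sup>2"
      proof -
        have "(a + b)\<^sup>2 \<le> (1 + 1 / real m) * a\<^sup>2 + (1 + real m) * b\<^sup>2" for a b :: real
        proof -
          have "0 \<le> (a - m * b)\<^sup>2 / real m" by simp
          also have "\<dots> = (1 + 1 / real m) * a\<^sup>2 + (1 + real m) * b\<^sup>2 - (a + b)\<^sup>2"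
            using m by (simp add: power2_eq_square field_simps)
          finally show ?thesis by simp
        qed
        then show ?thesis .
      qed
      finally show ?thesis
        by (simp add: power_mult_distrib F_def mult.assoc)
    qed
    have "real N * (real N * (norm (P f))\<^sup>2) = (\<Sum>k<N. (norm (P (v k)))\<^sup>2)"
      unfolding Pv w_def roots_of_unity_Parseval by (simp add: norm_U_pow)
    also have "\<dots> \<le> (\<Sum>k<N. (1 + 1 / real m) * s\<^sup>2 * (norm (v k))\<^sup>2 + (1 + real m) * (4 * K\<^sup>2 * F))"
      by (intro sum_mono bound)
    also have "\<dots> = (1 + 1 / real m) * s\<^sup>2 * (\<Sum>k<N. (norm (v k))\<^sup>2) + real N * ((1 + real m) * (4 * K\<^sup>2 * F))"
      by (simp add: sum.distrib sum_distrib_left)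
    also have "(\<Sum>k<N. (norm (v k))\<^sup>2) = real N * (real N * F)"
      unfolding v_def w_def roots_of_unity_Parseval by (simp add: norm_U_pow F_def)
    finally have "real N * (real N * (norm (P f))\<^sup>2)
        \<le> real N * (real N * ((1 + 1 / real m) * s\<^sup>2 * F) + (1 + real m) * (4 * K\<^sup>2 * F))"
      by (simp only: distrib_left mult.left_commute)
    then have "real N * (norm (P f))\<^sup>2
        \<le> real N * ((1 + 1 / real m) * s\<^sup>2 * F) + (1 + real m) * (4 * K\<^sup>2 * F)"
      using N(2) by (simp only: mult_le_cancel_left_pos of_nat_0_less_iff)
    also have "\<dots> = real N * ((1 + 1 / real m) * s\<^sup>2 * F + (1 + real m) / real N * (4 * K\<^sup>2 * F))"
      using N(2) by (simp add: distrib_left)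
    finally have "(norm (P f))\<^sup>2 \<le> (1 + 1 / real m) * s\<^sup>2 * F + (1 + real m) / real N * (4 * K\<^sup>2 * F)"
      using N(2) by (simp only: mult_le_cancel_left_pos of_nat_0_less_iff)
    then have "(norm (P f))\<^sup>2 \<le> (1 + 1 / real m) * s\<^sup>2 * F + (1 + real m) / (real m)\<^sup>2 * (4 * K\<^sup>2 * F)"
      by (simp only: N(1))
    also have "(1 + real m) / (real m)\<^sup>2 \<le> 2 / real m"
      using m by (simp add: field_simps power2_eq_square)
    then have "(1 + real m) / (real m)\<^sup>2 * (4 * K\<^sup>2 * F) \<le> 2 / real m * (4 * K\<^sup>2 * F)"
      by (intro mult_right_mono) (auto simp: F_def)
    then have "(1 + 1 / real m) * s\<^sup>2 * F + (1 + real m) / (real m)\<^sup>2 * (4 * K\<^sup>2 * F) \<le> s\<^sup>2 * F + C / real m"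
      by (simp add: C_def field_simps add_divide_distrib)
    finally show ?thesis .
  qed
  have "(\<lambda>m. s\<^sup>2 * F + C / real m) \<longlonglongrightarrow> s\<^sup>2 * F + 0"
    by (intro tendsto_intros lim_const_over_n)
  then have "(norm (P f))\<^sup>2 \<le> s\<^sup>2 * F + 0"
    by (rule LIMSEQ_le_const) (use main in blast)
  then have "(norm (P f))\<^sup>2 \<le> (s * norm f)\<^sup>2"
    by (simp add: F_def power_mult_distrib)
  then show "norm (P f) \<le> s * norm f"
    by (rule power2_le_imp_le) (use s0 in simp)
qed

lemma poly_of_norm_ge:
  assumes "poly_of p P" "z \<in> unit_circle_at_1"
  shows "cmod (p z) \<le> norm P"
proof (rule field_le_epsilon)
  fix e :: real assume e: "e > 0"
  obtain K where K: "K \<ge> 0" "\<And>z v d. z \<in> unit_circle_at_1 \<Longrightarrow>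
      norm (T v - z *\<^sub>C v) \<le> d \<Longrightarrow> norm (P v - p z *\<^sub>C v) \<le> K * d"
    using poly_of_approx[OF assms(1)] by metis
  have "e / (K + 1) > 0" using e K by simp
  then obtain f where f: "norm f = 1" "norm (T f - z *\<^sub>C f) \<le> e / (K + 1)"
    using approx_eigenvector[OF assms(2)] by blast
  have "cmod (p z) = norm (p z *\<^sub>C f)"
    by (simp add: norm_scaleC f)
  also have "\<dots> \<le> norm (P f) + norm (P f - p z *\<^sub>C f)"
    by (metis norm_minus_commute norm_triangle_sub)
  also have "\<dots> \<le> norm P + K * (e / (K + 1))"
    using K(2)[OF assms(2) f(2)] norm_blinfun[of P f] f(1) by simp
  also have "K * (e / (K + 1)) \<le> e"
    using K e by (simp add: field_simps)
  finally show "cmod (p z) \<le> norm P + e" by simp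
qed
subsection \<open>Continuous functions by uniform approximation\<close>

text \<open>
  The closure of the polynomial pairs in the product of the sup norm on the circle and the operator
  norm. By the norm identity this relation is the graph of the functional calculus.
\<close>

definition represents :: "(complex \<Rightarrow> complex) \<Rightarrow> (l2 \<Rightarrow>\<^sub>L l2) \<Rightarrow> bool" where
  "represents f A \<longleftrightarrow> (\<forall>e>0. \<exists>p P. poly_of p P \<and>
     (\<forall>z\<in>unit_circle_at_1. cmod (f z - p z) \<le> e) \<and> norm (A - P) \<le> e)"

lemma representsE:
  assumes "represents f A" "e > 0"
  obtains p P where "poly_of p P" "\<And>z. z \<in> unit_circle_at_1 \<Longrightarrow> cmod (f z - p z) \<le> e"
    "norm (A - P) \<le> e"
  using assms unfolding represents_def by blast

lemma represents_poly_of: "poly_of p P \<Longrightarrow> represents p P"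
  unfolding represents_def by (intro allI impI exI[of _ p] exI[of _ P]) auto

lemma represents_closed:
  assumes "\<And>e. e > 0 \<Longrightarrow> \<exists>g B. represents g B \<and>
    (\<forall>z\<in>unit_circle_at_1. cmod (f z - g z) \<le> e) \<and> norm (A - B) \<le> e"
  shows "represents f A"
  unfolding represents_def
proof (intro allI impI)
  fix e :: real assume "e > 0"
  then have e: "e / 2 > 0" by simp
  obtain g B where gB: "represents g B"
    "\<And>z. z \<in> unit_circle_at_1 \<Longrightarrow> cmod (f z - g z) \<le> e / 2" "norm (A - B) \<le> e / 2"
    using assms[OF e] by blast
  obtain p P where pP: "poly_of p P"
    "\<And>z. z \<in> unit_circle_at_1 \<Longrightarrow> cmod (g z - p z) \<le> e / 2" "norm (B - P) \<le> e / 2"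
    using representsE[OF gB(1) e] by blast
  have "cmod (f z - p z) \<le> e" if "z \<in> unit_circle_at_1" for z
    using gB(2)[OF that] pP(2)[OF that] norm_triangle_ineq[of "f z - g z" "g z - p z"] by simp
  moreover have "norm (A - P) \<le> e"
    using gB(3) pP(3) norm_triangle_ineq[of "A - B" "B - P"] by simp
  ultimately show "\<exists>p P. poly_of p P \<and> (\<forall>z\<in>unit_circle_at_1. cmod (f z - p z) \<le> e) \<and> norm (A - P) \<le> e"
    using pP(1) by blast
qed

lemma represents_cong:
  assumes "represents f A" "\<And>z. z \<in> unit_circle_at_1 \<Longrightarrow> f z = g z"
  shows "represents g A"
  using assms unfolding represents_def by simp

lemma represents_norm_le:
  assumes "represents f A" and s: "\<And>z. z \<in> unit_circle_at_1 \<Longrightarrow> cmod (f z) \<le> s"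
  shows "norm A \<le> s"
proof (rule field_le_epsilon)
  fix e :: real assume "e > 0"
  then obtain p P where P: "poly_of p P"
    "\<And>z. z \<in> unit_circle_at_1 \<Longrightarrow> cmod (f z - p z) \<le> e / 2" "norm (A - P) \<le> e / 2"
    using representsE[OF assms(1), of "e / 2"] by auto
  have "norm P \<le> s + e / 2"
  proof (rule poly_of_norm_le[OF P(1)])
    fix z assume z: "z \<in> unit_circle_at_1"
    show "cmod (p z) \<le> s + e / 2"
      using P(2)[OF z] s[OF z] norm_triangle_ineq3[of "f z" "p z"] by linarith
  qed
  then show "norm A \<le> s + e"
    using P(3) norm_triangle_ineq3[of A P] by linarith
qed

lemma represents_norm_ge:
  assumes "represents f A" and z: "z \<in> unit_circle_at_1"
  shows "cmod (f z) \<le> norm A"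
proof (rule field_le_epsilon)
  fix e :: real assume "e > 0"
  then obtain p P where P: "poly_of p P"
    "\<And>z. z \<in> unit_circle_at_1 \<Longrightarrow> cmod (f z - p z) \<le> e / 2" "norm (A - P) \<le> e / 2"
    using representsE[OF assms(1), of "e / 2"] by auto
  show "cmod (f z) \<le> norm A + e"
    using P(2)[OF z] poly_of_norm_ge[OF P(1) z] P(3) norm_triangle_ineq3[of A P]
      norm_triangle_ineq3[of "f z" "p z"] by linarith
qed

lemma represents_add:
  assumes "represents f A" "represents g B"
  shows "represents (\<lambda>z. f z + g z) (A + B)"
  unfolding represents_def
proof (intro allI impI)
  fix e :: real assume "e > 0"
  then have e: "e / 2 > 0" by simp
  obtain p P where P: "poly_of p P"
    "\<And>z. z \<in> unit_circle_at_1 \<Longrightarrow> cmod (f z - p z) \<le> e / 2" "norm (A - P) \<le> e / 2"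
    using representsE[OF assms(1) e] by blast
  obtain q Q where Q: "poly_of q Q"
    "\<And>z. z \<in> unit_circle_at_1 \<Longrightarrow> cmod (g z - q z) \<le> e / 2" "norm (B - Q) \<le> e / 2"
    using representsE[OF assms(2) e] by blast
  have "cmod (f z + g z - (p z + q z)) \<le> e" if "z \<in> unit_circle_at_1" for z
    using P(2)[OF that] Q(2)[OF that] norm_diff_triangle_ineq[of "f z" "g z" "p z" "q z"] by simp
  moreover have "norm (A + B - (P + Q)) \<le> e"
    using P(3) Q(3) norm_diff_triangle_ineq[of A B P Q] by simp
  ultimately show "\<exists>p P. poly_of p P \<and>
      (\<forall>z\<in>unit_circle_at_1. cmod (f z + g z - p z) \<le> e) \<and> norm (A + B - P) \<le> e"
    using poly_of.add[OF P(1) Q(1)] by blast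
qed

text \<open>
  Multiplication is uniformly continuous on bounded sets only. One constant bounds the functions and the operators
  alike, because represented functions are bounded by the norms of their operators.
\<close>

lemma represents_mult:
  assumes "represents f A" "represents g B"
  shows "represents (\<lambda>z. f z * g z) (A o\<^sub>L B)"
  unfolding represents_def
proof (intro allI impI)
  fix e :: real assume e: "e > 0"
  define C where "C = norm A + norm B + 1"
  (* d <= 1 keeps the approximating factor bounded by norm B + 1 *)
  define d where "d = min 1 (e / C)"
  have C: "C > 0" unfolding C_def by (smt (verit) norm_ge_zero)
  then have d: "d > 0" "d \<le> 1" "d * C \<le> e"
    using e by (auto simp: d_def min_def field_simps)
  obtain p P where P: "poly_of p P"
    "\<And>z. z \<in> unit_circle_at_1 \<Longrightarrow> cmod (f z - p z) \<le> d" "norm (A - P) \<le> d"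
    using representsE[OF assms(1) d(1)] by blast
  obtain q Q where Q: "poly_of q Q"
    "\<And>z. z \<in> unit_circle_at_1 \<Longrightarrow> cmod (g z - q z) \<le> d" "norm (B - Q) \<le> d"
    using representsE[OF assms(2) d(1)] by blast
  have "cmod (f z * g z - p z * q z) \<le> e" if z: "z \<in> unit_circle_at_1" for z
  proof -
    have f: "cmod (f z) \<le> norm A" using represents_norm_ge[OF assms(1) z] .
    have q: "cmod (q z) \<le> norm B + 1"
      using represents_norm_ge[OF assms(2) z] Q(2)[OF z] d norm_triangle_ineq3[of "g z" "q z"] by linarith
    have "f z * g z - p z * q z = f z * (g z - q z) + (f z - p z) * q z"
      by (simp add: algebra_simps)
    then have "cmod (f z * g z - p z * q z) \<le> cmod (f z) * cmod (g z - q z) + cmod (f z - p z) * cmod (q z)"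
      by (metis norm_triangle_ineq norm_mult)
    also have "\<dots> \<le> norm A * d + d * (norm B + 1)"
      using f q P(2)[OF z] Q(2)[OF z] d(1) by (intro add_mono mult_mono) auto
    also have "\<dots> \<le> e" using d(3) by (simp add: C_def algebra_simps)
    finally show ?thesis .
  qed
  moreover have "norm ((A o\<^sub>L B) - (P o\<^sub>L Q)) \<le> e"
  proof -
    have q: "norm Q \<le> norm B + 1"
      using Q(3) d norm_triangle_ineq3[of B Q] by linarith
    have "(A o\<^sub>L B) - (P o\<^sub>L Q) = (A o\<^sub>L (B - Q)) + ((A - P) o\<^sub>L Q)"
      by (intro blinfun_eqI) (simp add: blinfun.diff_left blinfun.diff_right blinfun.add_left)
    then have "norm ((A o\<^sub>L B) - (P o\<^sub>L Q)) \<le> norm (A o\<^sub>L (B - Q)) + norm ((A - P) o\<^sub>L Q)"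
      by (metis norm_triangle_ineq)
    also have "\<dots> \<le> norm A * norm (B - Q) + norm (A - P) * norm Q"
      by (intro add_mono norm_blinfun_compose)
    also have "\<dots> \<le> norm A * d + d * (norm B + 1)"
      using q P(3) Q(3) d by (intro add_mono mult_mono) auto
    also have "\<dots> \<le> e" using d(3) by (simp add: C_def algebra_simps)
    finally show ?thesis .
  qed
  ultimately show "\<exists>p P. poly_of p P \<and>
      (\<forall>z\<in>unit_circle_at_1. cmod (f z * g z - p z) \<le> e) \<and> norm ((A o\<^sub>L B) - P) \<le> e"
    using poly_of.mult[OF P(1) Q(1)] by blast
qed

lemma represents_const: "represents (\<lambda>z. c) (scalar_op c)"
  by (rule represents_poly_of[OF poly_of.const])

lemma represents_id: "represents (\<lambda>z. z) T"
  by (rule represents_poly_of[OF poly_of.id])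

lemma represents_diff:
  assumes "represents f A" "represents g B"
  shows "represents (\<lambda>z. f z - g z) (A - B)"
proof -
  have "represents (\<lambda>z. f z + (-1) * g z) (A + (scalar_op (-1) o\<^sub>L B))"
    by (intro represents_add represents_mult represents_const assms)
  moreover have "A + (scalar_op (-1) o\<^sub>L B) = A - B"
    by (intro blinfun_eqI)
      (simp add: blinfun.add_left blinfun.diff_left scalar_op_apply scaleC_minus_left scaleC_one)
  ultimately show ?thesis by simp
qed

lemma represents_unique:
  assumes "represents f A" "represents g B" "\<And>z. z \<in> unit_circle_at_1 \<Longrightarrow> f z = g z"
  shows "A = B"
proof -
  have "norm (A - B) \<le> 0"
    by (rule represents_norm_le[OF represents_diff[OF assms(1,2)]]) (simp add: assms(3))
  then show ?thesis by simp
qed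

text \<open>
  Polynomials have their formal conjugates as adjoints; the adjoint relation survives the limit
  because conjugate polynomials approximate the conjugate function equally well.
\<close>

lemma represents_adjoint:
  assumes "represents f A" "represents (\<lambda>z. cnj (f z)) S"
  shows "is_adjoint S A"
  unfolding is_adjoint_def
proof (intro allI)
  fix v w
  have "cmod (cinner (A v) w - cinner v (S w)) \<le> 0 + e" if "e > 0" for e
  proof -
    define d where "d = e / (2 * (norm v * norm w + 1))"
    have pos: "norm v * norm w + 1 > 0" by (simp add: add_nonneg_pos)
    then have d: "d > 0" using that by (simp add: d_def)
    obtain p P where P: "poly_of p P"
      "\<And>z. z \<in> unit_circle_at_1 \<Longrightarrow> cmod (f z - p z) \<le> d" "norm (A - P) \<le> d"
      using representsE[OF assms(1) d] by blast
    obtain P' where P': "poly_of (\<lambda>z. cnj (p z)) P'" "is_adjoint P' P"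
      using poly_of_adjoint[OF P(1)] by blast
    have S: "norm (S - P') \<le> d"
      by (rule represents_norm_le[OF represents_diff[OF assms(2) represents_poly_of[OF P'(1)]]])
        (use P(2) in \<open>simp flip: complex_cnj_diff\<close>)
    have "cinner (A v) w - cinner v (S w) = cinner ((A - P) v) w - cinner v ((S - P') w)"
      by (simp add: blinfun.diff_left cinner_diff_left cinner_diff_right is_adjointD[OF P'(2)])
    then have "cmod (cinner (A v) w - cinner v (S w))
        \<le> cmod (cinner ((A - P) v) w) + cmod (cinner v ((S - P') w))"
      by (metis norm_triangle_ineq4)
    also have "\<dots> \<le> norm ((A - P) v) * norm w + norm v * norm ((S - P') w)"
      by (intro add_mono cmod_cinner_le)
    also have "\<dots> \<le> (d * norm v) * norm w + norm v * (d * norm w)"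
      using P(3) S by (intro add_mono mult_right_mono mult_left_mono order_trans[OF norm_blinfun]) auto
    also have "\<dots> = (2 * d) * (norm v * norm w)"
      by simp
    also have "\<dots> \<le> (2 * d) * (norm v * norm w + 1)"
      using d by simp
    also have "\<dots> = e"
      using pos by (simp only: d_def) (simp add: field_simps)
    finally show ?thesis by simp
  qed
  then have "cmod (cinner (A v) w - cinner v (S w)) \<le> 0"
    by (rule field_le_epsilon)
  then show "cinner (A v) w = cinner v (S w)"
    by simp
qed

lemma real_polynomial_function_poly_of:
  fixes q :: "complex \<Rightarrow> real"
  assumes "real_polynomial_function q"
  shows "\<exists>Q. poly_of (\<lambda>z. complex_of_real (q z)) Q"
  using assms
proof (induction rule: real_polynomial_function.induct)
  case (linear q)
  (* q z = q 1 * Re z + q i * Im z, written with z and its conjugate *)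
  define a where "a = Complex (q 1 / 2) (- q \<i> / 2)"
  have "complex_of_real (q z) = a * z + cnj a * cnj z" for z
  proof -
    have "q (Re z *\<^sub>R 1 + Im z *\<^sub>R \<i>) = Re z * q 1 + Im z * q \<i>"
      using bounded_linear.linear[OF linear] by (simp only: linear_add linear_cmul real_scaleR_def)
    moreover have "Re z *\<^sub>R 1 + Im z *\<^sub>R \<i> = z"
      by (simp add: complex_eq_iff)
    ultimately have "q z = Re z * q 1 + Im z * q \<i>"
      by simp
    then show ?thesis
      by (simp add: complex_eq_iff a_def)
  qed
  then have "(\<lambda>z. complex_of_real (q z)) = (\<lambda>z. a * z + cnj a * cnj z)"
    by auto
  then show ?case
    using poly_of.add[OF poly_of.mult[OF poly_of.const poly_of.id] poly_of.mult[OF poly_of.const poly_of.cnj]]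
    by metis
next
  case (const c)
  then show ?case using poly_of.const by blast
next
  case (add f g)
  then show ?case using poly_of.add by (simp only: of_real_add) blast
next
  case (mult f g)
  then show ?case using poly_of.mult by (simp only: of_real_mult) blast
qed

text \<open>
  A real polynomial in the real and imaginary parts of \<open>z\<close> is a polynomial in \<open>z\<close> and its
  conjugate, so the Stone-Weierstrass theorem on the plane applies.
\<close>

lemma poly_of_dense:
  assumes "continuous_on unit_circle_at_1 f" "e > 0"
  shows "\<exists>p P. poly_of p P \<and> (\<forall>z\<in>unit_circle_at_1. cmod (f z - p z) \<le> e)"
proof -
  obtain g where g: "polynomial_function g" "\<forall>z\<in>unit_circle_at_1. cmod (f z - g z) < e"
    using Stone_Weierstrass_polynomial_function[OF compact_unit_circle_at_1 assms] by blast
  have "real_polynomial_function (Re \<circ> g)" "real_polynomial_function (Im \<circ> g)"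
    using g(1) bounded_linear_Re bounded_linear_Im by (auto simp: polynomial_function_def)
  then obtain P Q where "poly_of (\<lambda>z. complex_of_real (Re (g z))) P" "poly_of (\<lambda>z. complex_of_real (Im (g z))) Q"
    using real_polynomial_function_poly_of unfolding comp_def by blast
  note re_im = poly_of.add[OF this(1) poly_of.mult[OF poly_of.const[of \<i>] this(2)]]
  have "(\<lambda>z. complex_of_real (Re (g z)) + \<i> * complex_of_real (Im (g z))) = g"
    by (simp add: complex_eq_iff fun_eq_iff)
  then have "poly_of g (P + (scalar_op \<i> o\<^sub>L Q))"
    using re_im by simp
  then show ?thesis
    using g(2) by (meson less_imp_le)
qed

lemma represents_exists:
  assumes f: "continuous_on unit_circle_at_1 f"
  shows "\<exists>A. represents f A"
proof -
  define e where "e n = 1 / (real n + 1)" for n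
  have "\<exists>p P. poly_of p P \<and> (\<forall>z\<in>unit_circle_at_1. cmod (f z - p z) \<le> e n)" for n
    using poly_of_dense[OF f, of "e n"] by (simp add: e_def)
  then obtain p P where P: "\<And>n. poly_of (p n) (P n)"
    "\<And>n z. z \<in> unit_circle_at_1 \<Longrightarrow> cmod (f z - p n z) \<le> e n"
    by metis
  have dist: "norm (P m - P n) \<le> e m + e n" for m n
  proof (rule represents_norm_le[OF represents_diff[OF represents_poly_of[OF P(1)] represents_poly_of[OF P(1)]]])
    fix z assume z: "z \<in> unit_circle_at_1"
    show "cmod (p m z - p n z) \<le> e m + e n"
      using norm_triangle_ineq4[of "f z - p n z" "f z - p m z"] P(2)[OF z, of m] P(2)[OF z, of n] by simp
  qed
  have small: "\<exists>N. \<forall>n\<ge>N. e n < d" if "d > 0" for d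
  proof -
    have "e \<longlonglongrightarrow> 0"
      unfolding e_def[abs_def] using LIMSEQ_inverse_real_of_nat
      by (simp add: inverse_eq_divide add.commute)
    then show ?thesis
      using that by (metis order_tendstoD(2) eventually_sequentially)
  qed
  have "Cauchy P"
  proof (rule metric_CauchyI)
    fix d :: real assume "d > 0"
    then obtain N where N: "\<And>n. n \<ge> N \<Longrightarrow> e n < d / 2"
      using small[of "d / 2"] by auto
    have "dist (P m) (P n) < d" if "m \<ge> N" "n \<ge> N" for m n
      using dist[of m n] N[OF that(1)] N[OF that(2)] by (simp add: dist_norm)
    then show "\<exists>N. \<forall>m\<ge>N. \<forall>n\<ge>N. dist (P m) (P n) < d" by blast
  qed
  then obtain A where A: "P \<longlonglongrightarrow> A"
    by (auto simp: Cauchy_convergent_iff convergent_def)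
  have "represents f A"
    unfolding represents_def
  proof (intro allI impI)
    fix d :: real assume d: "d > 0"
    obtain N where N: "\<And>n. n \<ge> N \<Longrightarrow> e n < d"
      using small[OF d] by auto
    obtain M where M: "\<And>n. n \<ge> M \<Longrightarrow> norm (P n - A) < d"
      using LIMSEQ_D[OF A d] by auto
    show "\<exists>p P. poly_of p P \<and> (\<forall>z\<in>unit_circle_at_1. cmod (f z - p z) \<le> d) \<and> norm (A - P) \<le> d"
    proof (intro exI conjI ballI)
      show "poly_of (p (max M N)) (P (max M N))" by (rule P)
      show "norm (A - P (max M N)) \<le> d"
        using M[of "max M N"] by (simp add: norm_minus_commute)
      show "cmod (f z - p (max M N) z) \<le> d" if "z \<in> unit_circle_at_1" for z
        using P(2)[OF that, of "max M N"] N[of "max M N"] by simp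
    qed
  qed
  then show ?thesis by blast
qed

text \<open>
  Off the circle the resolvent is the operator of the continuous function \<open>1 / (z - w)\<close>. On the
  circle an inverse of \<open>z - T\<close> would be unbounded on the approximate eigenvectors.
\<close>

lemma spectrum_T: "spectrum T = unit_circle_at_1"
proof (intro set_eqI iffI)
  fix z assume z: "z \<in> spectrum T"
  show "z \<in> unit_circle_at_1"
  proof (rule ccontr)
    assume nz: "z \<notin> unit_circle_at_1"
    then have "continuous_on unit_circle_at_1 (\<lambda>w. 1 / (z - w))"
      by (intro continuous_intros) auto
    then obtain S where S: "represents (\<lambda>w. 1 / (z - w)) S"
      using represents_exists by blast
    have zT: "represents (\<lambda>w. z - w) (scalar_op z - T)"
      by (intro represents_diff represents_const represents_id)
    have one: "represents (\<lambda>w. 1) id_blinfun"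
      using represents_const[of 1] by (simp add: scalar_op_1)
    have "S o\<^sub>L (scalar_op z - T) = id_blinfun"
      by (rule represents_unique[OF represents_mult[OF S zT] one]) (use nz in auto)
    then have left: "S (z *\<^sub>C f - T f) = f" for f
      by (metis blinfun.diff_left blinfun_apply_blinfun_compose blinfun_apply_id_blinfun id_apply scalar_op_apply)
    have "(scalar_op z - T) o\<^sub>L S = id_blinfun"
      by (rule represents_unique[OF represents_mult[OF zT S] one]) (use nz in auto)
    then have right: "z *\<^sub>C S f - T (S f) = f" for f
      by (metis blinfun.diff_left blinfun_apply_blinfun_compose blinfun_apply_id_blinfun id_apply scalar_op_apply)
    have cont': "continuous_on unit_circle_at_1 (\<lambda>w. cnj (1 / (z - w)))"
      using nz by (intro continuous_intros) auto
    then obtain S' where "represents (\<lambda>w. cnj (1 / (z - w))) S'"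
      using represents_exists by blast
    then have "complex_linear S"
      using represents_adjoint[OF S] is_adjoint_sym complex_linear_if_adjoint by blast
    with left right z show False
      unfolding spectrum_def by blast
  qed
next
  fix z assume z: "z \<in> unit_circle_at_1"
  show "z \<in> spectrum T"
    unfolding spectrum_def
  proof (intro CollectI notI)
    assume "\<exists>S. complex_linear S \<and> (\<forall>f. S (z *\<^sub>C f - T f) = f \<and> z *\<^sub>C S f - T (S f) = f)"
    then obtain S :: "l2 \<Rightarrow>\<^sub>L l2" where S: "\<And>f. S (z *\<^sub>C f - T f) = f" by blast
    have "1 / (2 * (norm S + 1)) > 0" by (simp add: add_nonneg_pos)
    then obtain f where f: "norm f = 1" "norm (T f - z *\<^sub>C f) \<le> 1 / (2 * (norm S + 1))"
      using approx_eigenvector[OF z] by blast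
    have "1 = norm (S (z *\<^sub>C f - T f))"
      by (simp add: S f)
    also have "\<dots> \<le> norm S * norm (T f - z *\<^sub>C f)"
      by (metis norm_blinfun norm_minus_commute)
    also have "\<dots> \<le> norm S * (1 / (2 * (norm S + 1)))"
      by (intro mult_left_mono f) auto
    also have "\<dots> < 1"
      by (simp add: divide_simps add_nonneg_pos add_nonneg_eq_0_iff)
    finally show False by simp
  qed
qed

lemma represents_linear:
  assumes "represents f A" "continuous_on unit_circle_at_1 f"
  shows "complex_linear A"
proof -
  have "continuous_on unit_circle_at_1 (\<lambda>z. cnj (f z))"
    using assms(2) by (intro continuous_intros)
  then obtain S where "represents (\<lambda>z. cnj (f z)) S"
    using represents_exists by blast
  then show ?thesis
    using represents_adjoint[OF assms(1)] is_adjoint_sym complex_linear_if_adjoint by blast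
qed

lemma represents_norm:
  assumes "represents f A" "continuous_on unit_circle_at_1 f"
  shows "norm A = (SUP z\<in>unit_circle_at_1. cmod (f z))"
proof (rule antisym)
  have bdd: "bdd_above ((\<lambda>z. cmod (f z)) ` unit_circle_at_1)"
    using represents_norm_ge[OF assms(1)] by (intro bdd_aboveI2)
  show "norm A \<le> (SUP z\<in>unit_circle_at_1. cmod (f z))"
    by (rule represents_norm_le[OF assms(1)]) (intro cSUP_upper bdd)
  show "(SUP z\<in>unit_circle_at_1. cmod (f z)) \<le> norm A"
    using zero_in_unit_circle_at_1 by (intro cSUP_least represents_norm_ge[OF assms(1)]) auto
qed

definition calculus :: "(complex \<Rightarrow> complex) \<Rightarrow> (l2 \<Rightarrow>\<^sub>L l2)" where
  "calculus f = (SOME A. represents f A)"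

lemma represents_calculus: "continuous_on unit_circle_at_1 f \<Longrightarrow> represents f (calculus f)"
  unfolding calculus_def using represents_exists by (rule someI_ex)

lemma calculus_eqI:
  assumes "represents f A"
  shows "calculus f = A"
proof -
  have "represents f (calculus f)"
    unfolding calculus_def using assms by (rule someI)
  then show ?thesis
    using assms by (rule represents_unique) simp
qed

lemma functional_calculus_calculus: "functional_calculus T calculus"
  unfolding functional_calculus_def spectrum_T
proof (intro conjI allI impI)
  fix f g :: "complex \<Rightarrow> complex"
  assume f: "continuous_on unit_circle_at_1 f" and g: "continuous_on unit_circle_at_1 g"
  note fg = represents_calculus[OF f] represents_calculus[OF g]
  show "calculus f = calculus g" if "\<forall>z\<in>unit_circle_at_1. f z = g z"
    using represents_unique[OF fg] that by blast
  show "calculus (\<lambda>z. f z + g z) = calculus f + calculus g"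
    by (intro calculus_eqI represents_add fg)
  show "calculus (\<lambda>z. f z * g z) = calculus f o\<^sub>L calculus g"
    by (intro calculus_eqI represents_mult fg)
next
  fix f :: "complex \<Rightarrow> complex" and c h
  assume f: "continuous_on unit_circle_at_1 f"
  note fg = represents_calculus[OF f]
  show "complex_linear (calculus f)"
    using represents_linear[OF fg f] .
  have "calculus (\<lambda>z. c * f z) = scalar_op c o\<^sub>L calculus f"
    by (intro calculus_eqI represents_mult fg represents_const)
  then show "calculus (\<lambda>z. c * f z) h = c *\<^sub>C calculus f h"
    by (simp add: scalar_op_apply)
  show "is_adjoint (calculus (\<lambda>z. cnj (f z))) (calculus f)"
    using f by (intro represents_adjoint[OF fg] represents_calculus continuous_intros)
  show "norm (calculus f) = (SUP z\<in>unit_circle_at_1. cmod (f z))"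
    using represents_norm[OF fg f] .
next
  show "calculus (\<lambda>_. 1) = id_blinfun"
    using represents_const[of 1] by (intro calculus_eqI) (simp add: scalar_op_1)
  show "calculus (\<lambda>z. z) = T"
    by (intro calculus_eqI represents_id)
qed

text \<open>
  Uniqueness of the calculus: its algebraic properties force the values on polynomials, where \<open>T'\<close> is
  pinned down as the adjoint of \<open>T\<close>, and its isometry forces the values on uniform limits.
\<close>

lemma functional_calculus_represents:
  assumes "functional_calculus T \<Phi>" and f: "continuous_on unit_circle_at_1 f"
  shows "represents f (\<Phi> f)"
proof -
  note fc = assms(1)[unfolded functional_calculus_def spectrum_T]
  have sum: "\<Phi> (\<lambda>z. f z + g z) = \<Phi> f + \<Phi> g" and prod: "\<Phi> (\<lambda>z. f z * g z) = \<Phi> f o\<^sub>L \<Phi> g"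
    if "continuous_on unit_circle_at_1 f" "continuous_on unit_circle_at_1 g" for f g
    using fc that by blast+
  have scale: "\<Phi> (\<lambda>z. c * f z) h = c *\<^sub>C \<Phi> f h"
    and adj: "is_adjoint (\<Phi> (\<lambda>z. cnj (f z))) (\<Phi> f)"
    and norm: "norm (\<Phi> f) = (SUP z\<in>unit_circle_at_1. cmod (f z))"
    if "continuous_on unit_circle_at_1 f" for f c h
    using fc that by blast+
  have one: "\<Phi> (\<lambda>_. 1) = id_blinfun" and id: "\<Phi> (\<lambda>z. z) = T"
    using fc by blast+
  have poly: "poly_of p P \<Longrightarrow> \<Phi> p = P" for p P
  proof (induction rule: poly_of.induct)
    case (const c)
    show ?case
      using scale[of "\<lambda>_. 1" c] by (intro blinfun_eqI) (simp add: one scalar_op_apply)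
  next
    case cnj
    have "is_adjoint (\<Phi> cnj) T"
      using adj[of "\<lambda>z. z"] by (simp add: id)
    then show ?case
      using is_adjoint_unique T_adjoint by blast
  qed (use sum prod id poly_of_cont in auto)
  show ?thesis
    unfolding represents_def
  proof (intro allI impI)
    fix e :: real assume e: "e > 0"
    obtain p P where P: "poly_of p P" "\<And>z. z \<in> unit_circle_at_1 \<Longrightarrow> cmod (f z - p z) \<le> e"
      using poly_of_dense[OF f e] by blast
    have p: "continuous_on unit_circle_at_1 p"
      by (rule poly_of_cont[OF P(1)])
    have "\<Phi> (\<lambda>z. f z + (-1) * p z) = \<Phi> f + \<Phi> (\<lambda>z. (-1) * p z)"
      using p by (intro sum f continuous_intros)
    also have "\<Phi> (\<lambda>z. (-1) * p z) = - P"
      using scale[OF p, of "-1"] poly[OF P(1)]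
      by (intro blinfun_eqI) (simp add: blinfun.minus_left scaleC_minus_left scaleC_one)
    finally have "norm (\<Phi> f - P) = norm (\<Phi> (\<lambda>z. f z - p z))"
      by simp
    also have "\<dots> = (SUP z\<in>unit_circle_at_1. cmod (f z - p z))"
      using p f by (intro norm continuous_intros)
    also have "\<dots> \<le> e"
      using P(2) zero_in_unit_circle_at_1 by (intro cSUP_least) auto
    finally show "\<exists>p P. poly_of p P \<and>
        (\<forall>z\<in>unit_circle_at_1. cmod (f z - p z) \<le> e) \<and> norm (\<Phi> f - P) \<le> e"
      using P by blast
  qed
qed

lemma apply_fun_eqI:
  assumes "continuous_on unit_circle_at_1 f" "represents f A"
  shows "apply_fun f T = A"
  unfolding apply_fun_def
proof (rule the_equality)
  show "\<exists>\<Phi>. functional_calculus T \<Phi> \<and> A = \<Phi> f"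
    using functional_calculus_calculus calculus_eqI[OF assms(2)] by blast
next
  fix S assume "\<exists>\<Phi>. functional_calculus T \<Phi> \<and> S = \<Phi> f"
  then have "represents f S"
    using functional_calculus_represents[OF _ assms(1)] by blast
  then show "S = A"
    using assms(2) by (rule represents_unique) simp
qed

end

section \<open>Averages over dilations\<close>

lemma ennreal_two_mult_le_squares: "2 * (a * b) \<le> a\<^sup>2 + (b::ennreal)\<^sup>2"
proof (cases "a = top \<or> b = top")
  case True
  then show ?thesis by (auto simp: power2_eq_square ennreal_mult_top ennreal_top_mult)
next
  case False
  then obtain x y where "a = ennreal x" "x \<ge> 0" "b = ennreal y" "y \<ge> 0"
    by (metis ennreal_cases)
  then show ?thesis
    using sum_squares_bound[of x y]
    by (simp add: ennreal_power ennreal_le_iff mult.assoc flip: ennreal_mult ennreal_plus ennreal_numeral)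
qed

text \<open>
  The Cauchy-Schwarz inequality for a weighted measure. Writing the square as a double integral and
  applying \<open>2 a b \<le> a\<^sup>2 + b\<^sup>2\<close> to the integrand stays valid when the integrals are infinite.
\<close>

lemma nn_integral_weighted_square_le:
  fixes w h :: "real \<Rightarrow> ennreal"
  assumes [measurable]: "w \<in> borel_measurable lborel" "h \<in> borel_measurable lborel"
  shows "(\<integral>\<^sup>+u. w u * h u \<partial>lborel)\<^sup>2 \<le> (\<integral>\<^sup>+u. w u \<partial>lborel) * (\<integral>\<^sup>+u. w u * (h u)\<^sup>2 \<partial>lborel)"
proof -
  let ?I = "\<integral>\<^sup>+u. w u * h u \<partial>lborel" and ?W = "\<integral>\<^sup>+u. w u \<partial>lborel"
    and ?H = "\<integral>\<^sup>+u. w u * (h u)\<^sup>2 \<partial>lborel"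
  have "2 * ?I\<^sup>2 = (\<integral>\<^sup>+u. \<integral>\<^sup>+v. w u * w v * (2 * (h u * h v)) \<partial>lborel \<partial>lborel)"
  proof -
    have "(\<integral>\<^sup>+u. \<integral>\<^sup>+v. w u * w v * (2 * (h u * h v)) \<partial>lborel \<partial>lborel)
        = (\<integral>\<^sup>+u. \<integral>\<^sup>+v. (2 * (w u * h u)) * (w v * h v) \<partial>lborel \<partial>lborel)"
      by (simp add: mult_ac)
    also have "\<dots> = (\<integral>\<^sup>+u. (2 * (w u * h u)) * ?I \<partial>lborel)"
      by (simp add: nn_integral_cmult)
    also have "\<dots> = (\<integral>\<^sup>+u. 2 * (w u * h u) \<partial>lborel) * ?I"
      by (rule nn_integral_multc) measurable
    also have "\<dots> = 2 * ?I\<^sup>2"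
      by (simp add: nn_integral_cmult power2_eq_square mult.assoc)
    finally show ?thesis by simp
  qed
  also have "\<dots> \<le> (\<integral>\<^sup>+u. \<integral>\<^sup>+v. w u * w v * ((h u)\<^sup>2 + (h v)\<^sup>2) \<partial>lborel \<partial>lborel)"
    by (intro nn_integral_mono mult_left_mono ennreal_two_mult_le_squares) auto
  also have "\<dots> = (\<integral>\<^sup>+u. \<integral>\<^sup>+v. (w u * (h u)\<^sup>2) * w v + w u * (w v * (h v)\<^sup>2) \<partial>lborel \<partial>lborel)"
    by (simp add: distrib_left mult_ac)
  also have "\<dots> = (\<integral>\<^sup>+u. (w u * (h u)\<^sup>2) * ?W + w u * ?H \<partial>lborel)"
    by (simp add: nn_integral_add nn_integral_cmult)
  also have "\<dots> = (\<integral>\<^sup>+u. (w u * (h u)\<^sup>2) * ?W \<partial>lborel) + (\<integral>\<^sup>+u. w u * ?H \<partial>lborel)"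
    by (rule nn_integral_add) measurable
  also have "(\<integral>\<^sup>+u. (w u * (h u)\<^sup>2) * ?W \<partial>lborel) = ?H * ?W"
    by (rule nn_integral_multc) measurable
  also have "(\<integral>\<^sup>+u. w u * ?H \<partial>lborel) = ?W * ?H"
    by (rule nn_integral_multc) measurable
  also have "?H * ?W + ?W * ?H = 2 * (?W * ?H)"
    by (simp add: mult_2 mult.commute)
  finally show ?thesis
    by (simp add: ennreal_mult_le_mult_iff)
qed

lemma nn_integral_scale:
  assumes [measurable]: "g \<in> borel_measurable borel" and c: "c \<noteq> (0::real)"
  shows "(\<integral>\<^sup>+x. g x \<partial>lborel) = ennreal \<bar>c\<bar> * (\<integral>\<^sup>+x. g (c * x) \<partial>lborel)"
  by (subst nn_integral_real_affine[OF assms(1) c, of 0]) simp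

text \<open>
  Schur's test for the operators that average over dilations: the factor \<open>\<bar>u\<bar>\<^bsup>-1/2\<^esup>\<close> is the norm of
  the dilation \<open>f \<mapsto> (\<lambda>x. f (u * x))\<close> on \<open>L\<^sup>2\<close>. The inequality is applied with weight
  \<open>k u / sqrt \<bar>u\<bar>\<close> and function \<open>sqrt \<bar>u\<bar> * f (u * x)\<close>.
\<close>

lemma nn_dilation_square_le:
  fixes k f :: "real \<Rightarrow> ennreal"
  assumes [measurable]: "k \<in> borel_measurable lborel" "f \<in> borel_measurable lborel"
  shows "(\<integral>\<^sup>+x. (\<integral>\<^sup>+u. k u * f (u * x) \<partial>lborel)\<^sup>2 \<partial>lborel)
    \<le> (\<integral>\<^sup>+u. k u * ennreal (1 / sqrt \<bar>u\<bar>) \<partial>lborel)\<^sup>2 * (\<integral>\<^sup>+x. (f x)\<^sup>2 \<partial>lborel)"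
proof -
  let ?w = "\<lambda>u. k u * ennreal (1 / sqrt \<bar>u\<bar>)"
  let ?W = "\<integral>\<^sup>+u. ?w u \<partial>lborel"
  have AE0: "AE u in lborel. u \<noteq> (0::real)"
    by (rule AE_lborel_singleton)
  have one: "(\<integral>\<^sup>+u. k u * f (u * x) \<partial>lborel)
      = (\<integral>\<^sup>+u. ?w u * (ennreal (sqrt \<bar>u\<bar>) * f (u * x)) \<partial>lborel)" for x
    using AE0
  proof (intro nn_integral_cong_AE, eventually_elim)
    case (elim u)
    then have "ennreal (1 / sqrt \<bar>u\<bar>) * ennreal (sqrt \<bar>u\<bar>) = 1"
      by (simp flip: ennreal_mult)
    then show ?case
      by (metis mult.assoc mult.right_neutral)
  qed
  have sq: "(ennreal (sqrt \<bar>u\<bar>) * f y)\<^sup>2 = ennreal \<bar>u\<bar> * (f y)\<^sup>2" for u y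
    by (simp add: power_mult_distrib ennreal_power)
  have "(\<integral>\<^sup>+x. (\<integral>\<^sup>+u. k u * f (u * x) \<partial>lborel)\<^sup>2 \<partial>lborel)
      \<le> (\<integral>\<^sup>+x. ?W * (\<integral>\<^sup>+u. ?w u * (ennreal \<bar>u\<bar> * (f (u * x))\<^sup>2) \<partial>lborel) \<partial>lborel)"
    unfolding one sq[symmetric] by (intro nn_integral_mono nn_integral_weighted_square_le) measurable
  also have "\<dots> = ?W * (\<integral>\<^sup>+x. \<integral>\<^sup>+u. ?w u * (ennreal \<bar>u\<bar> * (f (u * x))\<^sup>2) \<partial>lborel \<partial>lborel)"
    by (rule nn_integral_cmult) measurable
  also have "(\<integral>\<^sup>+x. \<integral>\<^sup>+u. ?w u * (ennreal \<bar>u\<bar> * (f (u * x))\<^sup>2) \<partial>lborel \<partial>lborel)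
      = (\<integral>\<^sup>+u. \<integral>\<^sup>+x. ?w u * (ennreal \<bar>u\<bar> * (f (u * x))\<^sup>2) \<partial>lborel \<partial>lborel)"
    by (rule lborel_pair.Fubini') measurable
  also have "\<dots> = (\<integral>\<^sup>+u. ?w u * (\<integral>\<^sup>+x. (f x)\<^sup>2 \<partial>lborel) \<partial>lborel)"
    using AE0
  proof (intro nn_integral_cong_AE, eventually_elim)
    case (elim u)
    have "(\<integral>\<^sup>+x. ?w u * (ennreal \<bar>u\<bar> * (f (u * x))\<^sup>2) \<partial>lborel)
        = ?w u * (ennreal \<bar>u\<bar> * (\<integral>\<^sup>+x. (f (u * x))\<^sup>2 \<partial>lborel))"
      by (simp add: nn_integral_cmult)
    also have "ennreal \<bar>u\<bar> * (\<integral>\<^sup>+x. (f (u * x))\<^sup>2 \<partial>lborel) = (\<integral>\<^sup>+x. (f x)\<^sup>2 \<partial>lborel)"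
      using nn_integral_scale[of "\<lambda>x. (f x)\<^sup>2" u] elim by simp
    finally show ?case .
  qed
  also have "\<dots> = ?W * (\<integral>\<^sup>+x. (f x)\<^sup>2 \<partial>lborel)"
    by (rule nn_integral_multc) measurable
  finally show ?thesis
    by (simp add: power2_eq_square mult.assoc)
qed

lemma ennreal_norm_integral_le:
  fixes f :: "'a \<Rightarrow> 'b :: {banach, second_countable_topology}"
  shows "ennreal (norm (integral\<^sup>L M f)) \<le> (\<integral>\<^sup>+x. ennreal (norm (f x)) \<partial>M)"
  by (cases "integrable M f") (auto simp: integral_norm_bound_ennreal not_integrable_integral_eq)

text \<open>
  Kernels live on the whole line, so that every substitution below is a scaling \<open>u \<mapsto> c * u\<close>.
\<close>

definition admissible :: "(real \<Rightarrow> complex) \<Rightarrow> bool" where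
  "admissible k \<longleftrightarrow> k \<in> borel_measurable lborel \<and> integrable lborel (\<lambda>u. cmod (k u) / sqrt \<bar>u\<bar>)"

definition kernel_norm :: "(real \<Rightarrow> complex) \<Rightarrow> real" where
  "kernel_norm k = (\<integral>u. cmod (k u) / sqrt \<bar>u\<bar> \<partial>lborel)"

definition dilation_average :: "(real \<Rightarrow> complex) \<Rightarrow> (real \<Rightarrow> complex) \<Rightarrow> real \<Rightarrow> complex" where
  "dilation_average k f x = (\<integral>u. k u * f (u * x) \<partial>lborel)"

lemma admissible_measurable [measurable_dest]:
  "admissible k \<Longrightarrow> k \<in> borel_measurable lborel"
  by (simp add: admissible_def)

lemma nn_integral_kernel:
  assumes "admissible k"
  shows "(\<integral>\<^sup>+u. ennreal (cmod (k u)) * ennreal (1 / sqrt \<bar>u\<bar>) \<partial>lborel) = ennreal (kernel_norm k)"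
proof -
  have "(\<integral>\<^sup>+u. ennreal (cmod (k u) / sqrt \<bar>u\<bar>) \<partial>lborel) = ennreal (kernel_norm k)"
    unfolding kernel_norm_def using assms
    by (intro nn_integral_eq_integral) (auto simp: admissible_def)
  then show ?thesis
    by (simp flip: ennreal_mult)
qed

lemma kernel_norm_nonneg: "0 \<le> kernel_norm k"
  unfolding kernel_norm_def by (intro integral_nonneg_AE) auto

lemma dilation_average_measurable [measurable]:
  assumes [measurable]: "k \<in> borel_measurable lborel" "f \<in> borel_measurable lborel"
  shows "dilation_average k f \<in> borel_measurable lborel"
  unfolding dilation_average_def[abs_def] by measurable

lemma nn_dilation_bound:
  assumes k: "admissible k" and f: "square_integrable f"
  shows "(\<integral>\<^sup>+x. (\<integral>\<^sup>+u. ennreal (cmod (k u)) * ennreal (cmod (f (u * x))) \<partial>lborel)\<^sup>2 \<partial>lborel)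
    \<le> ennreal ((kernel_norm k * norm (abs_l2 f))\<^sup>2)"
proof -
  note [measurable] = admissible_measurable[OF k] square_integrable_measurable[OF f]
  have "(\<integral>\<^sup>+x. (\<integral>\<^sup>+u. ennreal (cmod (k u)) * ennreal (cmod (f (u * x))) \<partial>lborel)\<^sup>2 \<partial>lborel)
    \<le> (ennreal (kernel_norm k))\<^sup>2 * ennreal ((norm (abs_l2 f))\<^sup>2)"
    using nn_dilation_square_le[of "\<lambda>u. ennreal (cmod (k u))" "\<lambda>x. ennreal (cmod (f x))"]
    unfolding nn_integral_kernel[OF k] by (simp add: ennreal_power nn_integral_norm_abs_l2[OF f])
  then show ?thesis
    using kernel_norm_nonneg[of k] by (simp add: ennreal_power power_mult_distrib flip: ennreal_mult)
qed

lemma AE_nn_dilation_finite: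
  assumes k: "admissible k" and f: "square_integrable f"
  shows "AE x in lborel. (\<integral>\<^sup>+u. ennreal (cmod (k u)) * ennreal (cmod (f (u * x))) \<partial>lborel) < \<infinity>"
proof -
  note [measurable] = admissible_measurable[OF k] square_integrable_measurable[OF f]
  have "AE x in lborel. (\<integral>\<^sup>+u. ennreal (cmod (k u)) * ennreal (cmod (f (u * x))) \<partial>lborel)\<^sup>2 \<noteq> \<infinity>"
    using nn_dilation_bound[OF assms] by (intro nn_integral_noteq_infinite) (auto simp: top_unique)
  then show ?thesis
    by eventually_elim (auto simp: power2_eq_square ennreal_mult_eq_top_iff less_top)
qed

lemma AE_dilation_integrable:
  assumes k: "admissible k" and f: "square_integrable f"
  shows "AE x in lborel. integrable lborel (\<lambda>u. k u * f (u * x))"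
proof -
  note [measurable] = admissible_measurable[OF k] square_integrable_measurable[OF f]
  from AE_nn_dilation_finite[OF assms] show ?thesis
    by eventually_elim (auto intro!: integrableI_bounded simp: norm_mult ennreal_mult)
qed

lemma dilation_average_L2:
  assumes k: "admissible k" and f: "square_integrable f"
  shows "square_integrable (dilation_average k f)"
    and "norm (abs_l2 (dilation_average k f)) \<le> kernel_norm k * norm (abs_l2 f)"
proof -
  note [measurable] = admissible_measurable[OF k] square_integrable_measurable[OF f]
  have "(\<integral>\<^sup>+x. ennreal ((cmod (dilation_average k f x))\<^sup>2) \<partial>lborel)
     \<le> (\<integral>\<^sup>+x. (\<integral>\<^sup>+u. ennreal (cmod (k u)) * ennreal (cmod (f (u * x))) \<partial>lborel)\<^sup>2 \<partial>lborel)"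
  proof (intro nn_integral_mono)
    fix x
    show "ennreal ((cmod (dilation_average k f x))\<^sup>2)
        \<le> (\<integral>\<^sup>+u. ennreal (cmod (k u)) * ennreal (cmod (f (u * x))) \<partial>lborel)\<^sup>2"
      unfolding dilation_average_def
      by (subst ennreal_power[symmetric], simp, intro power_mono order_trans[OF ennreal_norm_integral_le])
        (auto simp: norm_mult ennreal_mult)
  qed
  also have "\<dots> \<le> ennreal ((kernel_norm k * norm (abs_l2 f))\<^sup>2)"
    by (rule nn_dilation_bound[OF assms])
  finally have *: "(\<integral>\<^sup>+x. ennreal ((cmod (dilation_average k f x))\<^sup>2) \<partial>lborel)
      \<le> ennreal ((kernel_norm k * norm (abs_l2 f))\<^sup>2)" .
  have "0 \<le> kernel_norm k * norm (abs_l2 f)"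
    by (simp add: kernel_norm_nonneg)
  moreover have "dilation_average k f \<in> borel_measurable lborel"
    by measurable
  ultimately
  show "square_integrable (dilation_average k f)"
    "norm (abs_l2 (dilation_average k f)) \<le> kernel_norm k * norm (abs_l2 f)"
    using norm_abs_l2_le[OF _ _ *] by blast+
qed

lemma dilation_average_cong_AE:
  assumes [measurable]: "k \<in> borel_measurable lborel" "f \<in> borel_measurable lborel" "g \<in> borel_measurable lborel"
    and "AE x in lborel. f x = g x" and "x \<noteq> 0"
  shows "dilation_average k f x = dilation_average k g x"
proof -
  have "AE u in lborel. f (0 + x * u) = g (0 + x * u)"
    using assms by (intro AE_borel_affine) auto
  then have "AE u in lborel. k u * f (u * x) = k u * g (u * x)"
    by (auto simp: mult.commute)
  then show ?thesis
    unfolding dilation_average_def by (intro integral_cong_AE) auto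
qed

text \<open>
  Averages do not see null sets except possibly at \<open>x = 0\<close>, so they act on classes of functions.
\<close>

lemma abs_l2_dilation_average_cong:
  assumes k: "admissible k" and fg: "square_integrable f" "square_integrable g" "AE x in lborel. f x = g x"
  shows "abs_l2 (dilation_average k f) = abs_l2 (dilation_average k g)"
proof (intro abs_l2_eqI dilation_average_L2 assms)
  note [measurable] = admissible_measurable[OF k] square_integrable_measurable[OF fg(1)]
    square_integrable_measurable[OF fg(2)]
  show "AE x in lborel. dilation_average k f x = dilation_average k g x"
    using AE_lborel_singleton[of "0::real"]
    by eventually_elim (rule dilation_average_cong_AE; use fg in measurable)
qed

definition kernel_op :: "(real \<Rightarrow> complex) \<Rightarrow> l2 \<Rightarrow>\<^sub>L l2" where
  "kernel_op k = Blinfun (\<lambda>f. abs_l2 (dilation_average k (rep_l2 f)))"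

lemma dilation_average_add:
  assumes "admissible k" "square_integrable f" "square_integrable g"
  shows "AE x in lborel. dilation_average k (\<lambda>x. f x + g x) x = dilation_average k f x + dilation_average k g x"
  using AE_dilation_integrable[OF assms(1,2)] AE_dilation_integrable[OF assms(1,3)]
  by eventually_elim (simp add: dilation_average_def distrib_left)

lemma dilation_average_scale: "dilation_average k (\<lambda>x. c * f x) = (\<lambda>x. c * dilation_average k f x)"
proof
  fix x
  have "k u * (c * f (u * x)) = c * (k u * f (u * x))" for u
    by simp
  then show "dilation_average k (\<lambda>x. c * f x) x = c * dilation_average k f x"
    unfolding dilation_average_def by (simp only: integral_mult_right_zero)
qed

lemma bounded_linear_dilation_average:
  assumes k: "admissible k"
  shows "bounded_linear (\<lambda>f. abs_l2 (dilation_average k (rep_l2 f)))"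
proof (rule bounded_linear_intro)
  fix f g :: l2 and r :: real
  note rep = square_integrable_rep[of f] square_integrable_rep[of g]
  have rep_add: "AE x in lborel. rep_l2 (f + g) x = rep_l2 f x + rep_l2 g x"
    using AE_rep_abs_l2[OF square_integrable_add[OF rep]] by (simp add: abs_l2_add[OF rep, symmetric] abs_rep_l2)
  have "abs_l2 (dilation_average k (rep_l2 (f + g)))
      = abs_l2 (dilation_average k (\<lambda>x. rep_l2 f x + rep_l2 g x))"
    by (intro abs_l2_dilation_average_cong k rep_add square_integrable_rep square_integrable_add)
  also have "\<dots> = abs_l2 (\<lambda>x. dilation_average k (rep_l2 f) x + dilation_average k (rep_l2 g) x)"
    by (intro abs_l2_eqI dilation_average_add dilation_average_L2 square_integrable_add k rep)
  finally show "abs_l2 (dilation_average k (rep_l2 (f + g)))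
      = abs_l2 (dilation_average k (rep_l2 f)) + abs_l2 (dilation_average k (rep_l2 g))"
    by (simp add: abs_l2_add dilation_average_L2 k rep)
  have rep_scale: "AE x in lborel. rep_l2 (r *\<^sub>R f) x = complex_of_real r * rep_l2 f x"
    using AE_rep_abs_l2[OF square_integrable_mult[OF rep(1)]]
    by (simp add: abs_l2_scaleC[OF rep(1), symmetric] abs_rep_l2 scaleR_l2_def)
  have "abs_l2 (dilation_average k (rep_l2 (r *\<^sub>R f)))
      = abs_l2 (dilation_average k (\<lambda>x. complex_of_real r * rep_l2 f x))"
    by (intro abs_l2_dilation_average_cong k rep_scale square_integrable_rep square_integrable_mult)
  then show "abs_l2 (dilation_average k (rep_l2 (r *\<^sub>R f))) = r *\<^sub>R abs_l2 (dilation_average k (rep_l2 f))"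
    by (simp add: dilation_average_scale scaleR_l2_def abs_l2_scaleC dilation_average_L2 k rep)
  show "norm (abs_l2 (dilation_average k (rep_l2 f))) \<le> norm f * kernel_norm k"
    using dilation_average_L2(2)[OF k rep(1)] by (simp add: abs_rep_l2 mult.commute)
qed

lemma kernel_op_apply:
  "admissible k \<Longrightarrow> kernel_op k f = abs_l2 (dilation_average k (rep_l2 f))"
  unfolding kernel_op_def by (subst bounded_linear_Blinfun_apply[OF bounded_linear_dilation_average]) auto

lemma kernel_op_abs_l2:
  assumes "admissible k" "square_integrable f"
  shows "kernel_op k (abs_l2 f) = abs_l2 (dilation_average k f)"
  unfolding kernel_op_apply[OF assms(1)]
  by (rule abs_l2_dilation_average_cong[OF assms(1) square_integrable_rep assms(2) AE_rep_abs_l2[OF assms(2)]])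

lemma norm_kernel_op:
  assumes k: "admissible k"
  shows "norm (kernel_op k) \<le> kernel_norm k"
proof (rule norm_blinfun_bound[OF kernel_norm_nonneg])
  show "norm (kernel_op k f) \<le> kernel_norm k * norm f" for f
    using dilation_average_L2(2)[OF k square_integrable_rep[of f]]
    by (simp add: kernel_op_apply[OF k] abs_rep_l2)
qed

lemma kernel_op_linear:
  assumes k: "admissible k"
  shows "complex_linear (kernel_op k)"
  unfolding complex_linear_def
proof (intro allI)
  fix c f
  have "kernel_op k (c *\<^sub>C abs_l2 (rep_l2 f)) = c *\<^sub>C kernel_op k (abs_l2 (rep_l2 f))"
    by (simp add: abs_l2_scaleC square_integrable_rep kernel_op_abs_l2 k square_integrable_mult
        dilation_average_scale dilation_average_L2)
  then show "kernel_op k (c *\<^sub>C f) = c *\<^sub>C kernel_op k f"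
    by (simp add: abs_rep_l2)
qed

lemma admissible_add:
  assumes j: "admissible j" and k: "admissible k"
  shows "admissible (\<lambda>u. j u + k u)"
proof -
  note [measurable] = admissible_measurable[OF j] admissible_measurable[OF k]
  have "integrable lborel (\<lambda>u. cmod (j u) / sqrt \<bar>u\<bar> + cmod (k u) / sqrt \<bar>u\<bar>)"
    using j k by (auto simp: admissible_def)
  then have "integrable lborel (\<lambda>u. cmod (j u + k u) / sqrt \<bar>u\<bar>)"
    by (rule Bochner_Integration.integrable_bound)
      (auto simp: divide_right_mono norm_triangle_ineq simp flip: add_divide_distrib)
  then show ?thesis
    by (simp add: admissible_def)
qed

lemma admissible_cmult: "admissible k \<Longrightarrow> admissible (\<lambda>u. c * k u)"
  by (auto simp: admissible_def norm_mult simp flip: times_divide_eq_right)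

lemma kernel_op_add:
  assumes j: "admissible j" and k: "admissible k"
  shows "kernel_op (\<lambda>u. j u + k u) = kernel_op j + kernel_op k"
proof (rule blinfun_eqI)
  fix f
  note rep = square_integrable_rep[of f]
  have "AE x in lborel. dilation_average (\<lambda>u. j u + k u) (rep_l2 f) x
      = dilation_average j (rep_l2 f) x + dilation_average k (rep_l2 f) x"
    using AE_dilation_integrable[OF j rep] AE_dilation_integrable[OF k rep]
    by eventually_elim (simp add: dilation_average_def distrib_right)
  then have "abs_l2 (dilation_average (\<lambda>u. j u + k u) (rep_l2 f))
      = abs_l2 (\<lambda>x. dilation_average j (rep_l2 f) x + dilation_average k (rep_l2 f) x)"
    by (intro abs_l2_eqI square_integrable_add dilation_average_L2 admissible_add j k rep)
  then show "kernel_op (\<lambda>u. j u + k u) f = (kernel_op j + kernel_op k) f"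
    by (simp add: kernel_op_apply admissible_add j k blinfun.add_left abs_l2_add dilation_average_L2 rep)
qed

lemma kernel_op_cmult:
  assumes k: "admissible k"
  shows "kernel_op (\<lambda>u. c * k u) f = c *\<^sub>C kernel_op k f"
proof -
  have "dilation_average (\<lambda>u. c * k u) (rep_l2 f) = (\<lambda>x. c * dilation_average k (rep_l2 f) x)"
    unfolding dilation_average_def by (simp only: mult.assoc integral_mult_right_zero)
  then show ?thesis
    by (simp add: kernel_op_apply admissible_cmult k abs_l2_scaleC dilation_average_L2 square_integrable_rep)
qed

lemma integral_scale:
  fixes g :: "real \<Rightarrow> complex"
  assumes "c \<noteq> 0"
  shows "(\<integral>x. g x \<partial>lborel) = complex_of_real \<bar>c\<bar> * (\<integral>x. g (c * x) \<partial>lborel)"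
  by (subst lborel_integral_real_affine[OF assms, of g 0]) (simp add: scaleR_conv_of_real)

text \<open>
  Composition is multiplicative convolution of the kernels: substitute \<open>w = u * v\<close> in the double
  integral and exchange the integrals. The exchange is justified at almost every \<open>x\<close>, because the
  majorant of the inner average is again square-integrable.
\<close>

lemma kernel_op_compose:
  assumes j: "admissible j" and k: "admissible k" and m: "admissible m"
    and conv: "\<And>w. w \<noteq> 0 \<Longrightarrow> m w = (\<integral>u. j u * k (w / u) / complex_of_real \<bar>u\<bar> \<partial>lborel)"
  shows "kernel_op j (kernel_op k f) = kernel_op m f"
proof -
  define h where "h = rep_l2 f"
  have h: "square_integrable h" by (simp add: h_def square_integrable_rep)
  note [measurable] = admissible_measurable[OF j] admissible_measurable[OF k]
    square_integrable_measurable[OF h]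
  have AE0: "AE u in lborel. u \<noteq> (0::real)"
    by (rule AE_lborel_singleton)
  (* the average of |h| against |k|, cut down from infinity on a null set *)
  define H where "H x = complex_of_real (enn2real (\<integral>\<^sup>+u. ennreal (cmod (k u)) * ennreal (cmod (h (u * x))) \<partial>lborel))" for x
  have [measurable]: "H \<in> borel_measurable lborel"
    unfolding H_def[abs_def] by measurable
  have finH: "AE x in lborel. (\<integral>\<^sup>+u. ennreal (cmod (k u)) * ennreal (cmod (h (u * x))) \<partial>lborel) = ennreal (cmod (H x))"
    using AE_nn_dilation_finite[OF k h] by eventually_elim (simp add: H_def)
  have H: "square_integrable H"
  proof (rule norm_abs_l2_le(1))
    have "(\<integral>\<^sup>+x. ennreal ((cmod (H x))\<^sup>2) \<partial>lborel)
       = (\<integral>\<^sup>+x. (\<integral>\<^sup>+u. ennreal (cmod (k u)) * ennreal (cmod (h (u * x))) \<partial>lborel)\<^sup>2 \<partial>lborel)"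
      using finH by (intro nn_integral_cong_AE, eventually_elim) (simp add: ennreal_power)
    then show "(\<integral>\<^sup>+x. ennreal ((cmod (H x))\<^sup>2) \<partial>lborel) \<le> ennreal ((kernel_norm k * norm (abs_l2 h))\<^sup>2)"
      using nn_dilation_bound[OF k h] by simp
  qed (auto simp: kernel_norm_nonneg)
  have "AE x in lborel. dilation_average j (dilation_average k h) x = dilation_average m h x"
    using AE0 AE_nn_dilation_finite[OF j H]
  proof eventually_elim
    case (elim x)
    define F where "F u w = j u * (k (w / u) / complex_of_real \<bar>u\<bar>) * h (w * x)" for u w
    have [measurable]: "case_prod F \<in> borel_measurable (lborel \<Otimes>\<^sub>M lborel)"
      unfolding F_def[abs_def] by measurable
    have inner: "j u * dilation_average k h (u * x) = (\<integral>w. F u w \<partial>lborel)"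
      and nn_inner: "(\<integral>\<^sup>+w. ennreal (cmod (F u w)) \<partial>lborel)
        = ennreal (cmod (j u)) * (\<integral>\<^sup>+v. ennreal (cmod (k v)) * ennreal (cmod (h (v * (u * x)))) \<partial>lborel)"
      if u: "u \<noteq> 0" for u
    proof -
      have "(\<integral>w. F u w \<partial>lborel) = complex_of_real \<bar>u\<bar> * (\<integral>v. F u (u * v) \<partial>lborel)"
        by (rule integral_scale[OF u])
      also have "(\<integral>v. F u (u * v) \<partial>lborel) = (\<integral>v. (j u / complex_of_real \<bar>u\<bar>) * (k v * h (v * (u * x))) \<partial>lborel)"
        using u by (intro Bochner_Integration.integral_cong) (auto simp: F_def mult_ac)
      finally show "j u * dilation_average k h (u * x) = (\<integral>w. F u w \<partial>lborel)"
        using u by (simp add: dilation_average_def)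
      have "(\<integral>\<^sup>+w. ennreal (cmod (F u w)) \<partial>lborel) = ennreal \<bar>u\<bar> * (\<integral>\<^sup>+v. ennreal (cmod (F u (u * v))) \<partial>lborel)"
        by (rule nn_integral_scale[OF _ u]) (unfold F_def, measurable)
      also have "\<dots> = (\<integral>\<^sup>+v. ennreal \<bar>u\<bar> * ennreal (cmod (F u (u * v))) \<partial>lborel)"
        by (rule nn_integral_cmult[symmetric]) (unfold F_def, measurable)
      also have "\<dots> = (\<integral>\<^sup>+v. ennreal (cmod (j u)) * (ennreal (cmod (k v)) * ennreal (cmod (h (v * (u * x))))) \<partial>lborel)"
        using u by (intro nn_integral_cong) (simp add: F_def norm_mult norm_divide mult_ac flip: ennreal_mult)
      also have "\<dots> = ennreal (cmod (j u)) * (\<integral>\<^sup>+v. ennreal (cmod (k v)) * ennreal (cmod (h (v * (u * x)))) \<partial>lborel)"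
        by (rule nn_integral_cmult) measurable
      finally show "(\<integral>\<^sup>+w. ennreal (cmod (F u w)) \<partial>lborel)
        = ennreal (cmod (j u)) * (\<integral>\<^sup>+v. ennreal (cmod (k v)) * ennreal (cmod (h (v * (u * x)))) \<partial>lborel)" .
    qed
    have finHx: "AE u in lborel. (\<integral>\<^sup>+v. ennreal (cmod (k v)) * ennreal (cmod (h (v * (0 + x * u)))) \<partial>lborel)
        = ennreal (cmod (H (0 + x * u)))"
      using finH elim(1) by (intro AE_borel_affine) auto
    have "(\<integral>\<^sup>+u. \<integral>\<^sup>+w. ennreal (cmod (F u w)) \<partial>lborel \<partial>lborel)
        = (\<integral>\<^sup>+u. ennreal (cmod (j u)) * ennreal (cmod (H (u * x))) \<partial>lborel)"
      using AE0 finHx by (intro nn_integral_cong_AE, eventually_elim) (simp add: nn_inner mult.commute)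
    then have "integrable (lborel \<Otimes>\<^sub>M lborel) (case_prod F)"
      using elim(2) by (intro integrableI_bounded) (auto simp: lborel.nn_integral_fst[symmetric] split_beta')
    then have swap: "(\<integral>u. \<integral>w. F u w \<partial>lborel \<partial>lborel) = (\<integral>w. \<integral>u. F u w \<partial>lborel \<partial>lborel)"
      by (rule lborel_pair.Fubini_integral[symmetric])
    have "dilation_average j (dilation_average k h) x = (\<integral>u. \<integral>w. F u w \<partial>lborel \<partial>lborel)"
      unfolding dilation_average_def[of j]
    proof (intro integral_cong_AE)
      show "AE u in lborel. j u * dilation_average k h (u * x) = (\<integral>w. F u w \<partial>lborel)"
        using AE0 by eventually_elim (rule inner)
    qed measurable
    also note swap
    also have "(\<integral>w. \<integral>u. F u w \<partial>lborel \<partial>lborel) = dilation_average m h x"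
      unfolding dilation_average_def
    proof (intro integral_cong_AE)
      show "AE w in lborel. (\<integral>u. F u w \<partial>lborel) = m w * h (w * x)"
        using AE0
      proof eventually_elim
        case (elim w)
        have "(\<integral>u. F u w \<partial>lborel) = (\<integral>u. j u * k (w / u) / complex_of_real \<bar>u\<bar> * h (w * x) \<partial>lborel)"
          by (simp add: F_def)
        then show ?case
          by (simp only: integral_mult_left_zero conv[OF elim])
      qed
    qed (use m in measurable)
    finally show ?case .
  qed
  then have "abs_l2 (dilation_average j (dilation_average k h)) = abs_l2 (dilation_average m h)"
    by (intro abs_l2_eqI dilation_average_L2 j k m h)
  then show ?thesis
    by (simp add: kernel_op_apply[OF k] kernel_op_apply[OF m] kernel_op_abs_l2 j k h dilation_average_L2
        flip: h_def)
qed

text \<open>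
  Substituting \<open>t = u * x\<close>, exchanging the integrals and substituting \<open>x = t * v\<close> inverts the
  dilation variable. Only scalings occur, the inversion \<open>u \<mapsto> 1 / u\<close> itself is never a change of
  variables. The relation between the kernels is asked for almost everywhere only, because the Cesaro
  kernel and its dual violate it at \<open>v = 1\<close>.
\<close>

lemma kernel_op_adjoint:
  assumes k: "admissible k" and k': "admissible k'"
    and dual: "AE v in lborel. k' v = cnj (k (1 / v)) / complex_of_real \<bar>v\<bar>"
  shows "is_adjoint (kernel_op k') (kernel_op k)"
  unfolding is_adjoint_def
proof (intro allI)
  fix a b
  define f g where "f = rep_l2 a" and "g = rep_l2 b"
  have f: "square_integrable f" and g: "square_integrable g"
    by (simp_all add: f_def g_def square_integrable_rep)
  note [measurable] = admissible_measurable[OF k] admissible_measurable[OF k']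
    square_integrable_measurable[OF f] square_integrable_measurable[OF g]
  have AE0: "AE u in lborel. u \<noteq> (0::real)"
    by (rule AE_lborel_singleton)
  define F where "F x t = k (t / x) / complex_of_real \<bar>x\<bar> * f t * cnj (g x)" for x t
  have [measurable]: "case_prod F \<in> borel_measurable (lborel \<Otimes>\<^sub>M lborel)"
    unfolding F_def[abs_def] by measurable
  let ?P = "\<lambda>x. \<integral>\<^sup>+u. ennreal (cmod (k u)) * ennreal (cmod (f (u * x))) \<partial>lborel"
  have inner: "dilation_average k f x * cnj (g x) = (\<integral>t. F x t \<partial>lborel)"
    and nn_inner: "(\<integral>\<^sup>+t. ennreal (cmod (F x t)) \<partial>lborel) = ?P x * ennreal (cmod (g x))"
    if x: "x \<noteq> 0" for x
  proof -
    have "(\<integral>t. F x t \<partial>lborel) = complex_of_real \<bar>x\<bar> * (\<integral>u. F x (x * u) \<partial>lborel)"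
      by (rule integral_scale[OF x])
    also have "(\<integral>u. F x (x * u) \<partial>lborel) = (\<integral>u. (k u * f (u * x)) * (cnj (g x) / complex_of_real \<bar>x\<bar>) \<partial>lborel)"
      using x by (intro Bochner_Integration.integral_cong) (auto simp: F_def mult_ac)
    finally show "dilation_average k f x * cnj (g x) = (\<integral>t. F x t \<partial>lborel)"
      using x by (simp add: dilation_average_def)
    have "(\<integral>\<^sup>+t. ennreal (cmod (F x t)) \<partial>lborel) = ennreal \<bar>x\<bar> * (\<integral>\<^sup>+u. ennreal (cmod (F x (x * u))) \<partial>lborel)"
      by (rule nn_integral_scale[OF _ x]) (unfold F_def, measurable)
    also have "\<dots> = (\<integral>\<^sup>+u. ennreal \<bar>x\<bar> * ennreal (cmod (F x (x * u))) \<partial>lborel)"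
      by (rule nn_integral_cmult[symmetric]) (unfold F_def, measurable)
    also have "\<dots> = (\<integral>\<^sup>+u. (ennreal (cmod (k u)) * ennreal (cmod (f (u * x)))) * ennreal (cmod (g x)) \<partial>lborel)"
      using x by (intro nn_integral_cong) (simp add: F_def norm_mult norm_divide mult_ac flip: ennreal_mult)
    also have "\<dots> = ?P x * ennreal (cmod (g x))"
      by (rule nn_integral_multc) measurable
    finally show "(\<integral>\<^sup>+t. ennreal (cmod (F x t)) \<partial>lborel) = ?P x * ennreal (cmod (g x))" .
  qed
  have "2 * (\<integral>\<^sup>+x. \<integral>\<^sup>+t. ennreal (cmod (F x t)) \<partial>lborel \<partial>lborel) = 2 * (\<integral>\<^sup>+x. ?P x * ennreal (cmod (g x)) \<partial>lborel)"
    using AE0 by (intro arg_cong2[where f = "(*)"] nn_integral_cong_AE refl, eventually_elim) (rule nn_inner)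
  also have "\<dots> = (\<integral>\<^sup>+x. 2 * (?P x * ennreal (cmod (g x))) \<partial>lborel)"
    by (rule nn_integral_cmult[symmetric]) measurable
  also have "\<dots> \<le> (\<integral>\<^sup>+x. (?P x)\<^sup>2 + (ennreal (cmod (g x)))\<^sup>2 \<partial>lborel)"
    by (intro nn_integral_mono ennreal_two_mult_le_squares)
  also have "\<dots> = (\<integral>\<^sup>+x. (?P x)\<^sup>2 \<partial>lborel) + (\<integral>\<^sup>+x. ennreal ((cmod (g x))\<^sup>2) \<partial>lborel)"
    by (subst nn_integral_add) (auto simp: ennreal_power)
  also have "\<dots> < \<infinity>"
    using nn_dilation_bound[OF k f] by (auto simp: nn_integral_norm_abs_l2[OF g] intro: le_less_trans)
  finally have "(\<integral>\<^sup>+x. \<integral>\<^sup>+t. ennreal (cmod (F x t)) \<partial>lborel \<partial>lborel) < \<infinity>"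
    by (auto simp: ennreal_mult_less_top)
  then have "integrable (lborel \<Otimes>\<^sub>M lborel) (case_prod F)"
    by (intro integrableI_bounded) (auto simp: lborel.nn_integral_fst[symmetric] split_beta')
  then have swap: "(\<integral>x. \<integral>t. F x t \<partial>lborel \<partial>lborel) = (\<integral>t. \<integral>x. F x t \<partial>lborel \<partial>lborel)"
    by (rule lborel_pair.Fubini_integral[symmetric])
  have "cinner (kernel_op k a) b = (\<integral>x. dilation_average k f x * cnj (g x) \<partial>lborel)"
    using cinner_abs_l2[OF dilation_average_L2(1)[OF k f] g]
    by (simp add: kernel_op_apply[OF k] f_def g_def abs_rep_l2)
  also have "\<dots> = (\<integral>x. \<integral>t. F x t \<partial>lborel \<partial>lborel)"
  proof (intro integral_cong_AE)
    show "AE x in lborel. dilation_average k f x * cnj (g x) = (\<integral>t. F x t \<partial>lborel)"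
      using AE0 by eventually_elim (rule inner)
  qed measurable
  also note swap
  also have "(\<integral>t. \<integral>x. F x t \<partial>lborel \<partial>lborel) = (\<integral>t. f t * cnj (dilation_average k' g t) \<partial>lborel)"
  proof (intro integral_cong_AE)
    show "AE t in lborel. (\<integral>x. F x t \<partial>lborel) = f t * cnj (dilation_average k' g t)"
      using AE0
    proof eventually_elim
      case (elim t)
      have "(\<integral>x. F x t \<partial>lborel) = complex_of_real \<bar>t\<bar> * (\<integral>v. F (t * v) t \<partial>lborel)"
        by (rule integral_scale[OF elim])
      also have "(\<integral>v. F (t * v) t \<partial>lborel) = (\<integral>v. (f t / complex_of_real \<bar>t\<bar>) * cnj (k' v * g (v * t)) \<partial>lborel)"
      proof (intro integral_cong_AE)
        show "AE v in lborel. F (t * v) t = (f t / complex_of_real \<bar>t\<bar>) * cnj (k' v * g (v * t))"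
          using AE0 dual by eventually_elim (use elim in \<open>simp add: F_def abs_mult mult_ac\<close>)
      qed (unfold F_def, measurable)
      also have "\<dots> = (f t / complex_of_real \<bar>t\<bar>) * cnj (dilation_average k' g t)"
        by (simp add: dilation_average_def flip: Bochner_Integration.integral_cnj del: complex_cnj_mult)
      finally show ?case
        using elim by simp
    qed
  qed measurable
  also have "\<dots> = cinner a (kernel_op k' b)"
    using cinner_abs_l2[OF f dilation_average_L2(1)[OF k' g]]
    by (simp add: kernel_op_apply[OF k'] f_def g_def abs_rep_l2)
  finally show "cinner (kernel_op k a) b = cinner a (kernel_op k' b)" .
qed

section \<open>The Cesaro operator as a dilation average\<close>

text \<open>
  Integrals computed by the fundamental theorem of calculus come as gauge integrals, while averages
  are Lebesgue integrals over the Borel measure.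
\<close>

lemma lborel_integral_HK:
  fixes f :: "real \<Rightarrow> 'b :: euclidean_space"
  assumes meas: "(\<lambda>x. indicator S x *\<^sub>R f x) \<in> borel_measurable lborel" and f: "f absolutely_integrable_on S"
  shows "integrable lborel (\<lambda>x. indicator S x *\<^sub>R f x)"
    and "(\<integral>x. indicator S x *\<^sub>R f x \<partial>lborel) = integral S f"
  using f set_lebesgue_integral_eq_integral(2)[OF f] meas
  by (simp_all add: set_integrable_def set_lebesgue_integral_def integrable_completion integral_completion)

lemma has_integral_lborel:
  fixes f :: "real \<Rightarrow> real"
  assumes "(\<lambda>x. indicator S x *\<^sub>R f x) \<in> borel_measurable lborel" "(f has_integral I) S"
    and "\<And>x. x \<in> S \<Longrightarrow> 0 \<le> f x"
  shows "integrable lborel (\<lambda>x. indicator S x *\<^sub>R f x)" "(\<integral>x. indicator S x *\<^sub>R f x \<partial>lborel) = I"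
proof -
  have "f absolutely_integrable_on S"
    using assms by (intro nonnegative_absolutely_integrable_1) (auto simp: has_integral_integrable)
  from lborel_integral_HK[OF assms(1) this]
  show "integrable lborel (\<lambda>x. indicator S x *\<^sub>R f x)" "(\<integral>x. indicator S x *\<^sub>R f x \<partial>lborel) = I"
    using assms(2) by (simp_all add: integral_unique)
qed

definition on_unit :: "(real \<Rightarrow> complex) \<Rightarrow> real \<Rightarrow> complex" where
  "on_unit \<phi> u = (if 0 < u \<and> u < 1 then \<phi> u else 0)"

lemma on_unit_eq_indicator: "on_unit \<phi> u = indicator {0<..<1} u *\<^sub>R \<phi> u"
  by (simp add: on_unit_def indicator_def)

lemma on_unit_measurable [measurable]:
  assumes [measurable]: "\<phi> \<in> borel_measurable lborel"
  shows "on_unit \<phi> \<in> borel_measurable lborel"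
  unfolding on_unit_def[abs_def] by measurable

lemma unit_powr_real:
  assumes "a > -1"
  shows "integrable lborel (\<lambda>u. indicator {0<..<1} u *\<^sub>R u powr a :: real)"
    and "(\<integral>u. indicator {0<..<1} u *\<^sub>R u powr a \<partial>lborel) = 1 / (a + 1)"
proof -
  have "((\<lambda>x. x powr a) has_integral (1 / (a + 1))) {0<..<1}"
    using has_integral_powr_from_0[of a 1] assms by (simp add: has_integral_Icc_iff_Ioo)
  from has_integral_lborel[OF _ this]
  show "integrable lborel (\<lambda>u. indicator {0<..<1} u *\<^sub>R u powr a :: real)"
    and "(\<integral>u. indicator {0<..<1} u *\<^sub>R u powr a \<partial>lborel) = 1 / (a + 1)"
    by simp_all
qed

lemma powr_complex_measurable [measurable]:
  "(\<lambda>u. complex_of_real u powr s) \<in> borel_measurable lborel"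
proof -
  have "(\<lambda>u. complex_of_real u powr s) = (\<lambda>u. if u = 0 then 0 else
      exp (s * (complex_of_real (ln \<bar>u\<bar>) + (if u < 0 then complex_of_real pi * \<i> else 0))))"
    by (intro ext) (simp add: powr_def Ln_of_real')
  also have "\<dots> \<in> borel_measurable lborel"
    by measurable
  finally show ?thesis .
qed

lemma unit_powr_integrable:
  assumes "Re s > -1"
  shows "integrable lborel (on_unit (\<lambda>u. complex_of_real u powr s))"
  by (rule Bochner_Integration.integrable_bound[OF unit_powr_real(1)[OF assms]])
    (auto simp: on_unit_def indicator_def norm_powr_real_powr)

lemma unit_powr_integral:
  assumes s: "Re s > -1"
  shows "(\<integral>u. on_unit (\<lambda>u. complex_of_real u powr s) u \<partial>lborel) = 1 / (s + 1)"
proof -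
  have s1: "s + 1 \<noteq> 0" using s by (auto simp: complex_eq_iff)
  let ?F = "\<lambda>u. complex_of_real u powr (s + 1) / (s + 1)"
  have "((\<lambda>u. complex_of_real u powr s) has_integral (?F 1 - ?F 0)) {0..1}"
  proof (rule fundamental_theorem_of_calculus_interior)
    show "continuous_on {0..1} ?F"
      using s s1 by (intro continuous_intros) auto
    show "(?F has_vector_derivative complex_of_real x powr s) (at x)" if "x \<in> {0<..<1}" for x
      using that s1
      by (auto intro!: derivative_eq_intros has_vector_derivative_real_field simp: powr_diff)
  qed simp
  then have "integral {0<..<1} (\<lambda>u. complex_of_real u powr s) = 1 / (s + 1)"
    by (simp add: has_integral_Icc_iff_Ioo integral_unique)
  moreover have "(\<lambda>u. complex_of_real u powr s) absolutely_integrable_on {0<..<1}"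
    using unit_powr_integrable[OF s]
    by (simp add: set_integrable_def integrable_completion on_unit_eq_indicator[abs_def])
  ultimately show ?thesis
    using lborel_integral_HK(2)[of "{0<..<1}" "\<lambda>u. complex_of_real u powr s"]
    by (simp add: on_unit_eq_indicator)
qed

lemma admissible_on_unit:
  assumes [measurable]: "\<phi> \<in> borel_measurable lborel"
    and bound: "\<And>u. 0 < u \<Longrightarrow> u < 1 \<Longrightarrow> cmod (\<phi> u) \<le> B"
  shows "admissible (on_unit \<phi>)"
  unfolding admissible_def
proof
  have "integrable lborel (\<lambda>u. B * (indicator {0<..<1} u *\<^sub>R u powr (-1/2)))"
    by (intro integrable_mult_right unit_powr_real) simp
  then show "integrable lborel (\<lambda>u. cmod (on_unit \<phi> u) / sqrt \<bar>u\<bar>)"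
  proof (rule Bochner_Integration.integrable_bound)
    have "cmod (on_unit \<phi> u) / sqrt \<bar>u\<bar> \<le> \<bar>B\<bar> * (indicator {0<..<1} u * u powr (-1/2))" for u
      using bound[of u] by (auto simp: on_unit_def indicator_def powr_half_sqrt powr_minus field_simps
          intro!: divide_right_mono)
    then show "AE u in lborel. norm (cmod (on_unit \<phi> u) / sqrt \<bar>u\<bar>)
        \<le> norm (B * (indicator {0<..<1} u *\<^sub>R u powr (-1/2)))"
      by (simp add: abs_mult)
  qed measurable
qed measurable

definition unit_power :: "nat \<Rightarrow> real \<Rightarrow> complex" where
  "unit_power n = on_unit (\<lambda>u. complex_of_real u ^ n)"

lemma admissible_unit_power: "admissible (unit_power n)"
  unfolding unit_power_def
  by (rule admissible_on_unit[where B = 1]) (auto simp: norm_power power_le_one)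

text \<open>
  The kernel of the adjoint of the Cesaro operator, \<open>x \<mapsto> \<integral> f t / t dt\<close> over \<open>t\<close> beyond \<open>x\<close>. Including
  the endpoint \<open>u = 1\<close> makes the convolution identities below hold at every nonzero point.
\<close>

definition dual_kernel :: "real \<Rightarrow> complex" where
  "dual_kernel u = (if 1 \<le> u then 1 / complex_of_real u else 0)"

lemma tail_powr:
  assumes "e < -1" "a > 0"
  shows "integrable lborel (\<lambda>u. indicator {a..} u *\<^sub>R u powr e :: real)"
    and "(\<integral>u. indicator {a..} u *\<^sub>R u powr e \<partial>lborel) = - (a powr (e + 1)) / (e + 1)"
  using has_integral_lborel[OF _ has_integral_powr_to_inf[OF assms]] by simp_all

lemma admissible_dual_kernel: "admissible dual_kernel"
  unfolding admissible_def
proof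
  show "dual_kernel \<in> borel_measurable lborel"
    unfolding dual_kernel_def[abs_def] by measurable
  have "cmod (dual_kernel u) / sqrt \<bar>u\<bar> = indicator {1..} u *\<^sub>R u powr (-3/2)" for u
  proof (cases "1 \<le> u")
    case True
    have "u powr (-3/2) = u powr (-1) * u powr (-1/2)"
      by (subst powr_add[symmetric]) simp
    with True show ?thesis
      by (simp add: dual_kernel_def norm_divide powr_minus powr_half_sqrt field_simps)
  qed (simp add: dual_kernel_def)
  then show "integrable lborel (\<lambda>u. cmod (dual_kernel u) / sqrt \<bar>u\<bar>)"
    using tail_powr(1)[of "-3/2" 1] by simp
qed

lemma unit_power_0: "unit_power 0 u = (if 0 < u \<and> u < 1 then 1 else 0)"
  by (simp add: unit_power_def on_unit_def)

lemma AE_neq: "AE u in lborel. u \<noteq> (c::real)"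
  by (rule AE_lborel_singleton)

text \<open>
  Both convolutions of the Cesaro kernel with its dual equal \<open>1 / max 1 w\<close> for positive \<open>w\<close>, the sum
  of the two kernels.
\<close>

lemma conv_unit_dual:
  assumes w: "w \<noteq> 0"
  shows "unit_power 0 w + dual_kernel w
    = (\<integral>u. unit_power 0 u * dual_kernel (w / u) / complex_of_real \<bar>u\<bar> \<partial>lborel)"
proof (cases "w > 0")
  case False
  then have zero: "unit_power 0 u * dual_kernel (w / u) / complex_of_real \<bar>u\<bar> = 0" for u
    using w by (auto simp: unit_power_0 dual_kernel_def field_simps)
  show ?thesis
    unfolding zero using False by (simp add: unit_power_0 dual_kernel_def)
next
  case True
  have "(\<integral>u. unit_power 0 u * dual_kernel (w / u) / complex_of_real \<bar>u\<bar> \<partial>lborel)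
      = (\<integral>u. indicator {0<..<min 1 w} u *\<^sub>R (1 / complex_of_real w) \<partial>lborel)"
    using AE_neq[of w]
  proof (intro integral_cong_AE, goal_cases)
    case 3
    then show ?case
      by eventually_elim (use True in \<open>auto simp: unit_power_0 dual_kernel_def indicator_def field_simps\<close>)
  qed (use admissible_measurable[OF admissible_dual_kernel] admissible_measurable[OF admissible_unit_power] in measurable)
  also have "\<dots> = min 1 w *\<^sub>R (1 / complex_of_real w)"
    using True by simp
  finally show ?thesis
    using True by (auto simp: unit_power_0 dual_kernel_def min_def scaleR_conv_of_real)
qed

lemma conv_dual_unit:
  assumes w: "w \<noteq> 0"
  shows "unit_power 0 w + dual_kernel w
    = (\<integral>u. dual_kernel u * unit_power 0 (w / u) / complex_of_real \<bar>u\<bar> \<partial>lborel)"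
proof (cases "w > 0")
  case False
  then have zero: "dual_kernel u * unit_power 0 (w / u) / complex_of_real \<bar>u\<bar> = 0" for u
    using w by (auto simp: unit_power_0 dual_kernel_def field_simps)
  show ?thesis
    unfolding zero using False by (simp add: unit_power_0 dual_kernel_def)
next
  case True
  have "(\<integral>u. dual_kernel u * unit_power 0 (w / u) / complex_of_real \<bar>u\<bar> \<partial>lborel)
      = (\<integral>u. complex_of_real (indicator {max 1 w..} u *\<^sub>R u powr (-2)) \<partial>lborel)"
    using AE_neq[of w]
  proof (intro integral_cong_AE, goal_cases)
    case 3
    then show ?case
    proof eventually_elim
      case (elim u)
      show ?case
      proof (cases "u \<ge> 1")
        case True
        then have "complex_of_real (u powr (-2)) = 1 / (complex_of_real u * complex_of_real u)"
          by (simp add: powr_minus powr_numeral power2_eq_square inverse_eq_divide)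
        with True elim \<open>w > 0\<close> show ?thesis
          by (auto simp: unit_power_0 dual_kernel_def indicator_def field_simps)
      qed (simp add: dual_kernel_def)
    qed
  qed (use admissible_measurable[OF admissible_dual_kernel] admissible_measurable[OF admissible_unit_power] in measurable)
  also have "\<dots> = complex_of_real (- (max 1 w powr (-2 + 1)) / (-2 + 1))"
    by (subst integral_complex_of_real, subst tail_powr(2)) auto
  also have "\<dots> = complex_of_real (1 / max 1 w)"
    by (simp add: powr_minus inverse_eq_divide)
  finally show ?thesis
    using True by (auto simp: unit_power_0 dual_kernel_def max_def)
qed

text \<open>
  On \<open>0 < w < 1\<close> the convolution is \<open>w\<^sup>n * \<integral> u\<^bsup>- n - 1\<^esup> du\<close> over \<open>w < u < 1\<close>, that is \<open>(1 - w\<^sup>n) / n\<close>.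
\<close>

lemma conv_unit_power:
  assumes w: "w \<noteq> 0" and n: "n \<ge> 1"
  shows "1 / of_nat n * unit_power 0 w + (- 1 / of_nat n) * unit_power n w
    = (\<integral>u. unit_power 0 u * unit_power n (w / u) / complex_of_real \<bar>u\<bar> \<partial>lborel)"
proof (cases "0 < w \<and> w < 1")
  case False
  then have zero: "unit_power 0 u * unit_power n (w / u) / complex_of_real \<bar>u\<bar> = 0" for u
    using w by (auto simp: unit_power_def on_unit_def field_simps)
  show ?thesis
    unfolding zero using False by (auto simp: unit_power_def on_unit_def)
next
  case True
  let ?f = "\<lambda>u. w ^ n / u ^ Suc n" and ?F = "\<lambda>u. - (w ^ n / (real n * u ^ n))"
  have "(\<integral>u. unit_power 0 u * unit_power n (w / u) / complex_of_real \<bar>u\<bar> \<partial>lborel)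
      = (\<integral>u. complex_of_real (indicator {w..1} u *\<^sub>R ?f u) \<partial>lborel)"
    using AE_neq[of w] AE_neq[of 1]
  proof (intro integral_cong_AE, goal_cases)
    case 3
    then show ?case
      by eventually_elim
        (use True in \<open>auto simp: unit_power_def on_unit_def indicator_def field_simps power_divide\<close>)
  qed (use admissible_measurable[OF admissible_unit_power] in measurable)
  also have "\<dots> = complex_of_real (?F 1 - ?F w)"
  proof -
    have "(\<integral>u. indicator {w..1} u *\<^sub>R ?f u \<partial>lborel) = ?F 1 - ?F w"
    proof (rule integral_FTC_atLeastAtMost)
      show "(?F has_vector_derivative ?f x) (at x within {w..1})" if "w \<le> x" "x \<le> 1" for x
      proof -
        obtain m where m: "n = Suc m" using n by (cases n) auto
        have x: "x > 0" using that True by linarith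
        have "(?F has_real_derivative (w ^ n * (real n * (real n * x ^ (n - Suc 0))) / (real n * x ^ n)\<^sup>2)) (at x within {w..1})"
          using x n by (auto intro!: derivative_eq_intros simp: power2_eq_square)
        also have "w ^ n * (real n * (real n * x ^ (n - Suc 0))) / (real n * x ^ n)\<^sup>2 = ?f x"
          using x by (simp add: m power2_eq_square)
        finally show ?thesis
          by (simp add: has_real_derivative_iff_has_vector_derivative)
      qed
      show "continuous_on {w..1} ?f"
        using True by (intro continuous_intros) auto
    qed (use True in simp)
    then show ?thesis
      by (simp only: integral_complex_of_real)
  qed
  finally show ?thesis
    using True n by (simp add: unit_power_def on_unit_def field_simps)
qed

subsection \<open>Algebraic relations\<close>

text \<open>
  The substitution \<open>t = x * u\<close>. For negative \<open>x\<close> the sign of the oriented integral cancels against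
  \<open>\<bar>x\<bar> / x\<close>; at \<open>x = 0\<close> the two sides may differ.
\<close>

lemma cesaro_eq_kernel_op: "cesaro = kernel_op (unit_power 0)"
proof -
  have "abs_l2 (\<lambda>x. (1 / complex_of_real x) * (LBINT t=0..ereal x. f t))
      = abs_l2 (dilation_average (unit_power 0) f)" if f: "square_integrable f" for f
  proof -
    note [measurable] = square_integrable_measurable[OF f]
      admissible_measurable[OF admissible_unit_power]
    have eq: "(1 / complex_of_real x) * (LBINT t=0..ereal x. f t) = dilation_average (unit_power 0) f x"
      if x: "x \<noteq> 0" for x
    proof (cases "x > 0")
      case True
      have "(LBINT t=0..ereal x. f t) = (\<integral>t. indicator {0<..<x} t *\<^sub>R f t \<partial>lborel)"
        using True by (simp add: interval_lebesgue_integral_def set_lebesgue_integral_def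
            einterval_eq zero_ereal_def)
      also have "\<dots> = complex_of_real \<bar>x\<bar> * (\<integral>u. indicator {0<..<x} (x * u) *\<^sub>R f (x * u) \<partial>lborel)"
        by (rule integral_scale[OF x])
      also have "(\<integral>u. indicator {0<..<x} (x * u) *\<^sub>R f (x * u) \<partial>lborel) = dilation_average (unit_power 0) f x"
        unfolding dilation_average_def using True
        by (intro Bochner_Integration.integral_cong)
          (auto simp: unit_power_0 indicator_def mult.commute zero_less_mult_iff)
      finally show ?thesis using True by simp
    next
      case False
      with x have xneg: "x < 0" by simp
      have "(LBINT t=0..ereal x. f t) = - (\<integral>t. indicator {x<..<0} t *\<^sub>R f t \<partial>lborel)"
        using xneg by (simp add: interval_lebesgue_integral_def set_lebesgue_integral_def
            einterval_eq zero_ereal_def)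
      also have "(\<integral>t. indicator {x<..<0} t *\<^sub>R f t \<partial>lborel)
          = complex_of_real \<bar>x\<bar> * (\<integral>u. indicator {x<..<0} (x * u) *\<^sub>R f (x * u) \<partial>lborel)"
        by (rule integral_scale[OF x])
      also have "(\<integral>u. indicator {x<..<0} (x * u) *\<^sub>R f (x * u) \<partial>lborel) = dilation_average (unit_power 0) f x"
        unfolding dilation_average_def using xneg
        by (intro Bochner_Integration.integral_cong)
          (auto simp: unit_power_0 indicator_def mult.commute mult_less_0_iff)
      finally show ?thesis using xneg by simp
    qed
    have "(\<lambda>x. (1 / complex_of_real x) * (LBINT t=0..ereal x. f t))
        = (\<lambda>x. if x = 0 then 0 else dilation_average (unit_power 0) f x)"
      using eq by auto
    then have [measurable]: "(\<lambda>x. (1 / complex_of_real x) * (LBINT t=0..ereal x. f t)) \<in> borel_measurable lborel"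
      by simp
    have AE: "AE x in lborel. dilation_average (unit_power 0) f x
        = (1 / complex_of_real x) * (LBINT t=0..ereal x. f t)"
      using AE_neq[of 0] by eventually_elim (rule eq[symmetric])
    note dil = dilation_average_L2(1)[OF admissible_unit_power f, of 0]
    show ?thesis
      by (rule abs_l2_eqI[symmetric, OF dil square_integrable_cong_AE[OF dil _ AE] AE]) measurable
  qed
  then show ?thesis
    unfolding cesaro_def kernel_op_def by (simp add: square_integrable_rep)
qed

definition cesaro_adj :: "l2 \<Rightarrow>\<^sub>L l2" where
  "cesaro_adj = kernel_op dual_kernel"

lemma cesaro_adjoint: "is_adjoint cesaro_adj cesaro"
  unfolding cesaro_eq_kernel_op cesaro_adj_def
proof (rule kernel_op_adjoint[OF admissible_unit_power admissible_dual_kernel])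
  show "AE v in lborel. dual_kernel v = cnj (unit_power 0 (1 / v)) / complex_of_real \<bar>v\<bar>"
    using AE_neq[of 1] by eventually_elim (auto simp: dual_kernel_def unit_power_0 field_simps)
qed

lemma cesaro_mult_adj: "cesaro (cesaro_adj f) = cesaro f + cesaro_adj f"
  using kernel_op_compose[OF admissible_unit_power admissible_dual_kernel
      admissible_add[OF admissible_unit_power admissible_dual_kernel] conv_unit_dual]
  by (simp add: cesaro_eq_kernel_op cesaro_adj_def kernel_op_add admissible_unit_power
      admissible_dual_kernel blinfun.add_left)

lemma adj_mult_cesaro: "cesaro_adj (cesaro f) = cesaro f + cesaro_adj f"
  using kernel_op_compose[OF admissible_dual_kernel admissible_unit_power
      admissible_add[OF admissible_unit_power admissible_dual_kernel] conv_dual_unit]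
  by (simp add: cesaro_eq_kernel_op cesaro_adj_def kernel_op_add admissible_unit_power
      admissible_dual_kernel blinfun.add_left)

text \<open>
  A resolvent identity: it exhibits averaging against \<open>u\<^sup>n\<close> as \<open>C (1 + n C)\<^bsup>-1\<^esup>\<close>.
\<close>

lemma cesaro_unit_power:
  "kernel_op (unit_power n) f + of_nat n *\<^sub>C cesaro (kernel_op (unit_power n) f) = cesaro f"
proof (cases "n = 0")
  case True
  then show ?thesis by (simp add: cesaro_eq_kernel_op scaleC_zero_left)
next
  case False
  then have n: "n \<ge> 1" by simp
  let ?j = "\<lambda>u. 1 / of_nat n * unit_power 0 u" and ?k = "\<lambda>u. (- 1 / of_nat n) * unit_power n u"
  have adm: "admissible ?j" "admissible ?k"
    by (intro admissible_cmult admissible_unit_power)+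
  have "cesaro (kernel_op (unit_power n) f) = kernel_op (\<lambda>u. ?j u + ?k u) f"
    unfolding cesaro_eq_kernel_op
    by (intro kernel_op_compose admissible_add adm admissible_unit_power conv_unit_power n)
  also have "\<dots> = (1 / of_nat n) *\<^sub>C cesaro f + (- 1 / of_nat n) *\<^sub>C kernel_op (unit_power n) f"
    by (simp only: kernel_op_add[OF adm] blinfun.add_left kernel_op_cmult[OF admissible_unit_power]
        cesaro_eq_kernel_op)
  finally show ?thesis
    using False by (simp add: scaleC_diff_right scaleC_scaleC scaleC_minus_left scaleC_one)
qed

subsection \<open>Approximate eigenvectors\<close>

text \<open>
  The power \<open>x\<^sup>s\<close> cut off to \<open>(0,1)\<close> is an eigenvector on \<open>(0,1)\<close>, and the defect
  \<open>1 / ((s + 1) x)\<close>, which lives on \<open>x > 1\<close>, stays bounded in norm while the norm of the power blows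
  up as \<open>Re s\<close> decreases to \<open>-1/2\<close>.
\<close>

lemma cesaro_powr_eigenvector:
  assumes s: "Re s > -1 / 2"
  shows "\<exists>f. norm f = 1 \<and> norm (cesaro f - (1 / (s + 1)) *\<^sub>C f) \<le> cmod (1 / (s + 1)) * sqrt (2 * Re s + 1)"
proof -
  define h where "h = on_unit (\<lambda>u. complex_of_real u powr s)"
  define \<mu> where "\<mu> = 1 / (s + 1)"
  define r where "r x = \<mu> * dual_kernel x" for x
  have [measurable]: "h \<in> borel_measurable lborel"
    unfolding h_def by measurable
  have sq_h: "(cmod (h u))\<^sup>2 = indicator {0<..<1} u *\<^sub>R u powr (2 * Re s)" for u
    by (auto simp: h_def on_unit_def norm_powr_real_powr power2_eq_square powr_add[symmetric])
  have h: "square_integrable h"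
    unfolding square_integrable_def sq_h using s by (intro conjI unit_powr_real) auto
  have norm_h: "(norm (abs_l2 h))\<^sup>2 = 1 / (2 * Re s + 1)"
    unfolding norm_abs_l2[OF h] sq_h using s by (intro unit_powr_real) auto
  have dil: "dilation_average (unit_power 0) h x = \<mu> * h x + r x" if x1: "x \<noteq> 1" for x
  proof -
    have int: "(\<integral>u. on_unit (\<lambda>u. complex_of_real u powr s) u \<partial>lborel) = \<mu>"
      unfolding \<mu>_def using s by (intro unit_powr_integral) auto
    consider "x \<le> 0" | "0 < x" "x < 1" | "x > 1"
      using x1 by linarith
    then show ?thesis
    proof cases
      case 1
      then have "unit_power 0 u * h (u * x) = 0" for u
        by (auto simp: unit_power_0 h_def on_unit_def zero_less_mult_iff)
      then have "dilation_average (unit_power 0) h x = 0"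
        by (simp only: dilation_average_def) simp
      with 1 show ?thesis
        by (simp add: h_def on_unit_def r_def dual_kernel_def)
    next
      case 2
      have "unit_power 0 u * h (u * x) = complex_of_real x powr s * on_unit (\<lambda>u. complex_of_real u powr s) u" for u
      proof (cases "0 < u \<and> u < 1")
        case True
        then have "0 < u * x" "u * x < 1"
          using 2 mult_strict_mono'[of u 1 x 1] by auto
        with True 2 show ?thesis
          by (simp add: unit_power_0 h_def on_unit_def powr_times_real mult.commute)
      qed (auto simp: unit_power_0 on_unit_def)
      then have "dilation_average (unit_power 0) h x = complex_of_real x powr s * \<mu>"
        by (simp only: dilation_average_def integral_mult_right_zero int)
      with 2 show ?thesis
        by (simp add: h_def on_unit_def r_def dual_kernel_def)
    next
      case 3
      have "\<mu> = complex_of_real \<bar>x\<bar> * (\<integral>u. h (x * u) \<partial>lborel)"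
        unfolding int[symmetric] h_def using 3 by (intro integral_scale) auto
      also have "(\<integral>u. h (x * u) \<partial>lborel) = dilation_average (unit_power 0) h x"
        unfolding dilation_average_def
      proof (intro Bochner_Integration.integral_cong refl)
        fix u
        have "0 < u \<and> u < 1" if "0 < x * u" "x * u < 1"
          using that 3 by (smt (verit) mult_less_cancel_right1 zero_less_mult_iff mult_le_cancel_right1)
        then show "h (x * u) = unit_power 0 u * h (u * x)"
          by (auto simp: h_def on_unit_def unit_power_0 mult.commute)
      qed
      finally show ?thesis
        using 3 by (simp add: h_def on_unit_def r_def dual_kernel_def field_simps)
    qed
  qed
  note [measurable] = admissible_measurable[OF admissible_dual_kernel]
  have sq_d: "(cmod (dual_kernel u))\<^sup>2 = indicator {1..} u *\<^sub>R u powr (-2)" for u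
    by (auto simp: dual_kernel_def norm_divide powr_minus powr_numeral power_divide inverse_eq_divide indicator_def)
  have d: "square_integrable dual_kernel"
    unfolding square_integrable_def sq_d by (intro conjI tail_powr) auto
  have norm_d: "(norm (abs_l2 dual_kernel))\<^sup>2 = 1"
    unfolding norm_abs_l2[OF d] sq_d by (subst tail_powr) auto
  then have norm_d: "norm (abs_l2 dual_kernel) = 1"
    by (simp add: power2_eq_1_iff) (smt (verit) norm_ge_zero)
  have r: "square_integrable r"
    unfolding r_def[abs_def] by (intro square_integrable_mult d)
  have "abs_l2 (dilation_average (unit_power 0) h) = abs_l2 (\<lambda>x. \<mu> * h x + r x)"
    using AE_neq[of 1]
    by (intro abs_l2_eqI dilation_average_L2 square_integrable_add square_integrable_mult h r
        admissible_unit_power, eventually_elim) (rule dil)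
  then have "cesaro (abs_l2 h) - \<mu> *\<^sub>C abs_l2 h = abs_l2 r"
    by (simp add: cesaro_eq_kernel_op kernel_op_abs_l2 admissible_unit_power h r
        square_integrable_mult abs_l2_scaleC flip: abs_l2_add)
  also have "abs_l2 r = \<mu> *\<^sub>C abs_l2 dual_kernel"
    by (simp add: r_def[abs_def] abs_l2_scaleC d)
  finally have eq: "cesaro (abs_l2 h) - \<mu> *\<^sub>C abs_l2 h = \<mu> *\<^sub>C abs_l2 dual_kernel" .
  define c where "c = sqrt (2 * Re s + 1)"
  have c: "c > 0" using s by (simp add: c_def)
  have "norm (abs_l2 h) = 1 / c"
    using norm_h s by (metis c_def norm_ge_zero real_sqrt_abs abs_of_nonneg real_sqrt_divide real_sqrt_one)
  then have 1: "norm (c *\<^sub>R abs_l2 h) = 1"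
    using c by simp
  have "cesaro (c *\<^sub>R abs_l2 h) - \<mu> *\<^sub>C (c *\<^sub>R abs_l2 h) = c *\<^sub>R (cesaro (abs_l2 h) - \<mu> *\<^sub>C abs_l2 h)"
  proof -
    have "\<mu> *\<^sub>C (c *\<^sub>R abs_l2 h) = c *\<^sub>R (\<mu> *\<^sub>C abs_l2 h)"
      by (simp add: scaleR_l2_def scaleC_scaleC mult.commute)
    then show ?thesis
      by (simp only: blinfun.scaleR_right scaleR_diff_right)
  qed
  then have "norm (cesaro (c *\<^sub>R abs_l2 h) - \<mu> *\<^sub>C (c *\<^sub>R abs_l2 h)) = c * cmod \<mu>"
    using c by (simp add: eq norm_scaleC norm_d)
  with 1 show ?thesis
    unfolding \<mu>_def[symmetric] c_def[symmetric] by (intro exI[of _ "c *\<^sub>R abs_l2 h"]) (simp add: mult.commute)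
qed

text \<open>
  For \<open>z \<noteq> 0\<close> take \<open>s = 1/z - 1 + e\<close> with small \<open>e\<close>; as \<open>Re (1/z) = 1/2\<close> on the circle, this has
  \<open>Re s = -1/2 + e\<close>. For \<open>z = 0\<close> the approximate eigenvalue \<open>1 / (s + 1)\<close> is small when \<open>s\<close> is a large
  imaginary number.
\<close>

lemma cesaro_approx_eigenvector:
  assumes z: "cmod (z - 1) = 1" and d: "d > 0"
  shows "\<exists>f. norm f = 1 \<and> norm (cesaro f - z *\<^sub>C f) \<le> d"
proof -
  have *: "\<exists>f. norm f = 1 \<and> norm (cesaro f - z *\<^sub>C f) \<le> d"
    if s: "Re s > -1/2" "cmod (1 / (s + 1)) * sqrt (2 * Re s + 1) + cmod (1 / (s + 1) - z) \<le> d" for s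
  proof -
    obtain f where f: "norm f = 1"
      "norm (cesaro f - (1 / (s + 1)) *\<^sub>C f) \<le> cmod (1 / (s + 1)) * sqrt (2 * Re s + 1)"
      using cesaro_powr_eigenvector[OF s(1)] by blast
    have "cesaro f - z *\<^sub>C f = (cesaro f - (1 / (s + 1)) *\<^sub>C f) + (1 / (s + 1) - z) *\<^sub>C f"
      by (simp add: scaleC_diff_left)
    then have "norm (cesaro f - z *\<^sub>C f) \<le> norm (cesaro f - (1 / (s + 1)) *\<^sub>C f) + norm ((1 / (s + 1) - z) *\<^sub>C f)"
      by (metis norm_triangle_ineq)
    with f s(2) show ?thesis
      by (intro exI[of _ f]) (simp add: norm_scaleC)
  qed
  show ?thesis
  proof (cases "z = 0")
    case True
    define s where "s = \<i> * complex_of_real (2 / d)"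
    have "2 / d = \<bar>Im (s + 1)\<bar>" using d by (simp add: s_def)
    also have "\<dots> \<le> cmod (s + 1)" by (rule abs_Im_le_cmod)
    finally have "1 / cmod (s + 1) \<le> 1 / (2 / d)"
      using d by (intro frac_le) auto
    then have "cmod (1 / (s + 1)) \<le> d / 2"
      by (simp add: norm_divide)
    with True show ?thesis
      by (intro *[of s]) (auto simp: s_def)
  next
    case False
    (* with e = t^2 / 2 the two error terms are each at most 2 t *)
    define t where "t = min 1 (d / 4)"
    define e where "e = t\<^sup>2 / 2"
    define s where "s = 1 / z - 1 + complex_of_real e"
    have t: "0 < t" "t \<le> 1" "4 * t \<le> d" using d by (auto simp: t_def)
    have "(cmod (z - 1))\<^sup>2 = 1"
      using z by simp
    then have "(cmod z)\<^sup>2 = 2 * Re z"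
      by (simp only: cmod_power2) (simp add: power2_eq_square algebra_simps)
    moreover from this have "Re z \<noteq> 0"
      using False by (intro notI) simp
    ultimately have Re: "Re (1 / z) = 1 / 2"
      by (simp add: Re_divide cmod_power2[symmetric])
    have s1: "s + 1 = 1 / z + complex_of_real e" by (simp add: s_def)
    have Res: "Re s = -1/2 + e" using Re by (simp add: s_def)
    have "1 / 2 \<le> \<bar>Re (s + 1)\<bar>" using Res by (simp add: e_def)
    also have "\<dots> \<le> cmod (s + 1)" by (rule abs_Re_le_cmod)
    finally have half: "1 / 2 \<le> cmod (s + 1)" .
    then have nz: "s + 1 \<noteq> 0" by auto
    have "1 / cmod (s + 1) \<le> 1 / (1 / 2)"
      using half by (intro frac_le) auto
    then have inv: "cmod (1 / (s + 1)) \<le> 2"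
      by (simp add: norm_divide)
    have z2: "cmod z \<le> 2"
      using z norm_triangle_ineq[of "z - 1" 1] by simp
    have "1 / (s + 1) - z = - (complex_of_real e * z * (1 / (s + 1)))"
      using nz False unfolding s1 by (simp add: field_simps)
    then have "cmod (1 / (s + 1) - z) = e * cmod z * cmod (1 / (s + 1))"
      by (simp only: norm_minus_cancel norm_mult norm_of_real) (simp add: e_def)
    also have "\<dots> \<le> e * 2 * 2"
      using inv z2 by (intro mult_mono) (auto simp: e_def)
    also have "\<dots> = 2 * t * t" by (simp add: e_def power2_eq_square)
    also have "\<dots> \<le> 2 * t" using t by (simp add: mult_left_le)
    finally have 1: "cmod (1 / (s + 1) - z) \<le> 2 * t" .
    have "sqrt (2 * Re s + 1) = t"
      using t by (simp add: Res e_def)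
    then have "cmod (1 / (s + 1)) * sqrt (2 * Re s + 1) \<le> 2 * t"
      using inv t by (simp add: mult_right_mono del: norm_one)
    with 1 t(3) have "cmod (1 / (s + 1)) * sqrt (2 * Re s + 1) + cmod (1 / (s + 1) - z) \<le> d"
      by linarith
    moreover have "Re s > -1/2"
      using Res t by (simp add: e_def)
    ultimately show ?thesis
      by (intro *[of s])
  qed
qed

section \<open>Laplace transform of a power\<close>

lemma powr_complex_measurable' [measurable (raw)]:
  assumes [measurable]: "f \<in> borel_measurable M"
  shows "(\<lambda>x. complex_of_real (f x) powr s) \<in> borel_measurable M"
  using measurable_compose[OF assms, of "\<lambda>u. complex_of_real u powr s" borel] powr_complex_measurable[of s]
  by simp

definition laplace_integrand :: "complex \<Rightarrow> complex \<Rightarrow> real \<Rightarrow> complex" where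
  "laplace_integrand \<alpha> w t = indicator {0<..} t *\<^sub>R (complex_of_real t powr (\<alpha> - 1) * exp (- (w * complex_of_real t)))"

lemma laplace_integrand_measurable [measurable]: "laplace_integrand \<alpha> w \<in> borel_measurable lborel"
  unfolding laplace_integrand_def[abs_def] by measurable

lemma norm_laplace_integrand:
  "cmod (laplace_integrand \<alpha> w t) = indicator {0<..} t * (t powr (Re \<alpha> - 1) * exp (- (Re w * t)))"
  by (auto simp: laplace_integrand_def norm_mult norm_powr_real_powr indicator_def)

lemma laplace_integrand_integrable:
  assumes "Re \<alpha> > 0" "Re w > 0"
  shows "integrable lborel (laplace_integrand \<alpha> w)"
proof -
  let ?f = "\<lambda>t. complex_of_real t powr (\<alpha> - 1) / of_real (exp (Re w * t))"
  have "integrable lborel (\<lambda>t. indicator {0<..} t *\<^sub>R ?f t)"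
    by (rule lborel_integral_HK(1)[OF _ absolutely_integrable_Gamma_integral[OF assms]]) measurable
  then show ?thesis
    by (rule Bochner_Integration.integrable_bound)
      (auto simp: norm_laplace_integrand norm_divide norm_powr_real_powr exp_minus field_simps indicator_def)
qed

lemma laplace_integral_real:
  assumes \<alpha>: "Re \<alpha> > 0" and c: "c > (0::real)"
  shows "(\<integral>t. laplace_integrand \<alpha> (of_real c) t \<partial>lborel) = Gamma \<alpha> / of_real c powr \<alpha>"
proof -
  let ?f = "\<lambda>t. complex_of_real t powr (\<alpha> - 1) / of_real (exp t)"
  have "Gamma \<alpha> = (\<integral>t. indicator {0<..} t *\<^sub>R ?f t \<partial>lborel)"
    using lborel_integral_HK(2)[OF _ absolutely_integrable_Gamma_integral'[OF \<alpha>]]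
      Gamma_integral_complex'[OF \<alpha>] by (simp add: integral_unique)
  also have "\<dots> = complex_of_real \<bar>c\<bar> * (\<integral>t. indicator {0<..} (c * t) *\<^sub>R ?f (c * t) \<partial>lborel)"
    using c by (intro integral_scale) auto
  also have "(\<integral>t. indicator {0<..} (c * t) *\<^sub>R ?f (c * t) \<partial>lborel)
      = (\<integral>t. of_real c powr (\<alpha> - 1) * laplace_integrand \<alpha> (of_real c) t \<partial>lborel)"
    using c by (intro Bochner_Integration.integral_cong)
      (auto simp: laplace_integrand_def indicator_def zero_less_mult_iff powr_times_real exp_minus
        field_simps exp_of_real[symmetric])
  finally have "Gamma \<alpha> = of_real c powr \<alpha> * (\<integral>t. laplace_integrand \<alpha> (of_real c) t \<partial>lborel)"
    using c by (simp add: powr_diff)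
  then show ?thesis
    using c by simp
qed

text \<open>
  From real to complex \<open>w\<close> by a binomial series: expand \<open>e\<^bsup>-w t\<^esup>\<close> around a real point \<open>c\<close> with
  \<open>\<bar>c - w\<bar> < c\<close>. The terms are integrals with real parameter, the partial sums are dominated by
  the integrand with real parameter \<open>c - \<bar>c - w\<bar> > 0\<close>, and the series of integrals is the
  binomial series of \<open>(w / c)\<^bsup>- \<alpha>\<^esup>\<close>.
\<close>

lemma laplace_integral:
  assumes \<alpha>: "Re \<alpha> > 0" and w: "Re w > 0"
  shows "(\<integral>t. laplace_integrand \<alpha> w t \<partial>lborel) = Gamma \<alpha> / w powr \<alpha>"
proof -
  (* the disc around c of radius c contains w exactly when 2 c Re w > |w|^2 *)
  define c where "c = (cmod w)\<^sup>2 / Re w"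
  define d where "d = complex_of_real c - w"
  have w0: "w \<noteq> 0" using w by auto
  then have c: "c > 0" using w by (simp add: c_def)
  have "(cmod d)\<^sup>2 = c\<^sup>2 - (2 * c * Re w - (cmod w)\<^sup>2)"
    unfolding d_def cmod_power2 by (simp add: power2_eq_square algebra_simps)
  also have "2 * c * Re w - (cmod w)\<^sup>2 = (cmod w)\<^sup>2"
    using w by (simp add: c_def)
  finally have "(cmod d)\<^sup>2 < c\<^sup>2" using w0 by simp
  then have dc: "cmod d < c" using c by (simp add: power2_less_imp_less)
  define F where "F k t = (d ^ k / fact k) * laplace_integrand (\<alpha> + of_nat k) (of_real c) t" for k t
  have F_eq: "F k t = laplace_integrand \<alpha> (of_real c) t * ((d * of_real t) ^ k / fact k)" for k t
    by (auto simp: F_def laplace_integrand_def indicator_def powr_add powr_diff power_mult_distrib field_simps)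
  have Fint: "integrable lborel (F k)" for k
    unfolding F_def using \<alpha> c by (intro integrable_mult_right laplace_integrand_integrable) auto
  have lim: "(\<lambda>n. \<integral>t. (\<Sum>k<n. F k t) \<partial>lborel) \<longlonglongrightarrow> (\<integral>t. laplace_integrand \<alpha> w t \<partial>lborel)"
  proof (rule integral_dominated_convergence)
    show "integrable lborel (\<lambda>t. cmod (laplace_integrand \<alpha> (of_real (c - cmod d)) t))"
      using \<alpha> dc by (intro integrable_norm laplace_integrand_integrable) auto
    show "(\<lambda>t. \<Sum>k<n. F k t) \<in> borel_measurable lborel" for n
      using Fint by (intro borel_measurable_sum) auto
    show "AE t in lborel. (\<lambda>n. \<Sum>k<n. F k t) \<longlonglongrightarrow> laplace_integrand \<alpha> w t"
    proof (intro AE_I2)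
      fix t
      have "(\<lambda>k. laplace_integrand \<alpha> (of_real c) t * ((d * of_real t) ^ k / fact k))
          sums (laplace_integrand \<alpha> (of_real c) t * exp (d * of_real t))"
        using exp_converges[of "d * of_real t"] by (intro sums_mult) (simp add: scaleR_conv_of_real field_simps)
      also have "laplace_integrand \<alpha> (of_real c) t * exp (d * of_real t) = laplace_integrand \<alpha> w t"
      proof -
        have "exp (- (of_real c * of_real t)) * exp (d * of_real t) = exp (- (w * complex_of_real t))"
          by (simp add: d_def exp_add[symmetric] algebra_simps)
        then show ?thesis
          by (simp add: laplace_integrand_def mult.assoc)
      qed
      finally show "(\<lambda>n. \<Sum>k<n. F k t) \<longlonglongrightarrow> laplace_integrand \<alpha> w t"
        by (simp add: F_eq sums_def)
    qed
    show "AE t in lborel. norm (\<Sum>k<n. F k t) \<le> cmod (laplace_integrand \<alpha> (of_real (c - cmod d)) t)" for n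
    proof (intro AE_I2)
      fix t :: real
      show "norm (\<Sum>k<n. F k t) \<le> cmod (laplace_integrand \<alpha> (of_real (c - cmod d)) t)"
      proof (cases "t > 0")
        case True
        have "norm (\<Sum>k<n. F k t) \<le> (\<Sum>k<n. cmod (F k t))"
          by (rule norm_sum)
        also have "\<dots> = cmod (laplace_integrand \<alpha> (of_real c) t) * (\<Sum>k<n. (cmod d * t) ^ k / fact k)"
          using True by (simp add: F_eq norm_mult norm_divide norm_power sum_distrib_left)
        also have "(\<Sum>k<n. (cmod d * t) ^ k / fact k) \<le> exp (cmod d * t)"
          unfolding exp_def using True summable_exp_generic[of "cmod d * t"]
          by (intro order_trans[OF _ sum_le_suminf]) (auto simp: field_simps)
        also have "cmod (laplace_integrand \<alpha> (of_real c) t) * exp (cmod d * t)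
            = cmod (laplace_integrand \<alpha> (of_real (c - cmod d)) t)"
          using True by (simp add: norm_laplace_integrand exp_diff[symmetric] exp_add[symmetric] algebra_simps)
        finally show ?thesis by (simp add: mult_left_mono)
      qed (simp add: F_eq laplace_integrand_def)
    qed
  qed measurable
  have nonpos: "\<alpha> \<notin> \<int>\<^sub>\<le>\<^sub>0" using \<alpha> by (auto elim!: nonpos_Ints_cases)
  define y where "y = d / of_real c"
  have coeff: "(\<integral>t. F k t \<partial>lborel) = Gamma \<alpha> / of_real c powr \<alpha> * (((- \<alpha>) gchoose k) * (- y) ^ k)" for k
  proof -
    have "(\<integral>t. F k t \<partial>lborel) = (d ^ k / fact k) * (Gamma (\<alpha> + of_nat k) / of_real c powr (\<alpha> + of_nat k))"
      unfolding F_def using \<alpha> c by (simp add: laplace_integral_real)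
    also have "Gamma (\<alpha> + of_nat k) = pochhammer \<alpha> k * Gamma \<alpha>"
      using nonpos by (simp add: pochhammer_Gamma Gamma_eq_zero_iff)
    also have "complex_of_real c powr (\<alpha> + of_nat k) = of_real c powr \<alpha> * of_real c ^ k"
      using c by (simp add: powr_add powr_nat)
    also have "(d ^ k / fact k) * (pochhammer \<alpha> k * Gamma \<alpha> / (of_real c powr \<alpha> * of_real c ^ k))
        = Gamma \<alpha> / of_real c powr \<alpha> * (((- \<alpha>) gchoose k) * (- y) ^ k)"
      by (simp add: gbinomial_pochhammer y_def power_divide power_minus[of "d / _"] mult_ac)
    finally show ?thesis .
  qed
  have ny: "cmod (- y) < 1"
    using dc c by (simp add: y_def norm_divide)
  have "(\<lambda>k. Gamma \<alpha> / of_real c powr \<alpha> * (((- \<alpha>) gchoose k) * (- y) ^ k))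
      sums (Gamma \<alpha> / of_real c powr \<alpha> * (1 + - y) powr (- \<alpha>))"
    by (intro sums_mult gen_binomial_complex ny)
  then have "(\<lambda>n. \<Sum>k<n. \<integral>t. F k t \<partial>lborel) \<longlonglongrightarrow> Gamma \<alpha> / of_real c powr \<alpha> * (1 + - y) powr (- \<alpha>)"
    by (simp add: sums_def coeff)
  moreover have "(\<integral>t. (\<Sum>k<n. F k t) \<partial>lborel) = (\<Sum>k<n. \<integral>t. F k t \<partial>lborel)" for n
    by (intro Bochner_Integration.integral_sum Fint)
  ultimately have eq: "(\<integral>t. laplace_integrand \<alpha> w t \<partial>lborel) = Gamma \<alpha> / of_real c powr \<alpha> * (1 + - y) powr (- \<alpha>)"
    using lim LIMSEQ_unique by fastforce
  have wc: "w = of_real c * (1 + - y)"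
    using c by (simp add: y_def d_def field_simps)
  have "1 + - y \<noteq> 0" using wc w0 by auto
  then have "Ln (of_real c * (1 + - y)) = of_real (ln c) + Ln (1 + - y)"
    using Ln_times_of_real[of c "1 + - y"] c by (simp add: Ln_of_real)
  then have "Ln w = of_real (ln c) + Ln (1 + - y)"
    by (simp only: wc[symmetric])
  then have "w powr \<alpha> = of_real c powr \<alpha> * (1 + - y) powr \<alpha>"
    using c w0 \<open>1 + - y \<noteq> 0\<close> by (simp add: powr_def Ln_of_real distrib_left exp_add)
  then show ?thesis
    by (simp add: eq powr_minus field_simps)
qed

definition log_kernel :: "complex \<Rightarrow> real \<Rightarrow> complex" where
  "log_kernel \<alpha> u = complex_of_real (ln (1 / u)) powr (\<alpha> - 1)"

lemma log_kernel_measurable [measurable]: "log_kernel \<alpha> \<in> borel_measurable lborel"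
  unfolding log_kernel_def[abs_def] by measurable

text \<open>
  The substitution \<open>u = e\<^bsup>-t\<^esup>\<close> turns the Laplace transform of a power into the Mellin transform of a
  power of the logarithm.
\<close>

lemma log_kernel_mellin:
  assumes \<alpha>: "Re \<alpha> > 0" and w: "Re w > 0"
  shows "integrable lborel (\<lambda>u. on_unit (log_kernel \<alpha>) u * complex_of_real u powr (w - 1))"
    and "(\<integral>u. on_unit (log_kernel \<alpha>) u * complex_of_real u powr (w - 1) \<partial>lborel) = Gamma \<alpha> / w powr \<alpha>"
proof -
  define f where "f u = log_kernel \<alpha> u * complex_of_real u powr (w - 1)" for u
  have img: "(\<lambda>t. exp (- t)) ` {0<..} = {0<..<1::real}"
  proof (intro equalityI subsetI)
    fix u :: real assume "u \<in> {0<..<1}"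
    then show "u \<in> (\<lambda>t. exp (- t)) ` {0<..}"
      by (intro image_eqI[of _ _ "- ln u"]) auto
  qed auto
  have sub: "\<bar>- exp (- t)\<bar> *\<^sub>R f (exp (- t)) = complex_of_real t powr (\<alpha> - 1) * exp (- (w * complex_of_real t))"
    if "t \<in> {0<..}" for t :: real
  proof -
    have "complex_of_real (exp (- t)) powr (w - 1) = exp ((w - 1) * of_real (- t))"
      by (simp add: powr_def Ln_of_real)
    moreover have "exp (- complex_of_real t) * exp ((w - 1) * of_real (- t)) = exp (- (w * complex_of_real t))"
      by (simp add: exp_add[symmetric] algebra_simps)
    ultimately show ?thesis
      by (simp add: f_def log_kernel_def exp_minus ln_div scaleR_conv_of_real exp_of_real[symmetric] mult_ac)
        (simp add: exp_minus[symmetric] ln_inverse mult_ac)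
  qed
  have abs_t: "(\<lambda>t. complex_of_real t powr (\<alpha> - 1) * exp (- (w * complex_of_real t))) absolutely_integrable_on {0<..}"
    using laplace_integrand_integrable[OF assms]
    by (simp add: set_integrable_def integrable_completion laplace_integrand_def[abs_def])
  have int_t: "integral {0<..} (\<lambda>t. complex_of_real t powr (\<alpha> - 1) * exp (- (w * complex_of_real t))) = Gamma \<alpha> / w powr \<alpha>"
    using lborel_integral_HK(2)[OF _ abs_t] laplace_integral[OF assms]
    by (simp add: laplace_integrand_def)
  have "(\<lambda>t. \<bar>- exp (- t)\<bar> *\<^sub>R f (exp (- t))) absolutely_integrable_on {0<..} \<and>
      integral {0<..} (\<lambda>t. \<bar>- exp (- t)\<bar> *\<^sub>R f (exp (- t))) = Gamma \<alpha> / w powr \<alpha>"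
  proof -
    have "(\<lambda>t. \<bar>- exp (- t)\<bar> *\<^sub>R f (exp (- t))) absolutely_integrable_on {0<..} \<longleftrightarrow>
        (\<lambda>t. complex_of_real t powr (\<alpha> - 1) * exp (- (w * complex_of_real t))) absolutely_integrable_on {0<..}"
      by (intro set_integrable_cong refl sub)
    moreover have "integral {0<..} (\<lambda>t. \<bar>- exp (- t)\<bar> *\<^sub>R f (exp (- t)))
        = integral {0<..} (\<lambda>t. complex_of_real t powr (\<alpha> - 1) * exp (- (w * complex_of_real t)))"
      by (intro Henstock_Kurzweil_Integration.integral_cong sub)
    ultimately show ?thesis
      using abs_t int_t by simp
  qed
  then have "f absolutely_integrable_on ((\<lambda>t. exp (- t)) ` {0<..}) \<and>
      integral ((\<lambda>t. exp (- t)) ` {0<..}) f = Gamma \<alpha> / w powr \<alpha>"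
    by (subst (asm) has_absolute_integral_change_of_variables_real)
      (auto intro!: derivative_eq_intros inj_onI)
  then have f: "f absolutely_integrable_on {0<..<1}" "integral {0<..<1} f = Gamma \<alpha> / w powr \<alpha>"
    by (auto simp: img)
  have eq: "on_unit (log_kernel \<alpha>) u * complex_of_real u powr (w - 1) = indicator {0<..<1} u *\<^sub>R f u" for u
    by (simp add: on_unit_def f_def indicator_def)
  have meas: "(\<lambda>u. indicator {0<..<1} u *\<^sub>R f u) \<in> borel_measurable lborel"
    unfolding f_def by measurable
  show "integrable lborel (\<lambda>u. on_unit (log_kernel \<alpha>) u * complex_of_real u powr (w - 1))"
    "(\<integral>u. on_unit (log_kernel \<alpha>) u * complex_of_real u powr (w - 1) \<partial>lborel) = Gamma \<alpha> / w powr \<alpha>"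
    using lborel_integral_HK[OF meas f(1)] f(2) by (simp_all add: eq)
qed

section \<open>Operators with kernel on the unit interval as functions of the Cesaro operator\<close>

interpretation cesaro: circle_pair cesaro cesaro_adj
proof
  show "complex_linear cesaro"
    unfolding cesaro_eq_kernel_op by (rule kernel_op_linear[OF admissible_unit_power])
qed (auto simp: cesaro_adjoint cesaro_mult_adj adj_mult_cesaro unit_circle_at_1_iff
    cesaro_approx_eigenvector)

text \<open>
  The eigenvalue of the average with kernel \<open>\<phi>\<close> at the power \<open>x\<^bsup>1/z - 1\<^esup>\<close>, at which the Cesaro
  operator has eigenvalue \<open>z\<close>. At \<open>z = 0\<close> the value is the limit along the circle.
\<close>

definition mellin_symbol :: "(real \<Rightarrow> complex) \<Rightarrow> complex \<Rightarrow> complex" where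
  "mellin_symbol \<phi> z = (if z = 0 then 0 else
     (\<integral>u. on_unit \<phi> u * complex_of_real u powr (1 / z - 1) \<partial>lborel))"

definition transforms_to_symbol :: "(real \<Rightarrow> complex) \<Rightarrow> bool" where
  "transforms_to_symbol \<phi> \<longleftrightarrow> admissible (on_unit \<phi>) \<and>
     cesaro.represents (mellin_symbol \<phi>) (kernel_op (on_unit \<phi>))"

lemma Re_on_circle:
  assumes "z \<in> unit_circle_at_1"
  shows "(cmod z)\<^sup>2 = 2 * Re z"
proof -
  have "(cmod (z - 1))\<^sup>2 = 1"
    using assms by (simp add: unit_circle_at_1_iff)
  then show ?thesis
    by (simp only: cmod_power2) (simp add: power2_eq_square algebra_simps)
qed

lemma Re_pos_on_circle:
  assumes "z \<in> unit_circle_at_1" "z \<noteq> 0"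
  shows "Re z > 0" "Re (1 / z) = 1 / 2"
proof -
  have eq: "(cmod z)\<^sup>2 = 2 * Re z"
    by (rule Re_on_circle[OF assms(1)])
  moreover have "(cmod z)\<^sup>2 > 0" using assms(2) by simp
  ultimately show "Re z > 0" by linarith
  with eq show "Re (1 / z) = 1 / 2"
    by (simp add: Re_divide cmod_power2[symmetric])
qed

text \<open>
  On the circle \<open>Re (1/z) = 1/2\<close>, so the Mellin transform is dominated by the very weight that bounds
  the operator norm. This makes function and operator converge together.
\<close>

lemma norm_mellin_integrand:
  assumes "z \<in> unit_circle_at_1" "z \<noteq> 0"
  shows "cmod (on_unit \<phi> u * complex_of_real u powr (1 / z - 1)) = cmod (on_unit \<phi> u) / sqrt \<bar>u\<bar>"
proof (cases "0 < u \<and> u < 1")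
  case True
  have "cmod (complex_of_real u powr (1 / z - 1)) = u powr (Re (1 / z) - 1)"
    using True by (simp add: norm_powr_real_powr)
  also have "\<dots> = u powr (-1/2)"
    unfolding Re_pos_on_circle(2)[OF assms] by simp
  also have "\<dots> = 1 / sqrt \<bar>u\<bar>"
    using True by (simp add: powr_minus powr_half_sqrt inverse_eq_divide)
  finally show ?thesis
    by (simp add: norm_mult)
qed (auto simp: on_unit_def)

lemma mellin_integrable:
  assumes "admissible (on_unit \<phi>)" "z \<in> unit_circle_at_1" "z \<noteq> 0"
  shows "integrable lborel (\<lambda>u. on_unit \<phi> u * complex_of_real u powr (1 / z - 1))"
proof (rule Bochner_Integration.integrable_bound)
  note [measurable] = admissible_measurable[OF assms(1)]
  show "integrable lborel (\<lambda>u. cmod (on_unit \<phi> u) / sqrt \<bar>u\<bar>)"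
    using assms(1) by (simp add: admissible_def)
  show "(\<lambda>u. on_unit \<phi> u * complex_of_real u powr (1 / z - 1)) \<in> borel_measurable lborel"
    by measurable
qed (simp only: norm_mellin_integrand[OF assms(2,3)], simp)

lemma mellin_symbol_bound:
  assumes "admissible (on_unit \<phi>)" "z \<in> unit_circle_at_1"
  shows "cmod (mellin_symbol \<phi> z) \<le> kernel_norm (on_unit \<phi>)"
proof (cases "z = 0")
  case False
  have "cmod (mellin_symbol \<phi> z) \<le> (\<integral>u. cmod (on_unit \<phi> u * complex_of_real u powr (1 / z - 1)) \<partial>lborel)"
    using False by (simp add: mellin_symbol_def integral_norm_bound)
  also have "\<dots> = kernel_norm (on_unit \<phi>)"
    unfolding norm_mellin_integrand[OF assms(2) False] kernel_norm_def ..
  finally show ?thesis .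
qed (simp add: mellin_symbol_def kernel_norm_nonneg)

lemma on_unit_add: "on_unit (\<lambda>u. \<phi> u + \<psi> u) = (\<lambda>u. on_unit \<phi> u + on_unit \<psi> u)"
  by (auto simp: on_unit_def)

lemma on_unit_cmult: "on_unit (\<lambda>u. c * \<phi> u) = (\<lambda>u. c * on_unit \<phi> u)"
  by (auto simp: on_unit_def)

lemma transforms_add:
  assumes "transforms_to_symbol \<phi>" "transforms_to_symbol \<psi>"
  shows "transforms_to_symbol (\<lambda>u. \<phi> u + \<psi> u)"
proof -
  have adm: "admissible (on_unit \<phi>)" "admissible (on_unit \<psi>)"
    using assms by (auto simp: transforms_to_symbol_def)
  have "cesaro.represents (\<lambda>z. mellin_symbol \<phi> z + mellin_symbol \<psi> z)
      (kernel_op (on_unit \<phi>) + kernel_op (on_unit \<psi>))"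
    using assms by (intro cesaro.represents_add) (auto simp: transforms_to_symbol_def)
  then have "cesaro.represents (mellin_symbol (\<lambda>u. \<phi> u + \<psi> u)) (kernel_op (on_unit (\<lambda>u. \<phi> u + \<psi> u)))"
    unfolding on_unit_add kernel_op_add[OF adm]
  proof (rule cesaro.represents_cong)
    fix z assume "z \<in> unit_circle_at_1"
    then show "mellin_symbol \<phi> z + mellin_symbol \<psi> z = mellin_symbol (\<lambda>u. \<phi> u + \<psi> u) z"
      by (cases "z = 0") (simp_all add: mellin_symbol_def on_unit_add distrib_right mellin_integrable adm)
  qed
  then show ?thesis
    using admissible_add[OF adm] by (simp add: transforms_to_symbol_def on_unit_add)
qed

lemma transforms_cmult:
  assumes "transforms_to_symbol \<phi>"
  shows "transforms_to_symbol (\<lambda>u. c * \<phi> u)"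
proof -
  have adm: "admissible (on_unit \<phi>)"
    using assms by (auto simp: transforms_to_symbol_def)
  have "scalar_op c o\<^sub>L kernel_op (on_unit \<phi>) = kernel_op (\<lambda>u. c * on_unit \<phi> u)"
    by (intro blinfun_eqI) (simp add: scalar_op_apply kernel_op_cmult[OF adm])
  moreover have "cesaro.represents (\<lambda>z. c * mellin_symbol \<phi> z) (scalar_op c o\<^sub>L kernel_op (on_unit \<phi>))"
    using assms by (intro cesaro.represents_mult cesaro.represents_const) (auto simp: transforms_to_symbol_def)
  moreover have "(\<lambda>z. c * mellin_symbol \<phi> z) = mellin_symbol (\<lambda>u. c * \<phi> u)"
    by (auto simp: mellin_symbol_def on_unit_cmult mult.assoc)
  ultimately show ?thesis
    using admissible_cmult[OF adm] by (simp add: transforms_to_symbol_def on_unit_cmult)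
qed

text \<open>
  The resolvent identity determines the average once \<open>1 + n C\<close> is invertible, and it is because
  \<open>1 + n z\<close> has positive real part on the circle.
\<close>

lemma transforms_power: "transforms_to_symbol (\<lambda>u. complex_of_real u ^ n)"
proof -
  have nz: "1 + of_nat n * z \<noteq> 0" if "z \<in> unit_circle_at_1" for z
  proof -
    have "Re z \<ge> 0"
      using Re_on_circle[OF that] zero_le_power2[of "cmod z"] by linarith
    then have "Re (1 + of_nat n * z) > 0" by (simp add: add_pos_nonneg)
    then show ?thesis by (intro notI) (simp only: zero_complex.sel)
  qed
  then have "continuous_on unit_circle_at_1 (\<lambda>z. 1 / (1 + of_nat n * z))"
    by (intro continuous_intros) auto
  then obtain S where S: "cesaro.represents (\<lambda>z. 1 / (1 + of_nat n * z)) S"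
    using cesaro.represents_exists by blast
  have prod: "cesaro.represents (\<lambda>z. 1 / (1 + of_nat n * z) * (1 + of_nat n * z))
      (S o\<^sub>L (scalar_op 1 + (scalar_op (of_nat n) o\<^sub>L cesaro)))"
    by (intro cesaro.represents_mult cesaro.represents_add cesaro.represents_const cesaro.represents_id S)
  have id: "S o\<^sub>L (scalar_op 1 + (scalar_op (of_nat n) o\<^sub>L cesaro)) = scalar_op 1"
    by (rule cesaro.represents_unique[OF prod cesaro.represents_const]) (use nz in auto)
  have "kernel_op (unit_power n) = S o\<^sub>L cesaro"
  proof (rule blinfun_eqI)
    fix f
    have "(S o\<^sub>L (scalar_op 1 + (scalar_op (of_nat n) o\<^sub>L cesaro))) (kernel_op (unit_power n) f)
        = S (cesaro f)"
      by (simp add: blinfun.add_left scalar_op_apply scaleC_one cesaro_unit_power)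
    then show "kernel_op (unit_power n) f = (S o\<^sub>L cesaro) f"
      by (simp add: id scalar_op_apply scaleC_one)
  qed
  moreover have "cesaro.represents (\<lambda>z. 1 / (1 + of_nat n * z) * z) (S o\<^sub>L cesaro)"
    by (intro cesaro.represents_mult S cesaro.represents_id)
  then have "cesaro.represents (mellin_symbol (\<lambda>u. complex_of_real u ^ n)) (S o\<^sub>L cesaro)"
  proof (rule cesaro.represents_cong)
    fix z assume z: "z \<in> unit_circle_at_1"
    show "1 / (1 + of_nat n * z) * z = mellin_symbol (\<lambda>u. complex_of_real u ^ n) z"
    proof (cases "z = 0")
      case False
      have "on_unit (\<lambda>u. complex_of_real u ^ n) u * complex_of_real u powr (1 / z - 1)
          = on_unit (\<lambda>u. complex_of_real u powr (of_nat n + 1 / z - 1)) u" for u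
        by (simp add: on_unit_def powr_nat' powr_add[symmetric] powr_diff powr_add powr_nat)
      then have "mellin_symbol (\<lambda>u. complex_of_real u ^ n) z = 1 / (of_nat n + 1 / z - 1 + 1)"
        using False Re_pos_on_circle(2)[OF z False]
        by (simp only: mellin_symbol_def if_False) (subst unit_powr_integral; simp)
      then show ?thesis
        using False by (simp add: field_simps)
    qed (simp add: mellin_symbol_def)
  qed
  ultimately show ?thesis
    using admissible_unit_power[of n] by (simp add: transforms_to_symbol_def unit_power_def)
qed

lemma transforms_limit:
  assumes adm: "admissible (on_unit \<phi>)"
    and approx: "\<And>e. e > 0 \<Longrightarrow> \<exists>\<psi>. transforms_to_symbol \<psi> \<and> kernel_norm (on_unit (\<lambda>u. \<phi> u - \<psi> u)) \<le> e"
  shows "transforms_to_symbol \<phi>"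
proof -
  have "cesaro.represents (mellin_symbol \<phi>) (kernel_op (on_unit \<phi>))"
  proof (rule cesaro.represents_closed)
    fix e :: real assume "e > 0"
    then obtain \<psi> where \<psi>: "transforms_to_symbol \<psi>" "kernel_norm (on_unit (\<lambda>u. \<phi> u - \<psi> u)) \<le> e"
      using approx by blast
    define \<theta> where "\<theta> u = \<phi> u - \<psi> u" for u
    have adm\<psi>: "admissible (on_unit \<psi>)"
      using \<psi>(1) by (simp add: transforms_to_symbol_def)
    have "on_unit \<theta> = (\<lambda>u. on_unit \<phi> u + (-1) * on_unit \<psi> u)"
      by (auto simp: on_unit_def \<theta>_def)
    then have adm\<theta>: "admissible (on_unit \<theta>)"
      using admissible_add[OF adm admissible_cmult[OF adm\<psi>, of "-1"]] by simp
    have \<phi>: "\<phi> = (\<lambda>u. \<psi> u + \<theta> u)" by (simp add: \<theta>_def)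
    have \<theta>e: "kernel_norm (on_unit \<theta>) \<le> e"
      using \<psi>(2) by (simp add: \<theta>_def[abs_def])
    show "\<exists>g B. cesaro.represents g B \<and> (\<forall>z\<in>unit_circle_at_1. cmod (mellin_symbol \<phi> z - g z) \<le> e) \<and>
        norm (kernel_op (on_unit \<phi>) - B) \<le> e"
    proof (intro exI conjI ballI)
      show "cesaro.represents (mellin_symbol \<psi>) (kernel_op (on_unit \<psi>))"
        using \<psi>(1) by (simp add: transforms_to_symbol_def)
      have "kernel_op (on_unit \<phi>) - kernel_op (on_unit \<psi>) = kernel_op (on_unit \<theta>)"
        by (simp add: \<phi> on_unit_add kernel_op_add[OF adm\<psi> adm\<theta>])
      then show "norm (kernel_op (on_unit \<phi>) - kernel_op (on_unit \<psi>)) \<le> e"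
        using norm_kernel_op[OF adm\<theta>] \<theta>e by simp
      fix z assume z: "z \<in> unit_circle_at_1"
      have "mellin_symbol \<phi> z - mellin_symbol \<psi> z = mellin_symbol \<theta> z"
        using z by (cases "z = 0")
          (simp_all add: mellin_symbol_def \<phi> on_unit_add distrib_right mellin_integrable adm\<psi> adm\<theta>)
      then show "cmod (mellin_symbol \<phi> z - mellin_symbol \<psi> z) \<le> e"
        using mellin_symbol_bound[OF adm\<theta> z] \<theta>e by simp
    qed
  qed
  with adm show ?thesis by (simp add: transforms_to_symbol_def)
qed

lemma transforms_real_polynomial:
  assumes "real_polynomial_function q"
  shows "transforms_to_symbol (\<lambda>u. complex_of_real (q u))"
proof -
  obtain a n where q: "q = (\<lambda>u. \<Sum>i\<le>n. a i * u ^ i)"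
    using assms by (auto simp: real_polynomial_function_iff_sum)
  have "transforms_to_symbol (\<lambda>u. \<Sum>i\<le>m. complex_of_real (a i) * complex_of_real u ^ i)" for m
    by (induction m) (auto intro: transforms_add transforms_cmult[OF transforms_power]
        simp del: power_0 power_Suc)
  then show ?thesis by (simp add: q)
qed

lemma kernel_norm_le:
  assumes "\<phi> \<in> borel_measurable lborel" "\<And>u. 0 < u \<Longrightarrow> u < 1 \<Longrightarrow> cmod (\<phi> u) \<le> B"
  shows "kernel_norm (on_unit \<phi>) \<le> 2 * B"
proof -
  have "kernel_norm (on_unit \<phi>) \<le> (\<integral>u. B * (indicator {0<..<1} u *\<^sub>R u powr (-1/2)) \<partial>lborel)"
    unfolding kernel_norm_def
  proof (rule integral_mono)
    show "integrable lborel (\<lambda>u. cmod (on_unit \<phi> u) / sqrt \<bar>u\<bar>)"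
      using admissible_on_unit[OF assms] by (simp add: admissible_def)
    show "integrable lborel (\<lambda>u. B * (indicator {0<..<1} u *\<^sub>R u powr (-1/2)))"
      by (intro integrable_mult_right unit_powr_real) simp
    show "cmod (on_unit \<phi> u) / sqrt \<bar>u\<bar> \<le> B * (indicator {0<..<1} u *\<^sub>R u powr (-1/2))" for u
      using assms(2)[of u]
      by (auto simp: on_unit_def indicator_def powr_minus powr_half_sqrt inverse_eq_divide divide_right_mono)
  qed
  also have "\<dots> = B * (\<integral>u. indicator {0<..<1} u *\<^sub>R u powr (-1/2) \<partial>lborel)"
    by (rule integral_mult_right_zero)
  also have "(\<integral>u. indicator {0<..<1} u *\<^sub>R u powr (-1/2) \<partial>lborel) = (2 :: real)"
    by (subst unit_powr_real(2)) auto
  finally show ?thesis by simp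
qed

text \<open>
  Uniform approximation by polynomials is more than approximation in the weighted norm, as
  \<open>u\<^bsup>-1/2\<^esup>\<close> has integral 2 on the unit interval.
\<close>

lemma transforms_continuous:
  assumes cont: "continuous_on UNIV \<psi>"
  shows "transforms_to_symbol \<psi>"
proof (rule transforms_limit)
  have [measurable]: "\<psi> \<in> borel_measurable lborel"
    using borel_measurable_continuous_onI[OF cont] by simp
  have cont01: "continuous_on {0..1} \<psi>"
    using cont by (rule continuous_on_subset) auto
  have "bounded (\<psi> ` {0..1})"
    by (intro compact_imp_bounded compact_continuous_image cont01) auto
  then obtain B where "\<forall>u\<in>{0..1}. cmod (\<psi> u) \<le> B"
    unfolding bounded_iff by blast
  then show "admissible (on_unit \<psi>)"
    by (intro admissible_on_unit[where B = B]) auto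
  fix e :: real assume "e > 0"
  then have "e / 2 > 0" by simp
  then obtain g where g: "polynomial_function g" "\<forall>u\<in>{0..1}. cmod (\<psi> u - g u) < e / 2"
    using Stone_Weierstrass_polynomial_function[OF compact_Icc cont01] by blast
  have "real_polynomial_function (Re \<circ> g)" "real_polynomial_function (Im \<circ> g)"
    using g(1) bounded_linear_Re bounded_linear_Im by (auto simp: polynomial_function_def)
  then have "transforms_to_symbol (\<lambda>u. complex_of_real (Re (g u)) + \<i> * complex_of_real (Im (g u)))"
    using transforms_real_polynomial[of "Re \<circ> g"] transforms_real_polynomial[of "Im \<circ> g"]
    by (intro transforms_add transforms_cmult) auto
  moreover have "(\<lambda>u. complex_of_real (Re (g u)) + \<i> * complex_of_real (Im (g u))) = g"
    by (auto simp: complex_eq_iff)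
  ultimately have "transforms_to_symbol g" by simp
  moreover have "continuous_on UNIV g"
    using g(1) by (rule continuous_on_polymonial_function)
  then have [measurable]: "g \<in> borel_measurable lborel"
    using borel_measurable_continuous_onI by simp
  have "kernel_norm (on_unit (\<lambda>u. \<psi> u - g u)) \<le> 2 * (e / 2)"
    using g(2) by (intro kernel_norm_le) (auto simp: less_imp_le)
  ultimately show "\<exists>\<psi>'. transforms_to_symbol \<psi>' \<and> kernel_norm (on_unit (\<lambda>u. \<psi> u - \<psi>' u)) \<le> e"
    by auto
qed

text \<open>
  A kernel with singular endpoints, such as a power of \<open>log (1/u)\<close>, is multiplied by a continuous
  cut-off that vanishes near both endpoints; dominated convergence removes the cut-off.
\<close>

lemma transforms_continuous_open:
  assumes adm: "admissible (on_unit \<phi>)" and cont: "continuous_on {0<..<1} \<phi>"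
  shows "transforms_to_symbol \<phi>"
proof (rule transforms_limit[OF adm])
  note [measurable] = admissible_measurable[OF adm]
  define \<eta> :: "nat \<Rightarrow> real \<Rightarrow> real" where "\<eta> m u = max 0 (min 1 (real m * (u * (1 - u)) - 1))" for m u
  define \<delta> :: "nat \<Rightarrow> real" where "\<delta> m = 1 / (real m + 2)" for m
  (* clamping the argument only matters where the cut-off is zero, and makes the product continuous on the line *)
  define \<psi> where "\<psi> m u = \<phi> (max (\<delta> m) (min (1 - \<delta> m) u)) * complex_of_real (\<eta> m u)" for m u
  have \<delta>: "0 < \<delta> m" "\<delta> m < 1" for m by (auto simp: \<delta>_def field_simps)
  have cont_\<psi>: "continuous_on UNIV (\<psi> m)" for m
  proof -
    have "\<delta> m \<le> 1 - \<delta> m" by (simp add: \<delta>_def field_simps)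
    then have "continuous_on UNIV (\<lambda>u. \<phi> (max (\<delta> m) (min (1 - \<delta> m) u)))"
      using \<delta>[of m] by (intro continuous_on_compose2[OF cont] continuous_intros) auto
    then show ?thesis
      unfolding \<psi>_def \<eta>_def by (intro continuous_intros)
  qed
  have cut: "\<psi> m u = \<phi> u * complex_of_real (\<eta> m u)" if u: "0 < u" "u < 1" for m u
  proof (cases "\<eta> m u = 0")
    case False
    then have m: "1 < real m * (u * (1 - u))"
      by (auto simp: \<eta>_def max_def min_def split: if_splits)
    then have "m > 0" using u by (cases m) auto
    have "real m * (u * (1 - u)) \<le> real m * u" "real m * (u * (1 - u)) \<le> real m * (1 - u)"
      using u by (auto intro!: mult_left_mono simp: mult_left_le mult_left_le_one_le)
    with m have "1 < real m * u" "1 < real m * (1 - u)" by linarith+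
    then have "1 \<le> (real m + 2) * u" "1 \<le> (real m + 2) * (1 - u)"
      using u by (auto simp: distrib_right)
    then have "\<delta> m \<le> u" "\<delta> m \<le> 1 - u"
      by (auto simp: \<delta>_def divide_le_eq mult.commute)
    then have "max (\<delta> m) (min (1 - \<delta> m) u) = u" by simp
    then show ?thesis by (simp only: \<psi>_def)
  qed (simp add: \<psi>_def)
  have "(\<lambda>m. kernel_norm (on_unit (\<lambda>u. \<phi> u - \<psi> m u))) \<longlonglongrightarrow> (\<integral>u. 0 \<partial>(lborel :: real measure))"
    unfolding kernel_norm_def
  proof (rule integral_dominated_convergence)
    show "integrable lborel (\<lambda>u. cmod (on_unit \<phi> u) / sqrt \<bar>u\<bar>)"
      using adm by (simp add: admissible_def)
    have eq: "on_unit (\<lambda>u. \<phi> u - \<psi> m u) = (\<lambda>u. on_unit \<phi> u * complex_of_real (1 - \<eta> m u))" for m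
      by (auto simp: on_unit_def cut algebra_simps)
    have [measurable]: "\<eta> m \<in> borel_measurable lborel" for m
      unfolding \<eta>_def[abs_def] by measurable
    show "(\<lambda>u. cmod (on_unit (\<lambda>u. \<phi> u - \<psi> m u) u) / sqrt \<bar>u\<bar>) \<in> borel_measurable lborel" for m
      unfolding eq by measurable
    show "AE u in lborel. norm (cmod (on_unit (\<lambda>u. \<phi> u - \<psi> m u) u) / sqrt \<bar>u\<bar>)
        \<le> cmod (on_unit \<phi> u) / sqrt \<bar>u\<bar>" for m
    proof (intro AE_I2)
      fix u
      have "\<bar>1 - \<eta> m u\<bar> \<le> 1" by (simp add: \<eta>_def)
      then have "cmod (on_unit \<phi> u) * \<bar>1 - \<eta> m u\<bar> \<le> cmod (on_unit \<phi> u)"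
        by (simp add: mult_left_le)
      then show "norm (cmod (on_unit (\<lambda>u. \<phi> u - \<psi> m u) u) / sqrt \<bar>u\<bar>) \<le> cmod (on_unit \<phi> u) / sqrt \<bar>u\<bar>"
        unfolding eq norm_mult norm_of_real by (simp add: divide_right_mono)
    qed
    show "AE u in lborel. (\<lambda>m. cmod (on_unit (\<lambda>u. \<phi> u - \<psi> m u) u) / sqrt \<bar>u\<bar>) \<longlonglongrightarrow> 0"
    proof (intro AE_I2)
      fix u :: real
      show "(\<lambda>m. cmod (on_unit (\<lambda>u. \<phi> u - \<psi> m u) u) / sqrt \<bar>u\<bar>) \<longlonglongrightarrow> 0"
      proof (cases "0 < u \<and> u < 1")
        case True
        then have pos: "u * (1 - u) > 0" by simp
        obtain M :: nat where M: "2 / (u * (1 - u)) \<le> real M"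
          using real_arch_simple by blast
        have "\<eta> m u = 1" if "m \<ge> M" for m
        proof -
          have "2 \<le> real M * (u * (1 - u))"
            using M pos by (simp add: pos_divide_le_eq)
          also have "\<dots> \<le> real m * (u * (1 - u))"
            using that pos by (intro mult_right_mono) auto
          finally show ?thesis by (simp add: \<eta>_def)
        qed
        then have "eventually (\<lambda>m. cmod (on_unit (\<lambda>u. \<phi> u - \<psi> m u) u) / sqrt \<bar>u\<bar> = 0) sequentially"
          unfolding eventually_sequentially eq by auto
        then show ?thesis
          by (rule tendsto_eventually)
      next
        case False
        then have "on_unit (\<lambda>u. \<phi> u - \<psi> m u) u = 0" for m
          by (auto simp: on_unit_def)
        then show ?thesis by simp
      qed
    qed
  qed simp
  then have lim: "(\<lambda>m. kernel_norm (on_unit (\<lambda>u. \<phi> u - \<psi> m u))) \<longlonglongrightarrow> 0" by simp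
  fix e :: real assume "e > 0"
  then obtain m where "kernel_norm (on_unit (\<lambda>u. \<phi> u - \<psi> m u)) < e"
    using order_tendstoD(2)[OF lim] by (auto simp: eventually_sequentially)
  then show "\<exists>\<psi>. transforms_to_symbol \<psi> \<and> kernel_norm (on_unit (\<lambda>u. \<phi> u - \<psi> u)) \<le> e"
    using transforms_continuous[OF cont_\<psi>] by (auto intro!: exI[of _ "\<psi> m"])
qed

section \<open>The Hoelder operator\<close>

lemma admissible_log_kernel:
  assumes "Re \<alpha> > 0"
  shows "admissible (on_unit (log_kernel \<alpha>))"
  unfolding admissible_def
proof
  have "integrable lborel (\<lambda>u. cmod (on_unit (log_kernel \<alpha>) u * complex_of_real u powr (1 / 2 - 1)))"
    using assms by (intro integrable_norm log_kernel_mellin) auto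
  moreover have "2 \<in> unit_circle_at_1" by (simp add: unit_circle_at_1_iff)
  ultimately show "integrable lborel (\<lambda>u. cmod (on_unit (log_kernel \<alpha>) u) / sqrt \<bar>u\<bar>)"
    using norm_mellin_integrand[of 2 "log_kernel \<alpha>"] by simp
qed measurable

lemma continuous_log_kernel: "continuous_on {0<..<1} (log_kernel \<alpha>)"
  unfolding log_kernel_def by (intro continuous_intros) (auto simp: ln_div)

lemma hoelder_eq_kernel_op: "hoelder \<alpha> = kernel_op (on_unit (\<lambda>u. 1 / Gamma \<alpha> * log_kernel \<alpha> u))"
proof -
  have "(1 / Gamma \<alpha>) * (LBINT u=0..1. complex_of_real (ln (1 / u)) powr (\<alpha> - 1) * f (u * x))
      = dilation_average (on_unit (\<lambda>u. 1 / Gamma \<alpha> * log_kernel \<alpha> u)) f x" for f x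
  proof -
    have "(LBINT u=0..1. complex_of_real (ln (1 / u)) powr (\<alpha> - 1) * f (u * x))
        = (\<integral>u. on_unit (log_kernel \<alpha>) u * f (u * x) \<partial>lborel)"
      by (simp add: interval_lebesgue_integral_def set_lebesgue_integral_def zero_ereal_def one_ereal_def
          einterval_eq on_unit_eq_indicator log_kernel_def del: ereal_eq_0 ereal_eq_1)
    then show ?thesis
      by (simp only: dilation_average_def on_unit_cmult mult.assoc integral_mult_right_zero)
  qed
  then show ?thesis
    unfolding hoelder_def kernel_op_def by simp
qed

lemma mellin_symbol_hoelder:
  assumes \<alpha>: "Re \<alpha> > 0" and z: "z \<in> unit_circle_at_1"
  shows "mellin_symbol (\<lambda>u. 1 / Gamma \<alpha> * log_kernel \<alpha> u) z = z powr \<alpha>"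
proof (cases "z = 0")
  case False
  have pos: "Re z > 0" "Re (1 / z) > 0"
    using Re_pos_on_circle[OF z False] by simp_all
  have "Gamma \<alpha> \<noteq> 0"
    using \<alpha> by (auto simp: Gamma_eq_zero_iff elim!: nonpos_Ints_cases)
  moreover have "mellin_symbol (\<lambda>u. 1 / Gamma \<alpha> * log_kernel \<alpha> u) z
      = 1 / Gamma \<alpha> * (Gamma \<alpha> / (1 / z) powr \<alpha>)"
    unfolding log_kernel_mellin(2)[OF \<alpha> pos(2), symmetric] using False
    by (simp only: mellin_symbol_def on_unit_cmult mult.assoc integral_mult_right_zero if_False)
  moreover have "(1 / z) powr \<alpha> = 1 / z powr \<alpha>"
  proof -
    have "z \<notin> \<real>\<^sub>\<le>\<^sub>0" using pos(1) by (auto simp: complex_nonpos_Reals_iff)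
    then have "Ln (1 / z) = - Ln z"
      by (simp add: Ln_inverse flip: inverse_eq_divide)
    then show ?thesis
      using False by (simp add: powr_def exp_minus inverse_eq_divide)
  qed
  ultimately show ?thesis by simp
qed (simp add: mellin_symbol_def)

theorem theorem7:
  fixes \<alpha> :: complex
  assumes "Re \<alpha> > 0"
  shows "apply_fun (\<lambda>z. z powr \<alpha>) cesaro = hoelder \<alpha>"
proof (rule cesaro.apply_fun_eqI)
  show "continuous_on unit_circle_at_1 (\<lambda>z. z powr \<alpha>)"
    using assms Re_pos_on_circle(1) by (intro continuous_intros) (force dest: less_imp_le)+
  have "transforms_to_symbol (\<lambda>u. 1 / Gamma \<alpha> * log_kernel \<alpha> u)"
    by (intro transforms_cmult transforms_continuous_open admissible_log_kernel assms continuous_log_kernel)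
  then have "cesaro.represents (mellin_symbol (\<lambda>u. 1 / Gamma \<alpha> * log_kernel \<alpha> u)) (hoelder \<alpha>)"
    by (simp add: transforms_to_symbol_def hoelder_eq_kernel_op)
  then show "cesaro.represents (\<lambda>z. z powr \<alpha>) (hoelder \<alpha>)"
    by (rule cesaro.represents_cong) (rule mellin_symbol_hoelder[OF assms])
qed

end
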